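(* Let $1/4<H<1$, $T>0$, let $b,\sigma$ satisfy the standing assumption (A) of the context, and let $\bar X$ solve $\bar X_t'=b_t(\bar X_t)$, $\bar X_0=x_0$ on $[0,T]$. Let $\mathcal A$ be either the fixed-endpoint space $\mathcal H^{\sigma,T}_{H;x_0,x_T}$ with $x_T=\bar X_T$, or the free-endpoint space $x_0+\mathcal H_H^\sigma([0,T];\mathbb R^n)$. Let $\beta\in(0,H)$ be such that $\mathcal H_H^\sigma([0,T];\mathbb R^n)\hookrightarrow C^\beta([0,T];\mathbb R^n)$ continuously. Then there exists $C>0$, independent of $\epsilon$, such that every global minimizer $\phi^\epsilon$ of $J_\epsilon$ over $\mathcal A$ satisfies $$\|\phi^\epsilon-\bar X\|_\beta\le C\epsilon .$$
   Context: Standing assumption (A): $b\in C_b^{1,3}([0,T]\times\mathbb R^n;\mathbb R^n)$ (bounded, with bounded continuous derivatives up to order one in $t$ and order three in $x$); $\sigma_t=\operatorname{diag}(\sigma_t^1,\dots,\sigma_t^n)$ with $\sigma^i\in C^1([0,T])$ and $0<m_i\le\sigma_t^i\le M_i$. $\nabla\cdot$ acts in the space variable. The noise intensity $\epsilon$ ranges over $(0,\infty)$. For $f$ on $[0,T]$ with $f_0=0$, $\|f\|_\beta=\sup_{s\ne t}|f_t-f_s|/|t-s|^\beta$. Kernel, for $0<s<t$: $K_H(t,s)=c_H\left[(t/s)^{H-\frac12}(t-s)^{H-\frac12}-(H-\frac12)s^{\frac12-H}\int_s^tu^{H-\frac32}(u-s)^{H-\frac12}du\right]$, $c_H=\sqrt{\frac{2H\Gamma(3/2-H)}{\Gamma(H+1/2)\Gamma(2-2H)}}$.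 For $u\in L^2([0,T];\mathbb R^n)$: $(K_Hu)(t)=\int_0^tK_H(t,s)u(s)ds$, $(K_H^\sigma u)(t)=\int_0^t\sigma_s\,d(K_Hu)(s)$ (Young integral). $K_H^\sigma$ is injective; $\mathcal H_H^\sigma([0,T];\mathbb R^n):=K_H^\sigma(L^2)$ with norm $\|h\|_{\mathcal H_H^\sigma}=\|(K_H^\sigma)^{-1}h\|_{L^2(0,T)}$. $d_H=\sqrt{2H\Gamma(H+\frac12)\Gamma(\frac32-H)/\Gamma(2-2H)}$. For $\phi\in x_0+\mathcal H_H^\sigma([0,T];\mathbb R^n)$, $$J_\epsilon(\phi)=\frac1{2\epsilon}\int_0^T\left|(K_H^\sigma)^{-1}\left(\phi_\cdot-x_0-\int_0^\cdot b_s(\phi_s)ds\right)(t)\right|^2dt+\frac{d_H}2\int_0^T\nabla\cdot b_t(\phi_t)\,dt .$$ $\mathcal H^{\sigma,T}_{H;x_0,x_T}=\{\phi\in x_0+\mathcal H_H^\sigma([0,T];\mathbb R^n):\phi_T=x_T\}$. *)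

theory Defs
  imports "HOL-Analysis.Analysis"
begin

text \<open>
  The class \<open>C\<^sub>b\<^sup>1\<^sup>,\<^sup>3([0,T] \<times> \<real>\<^sup>n; \<real>\<^sup>n)\<close>: \<open>b\<close>, \<open>\<partial>\<^sub>t b\<close> and the Frechet derivatives
  \<open>D\<^sub>x b\<close>, \<open>D\<^sub>x\<^sup>2 b\<close>, \<open>D\<^sub>x\<^sup>3 b\<close> exist and are bounded and jointly continuous.  Mixed derivatives
  \<open>\<partial>\<^sub>t D\<^sub>x b\<close> are not required.
\<close>

definition bdd_cont_on :: "real \<Rightarrow> (real \<Rightarrow> 'a::euclidean_space \<Rightarrow> 'b::real_normed_vector) \<Rightarrow> bool" where
  "bdd_cont_on T f \<longleftrightarrow>
     bounded ((\<lambda>(t, x). f t x) ` ({0..T} \<times> UNIV)) \<and>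
     continuous_on ({0..T} \<times> UNIV) (\<lambda>(t, x). f t x)"

definition Cb13 :: "real \<Rightarrow> (real \<Rightarrow> real^'n \<Rightarrow> real^'n) \<Rightarrow> bool" where
  "Cb13 T b \<longleftrightarrow>
     bdd_cont_on T b \<and>
     (\<exists>bt :: real \<Rightarrow> real^'n \<Rightarrow> real^'n.
        bdd_cont_on T bt \<and>
        (\<forall>t\<in>{0..T}. \<forall>x. ((\<lambda>s. b s x) has_vector_derivative bt t x) (at t within {0..T}))) \<and>
     (\<exists>(b1 :: real \<Rightarrow> real^'n \<Rightarrow> (real^'n) \<Rightarrow>\<^sub>L (real^'n))
       (b2 :: real \<Rightarrow> real^'n \<Rightarrow> (real^'n) \<Rightarrow>\<^sub>L ((real^'n) \<Rightarrow>\<^sub>L (real^'n)))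
       (b3 :: real \<Rightarrow> real^'n \<Rightarrow> (real^'n) \<Rightarrow>\<^sub>L ((real^'n) \<Rightarrow>\<^sub>L ((real^'n) \<Rightarrow>\<^sub>L (real^'n)))).
        bdd_cont_on T b1 \<and> bdd_cont_on T b2 \<and> bdd_cont_on T b3 \<and>
        (\<forall>t\<in>{0..T}. \<forall>x.
           (b t has_derivative blinfun_apply (b1 t x)) (at x) \<and>
           (b1 t has_derivative blinfun_apply (b2 t x)) (at x) \<and>
           (b2 t has_derivative blinfun_apply (b3 t x)) (at x)))"

definition C1_on :: "real \<Rightarrow> (real \<Rightarrow> real) \<Rightarrow> bool" where
  "C1_on T f \<longleftrightarrow>
     (\<exists>f'. continuous_on {0..T} f' \<and>
        (\<forall>t\<in>{0..T}. (f has_real_derivative f' t) (at t within {0..T})))"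

definition diffusion_coeff :: "real \<Rightarrow> (real \<Rightarrow> real^'n^'n) \<Rightarrow> bool" where
  "diffusion_coeff T \<sigma> \<longleftrightarrow>
     (\<forall>t\<in>{0..T}. \<forall>i j. i \<noteq> j \<longrightarrow> \<sigma> t $ i $ j = 0) \<and>
     (\<forall>i. C1_on T (\<lambda>t. \<sigma> t $ i $ i)) \<and>
     (\<forall>i. \<exists>m M. 0 < m \<and> (\<forall>t\<in>{0..T}. m \<le> \<sigma> t $ i $ i \<and> \<sigma> t $ i $ i \<le> M))"

definition divergence :: "(real^'n \<Rightarrow> real^'n) \<Rightarrow> real^'n \<Rightarrow> real" where
  "divergence f x = (\<Sum>i\<in>UNIV. frechet_derivative f (at x) (axis i 1) $ i)"

text \<open>
  Paths on \<open>[0,T]\<close> are total functions on the reals; every notion below depends only on their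
  values on \<open>[0,T]\<close>.  The homogeneous Hoelder norm takes values in \<^typ>\<open>ereal\<close>, so it is
  infinite for paths outside \<open>C\<^sup>\<beta>\<close>.
\<close>

definition holder_norm :: "real \<Rightarrow> real \<Rightarrow> (real \<Rightarrow> 'a::real_normed_vector) \<Rightarrow> ereal" where
  "holder_norm T \<beta> f =
     (SUP (s, t) \<in> {(s, t). s \<in> {0..T} \<and> t \<in> {0..T} \<and> s \<noteq> t}.
        ereal (norm (f t - f s) / \<bar>t - s\<bar> powr \<beta>))"

definition L2 :: "real \<Rightarrow> (real \<Rightarrow> real^'n) set" where
  "L2 T = {u. set_borel_measurable lborel {0..T} u \<and>
              set_integrable lborel {0..T} (\<lambda>t. (norm (u t))\<^sup>2)}"

definition L2_norm :: "real \<Rightarrow> (real \<Rightarrow> real^'n) \<Rightarrow> real" where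
  "L2_norm T u = sqrt (LINT t:{0..T}|lborel. (norm (u t))\<^sup>2)"

definition c_H :: "real \<Rightarrow> real" where
  "c_H H = sqrt (2 * H * Gamma (3/2 - H) / (Gamma (H + 1/2) * Gamma (2 - 2 * H)))"

definition d_H :: "real \<Rightarrow> real" where
  "d_H H = sqrt (2 * H * Gamma (H + 1/2) * Gamma (3/2 - H) / Gamma (2 - 2 * H))"

definition K_kernel :: "real \<Rightarrow> real \<Rightarrow> real \<Rightarrow> real" where
  "K_kernel H t s = c_H H *
     ((t / s) powr (H - 1/2) * (t - s) powr (H - 1/2)
      - (H - 1/2) * s powr (1/2 - H) *
        (LINT u:{s<..<t}|lborel. u powr (H - 3/2) * (u - s) powr (H - 1/2)))"

definition K_op :: "real \<Rightarrow> (real \<Rightarrow> real^'n) \<Rightarrow> real \<Rightarrow> real^'n" where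
  "K_op H u t = (LINT s:{0<..<t}|lborel. K_kernel H t s *\<^sub>R u s)"

text \<open>
  The Young integral of a matrix-valued integrand against a vector-valued path is the limit of
  Riemann-Stieltjes sums as the mesh tends to zero.  The radius \<open>\<delta>\<close> is a constant, so that
  \<open>fine\<close> is a bound on the mesh and not a Henstock gauge.
\<close>

definition has_young_integral ::
  "(real \<Rightarrow> real^'n^'m) \<Rightarrow> (real \<Rightarrow> real^'n) \<Rightarrow> real^'m \<Rightarrow> real \<Rightarrow> real \<Rightarrow> bool" where
  "has_young_integral A g I a b \<longleftrightarrow>
     (\<forall>e>0. \<exists>\<delta>>0. \<forall>p. p tagged_division_of {a..b} \<and> (\<lambda>x. ball x \<delta>) fine p \<longrightarrow>
        norm ((\<Sum>(x, k)\<in>p. A x *v (g (Sup k) - g (Inf k))) - I) < e)"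

definition young_integral ::
  "(real \<Rightarrow> real^'n^'m) \<Rightarrow> (real \<Rightarrow> real^'n) \<Rightarrow> real \<Rightarrow> real \<Rightarrow> real^'m" where
  "young_integral A g a b = (THE I. has_young_integral A g I a b)"

definition K_sigma :: "real \<Rightarrow> (real \<Rightarrow> real^'n^'n) \<Rightarrow> (real \<Rightarrow> real^'n) \<Rightarrow> real \<Rightarrow> real^'n" where
  "K_sigma H \<sigma> u t = young_integral \<sigma> (K_op H u) 0 t"

definition CM_space :: "real \<Rightarrow> real \<Rightarrow> (real \<Rightarrow> real^'n^'n) \<Rightarrow> (real \<Rightarrow> real^'n) set" where
  "CM_space H T \<sigma> = {h. \<exists>u\<in>L2 T. \<forall>t\<in>{0..T}. h t = K_sigma H \<sigma> u t}"

text \<open>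
  Elements of \<^term>\<open>L2 T\<close> are functions, not classes.  As \<open>K\<^sub>H\<^sup>\<sigma>\<close> is injective on classes, the
  preimage chosen here is determined up to a null set of \<open>[0,T]\<close>, and it is only used under
  integrals over \<open>[0,T]\<close>.
\<close>

definition K_sigma_inv ::
  "real \<Rightarrow> real \<Rightarrow> (real \<Rightarrow> real^'n^'n) \<Rightarrow> (real \<Rightarrow> real^'n) \<Rightarrow> real \<Rightarrow> real^'n" where
  "K_sigma_inv H T \<sigma> h = (SOME u. u \<in> L2 T \<and> (\<forall>t\<in>{0..T}. h t = K_sigma H \<sigma> u t))"

definition CM_norm :: "real \<Rightarrow> real \<Rightarrow> (real \<Rightarrow> real^'n^'n) \<Rightarrow> (real \<Rightarrow> real^'n) \<Rightarrow> real" where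
  "CM_norm H T \<sigma> h = L2_norm T (K_sigma_inv H T \<sigma> h)"

definition embeds_in_holder :: "real \<Rightarrow> real \<Rightarrow> (real \<Rightarrow> real^'n^'n) \<Rightarrow> real \<Rightarrow> bool" where
  "embeds_in_holder H T \<sigma> \<beta> \<longleftrightarrow>
     (\<exists>L. \<forall>h\<in>CM_space H T \<sigma>. holder_norm T \<beta> h \<le> ereal (L * CM_norm H T \<sigma> h))"

definition free_paths ::
  "real \<Rightarrow> real \<Rightarrow> (real \<Rightarrow> real^'n^'n) \<Rightarrow> real^'n \<Rightarrow> (real \<Rightarrow> real^'n) set" where
  "free_paths H T \<sigma> x0 = {\<phi>. (\<lambda>t. \<phi> t - x0) \<in> CM_space H T \<sigma>}"

definition bridge_paths ::
  "real \<Rightarrow> real \<Rightarrow> (real \<Rightarrow> real^'n^'n) \<Rightarrow> real^'n \<Rightarrow> real^'n \<Rightarrow> (real \<Rightarrow> real^'n) set" where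
  "bridge_paths H T \<sigma> x0 xT = {\<phi> \<in> free_paths H T \<sigma> x0. \<phi> T = xT}"

definition J ::
  "real \<Rightarrow> real \<Rightarrow> (real \<Rightarrow> real^'n \<Rightarrow> real^'n) \<Rightarrow> (real \<Rightarrow> real^'n^'n) \<Rightarrow> real^'n \<Rightarrow> real
    \<Rightarrow> (real \<Rightarrow> real^'n) \<Rightarrow> real" where
  "J H T b \<sigma> x0 \<epsilon> \<phi> =
     1 / (2 * \<epsilon>) *
       (LINT t:{0..T}|lborel.
          (norm (K_sigma_inv H T \<sigma> (\<lambda>r. \<phi> r - x0 - (LINT s:{0..r}|lborel. b s (\<phi> s))) t))\<^sup>2)
     + d_H H / 2 * (LINT t:{0..T}|lborel. divergence (b t) (\<phi> t))"

end

theory Submission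
  imports Defs
begin

text \<open>
  Put \<open>a = H - 1/2\<close> and \<open>G(t) = \<integral>\<^sub>0\<^sup>t (t - s)\<^sup>a s\<^sup>-\<^sup>a u(s) ds\<close>.  By Fubini's theorem,
  \<open>(K\<^sub>H u)(t) = c\<^sub>H (t\<^sup>a G(t) - a \<integral>\<^sub>0\<^sup>t r\<^sup>a\<^sup>-\<^sup>1 G(r) dr)\<close> for both signs of \<open>a\<close>, so injectivity of \<open>K\<^sub>H\<close>
  and the solution of \<open>K\<^sub>H u = \<integral> f\<close> reduce to an Abel equation.  It is solvable in \<open>L\<^sup>2\<close> for
  continuous \<open>f\<close> (Hoelder continuous of an order above \<open>a\<close> if \<open>a > 0\<close>); integration by parts in the
  Young integral and Gronwall's lemma carry this over to \<open>K\<^sub>H\<^sup>\<sigma>\<close>.  Hence \<open>\<integral> b(\<phi>)\<close> lies in the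
  Cameron--Martin space for every admissible \<open>\<phi>\<close>, the zero-noise path \<open>X\<close> is admissible, and its
  quadratic energy is zero.

  For a minimizer \<open>\<phi>\<close> and \<open>h = \<phi> - x\<^sub>0 - \<integral> b(\<phi>)\<close>, comparison with \<open>X\<close> gives
  \<open>\<parallel>h\<parallel>\<^sup>2 \<le> \<epsilon> d\<^sub>H \<integral> (div b(X) - div b(\<phi>))\<close>.  By Gronwall and the embedding the right-hand side is at
  most \<open>const \<sqdot> \<epsilon> \<parallel>h\<parallel>\<close>, so \<open>\<parallel>h\<parallel> = O(\<epsilon>)\<close>, and \<open>\<phi> - X\<close> is controlled by \<open>h\<close> in \<open>C\<^sup>\<beta>\<close>.
\<close>

subsection \<open>Riemann--Liouville kernels\<close>

text \<open>\<open>K_sigma_inv\<close> selects a preimage by choice, so the energy in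
  \<open>J\<close> carries information only if two facts are known. The path \<open>h\<close> must
  lie in the range of \<open>K_sigma\<close>, since otherwise the selected function is arbitrary;
  this forces the solvability analysis for the drift integral. And every preimage of the zero path
  must be null, since otherwise \<open>X\<close> need not have zero energy; this is the one place
  where injectivity enters. Two thresholds shape the estimates. The contraction behind injectivity
  has factor below 1 for negative \<open>a\<close> exactly when \<open>H > 1/4\<close>. For
  \<open>H > 1/2\<close> the Abel equation asks for a fractional derivative of order
  \<open>a\<close>, so the drift along a path must be Hoelder of an order above
  \<open>H - 1/2\<close>; the given \<beta> may be too small for that, and the order 1/2 of
  Cameron--Martin paths is proved directly from the kernel. The rate is linear in \<epsilon> because
  the cost of leaving \<open>X\<close> is quadratic in the norm of \<open>h\<close>, while the
  possible gain in the divergence term is only linear in it.\<close>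

definition rker :: "real \<Rightarrow> real \<Rightarrow> real" where
  "rker p x = (if 0 < x then x powr (p - 1) else 0)"

text \<open>The Riemann--Liouville integral without the factor \<open>1 / \<Gamma>(p)\<close>; for \<open>v\<close> vanishing on negative times
  it is \<open>\<integral>\<^sub>0\<^sup>t (t - s)\<^sup>p\<^sup>-\<^sup>1 v(s) ds\<close>.\<close>

definition RL :: "real \<Rightarrow> (real \<Rightarrow> real) \<Rightarrow> real \<Rightarrow> real" where
  "RL p v t = (LBINT s. rker p (t - s) * v s)"

lemma rker_measurable [measurable]: "rker p \<in> borel_measurable borel"
  unfolding rker_def by measurable

lemma rker_nonneg [simp]: "0 \<le> rker p x"
  by (simp add: rker_def)

lemma rker_nonpos [simp]: "x \<le> 0 \<Longrightarrow> rker p x = 0"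
  by (simp add: rker_def)

text \<open>The cutoff at zero makes the rule hold for indices of any sign. Non-integrable weights
  such as \<open>rker 0 s\<close> and \<open>rker (- a) x\<close> can therefore be combined with
  integrable ones before anything is integrated.\<close>

lemma rker_mult: "rker p x * rker q x = rker (p + q - 1) x"
  by (simp add: rker_def algebra_simps flip: powr_add)

lemma rker_1 [simp]: "rker 1 x = indicator {0<..} x"
  by (simp add: rker_def)

lemma Beta_real_pos: "0 < p \<Longrightarrow> 0 < q \<Longrightarrow> 0 < Beta p (q::real)"
  unfolding Beta_def by simp

lemma Beta_1_left:
  assumes "0 < q"
  shows "Beta 1 (q::real) = 1 / q"
proof -
  have "Gamma (1 + q) = q * Gamma q"
    using Gamma_plus1[of q] assms by (auto simp: add.commute nonpos_Ints_def)
  moreover have "Gamma q \<noteq> 0"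
    using Gamma_real_pos[OF assms] by simp
  ultimately show ?thesis
    using assms by (simp add: Beta_def)
qed

lemma nn_integral_rker_conv_unit:
  assumes "0 < p" "0 < q"
  shows "(\<integral>\<^sup>+s. ennreal (rker q (1 - s) * rker p s) \<partial>lborel) = ennreal (Beta p q)"
proof -
  have "((\<lambda>t. t powr (p - 1) * (1 - t) powr (q - 1)) has_integral Beta p q) {0..1}"
    using assms by (rule has_integral_Beta_real)
  then have "((\<lambda>t. t powr (p - 1) * (1 - t) powr (q - 1)) has_integral Beta p q) {0<..<1}"
    using has_integral_Icc_iff_Ioo by blast
  then have "(\<integral>\<^sup>+s. ennreal (indicator {0<..<1} s * (s powr (p - 1) * (1 - s) powr (q - 1))) \<partial>lborel)
      = ennreal (Beta p q)"
    by (intro nn_integral_has_integral_lebesgue) auto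
  moreover have "rker q (1 - s) * rker p s
      = indicator {0<..<1} s * (s powr (p - 1) * (1 - s) powr (q - 1))" for s
    by (auto simp: rker_def split: split_indicator)
  ultimately show ?thesis
    by simp
qed

text \<open>The substitution \<open>s = r + (t - r) * x\<close> scales the integral to the Beta
  integral on the unit interval. The nonnegative integral is used because it yields integrability
  and the value at once.\<close>

lemma nn_integral_rker_conv:
  assumes "0 < p" "0 < q"
  shows "(\<integral>\<^sup>+s. ennreal (rker q (t - s) * rker p (s - r)) \<partial>lborel)
    = ennreal (Beta p q * rker (p + q) (t - r))"
proof (cases "r < t")
  case False
  then have "(\<lambda>s. ennreal (rker q (t - s) * rker p (s - r))) = (\<lambda>s. 0)"
    by (auto simp: rker_def)
  with False show ?thesis
    by simp
next
  case True
  define d where "d = t - r"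
  have d: "d > 0" using True by (simp add: d_def)
  have scale: "rker q (t - (r + d * x)) * rker p (r + d * x - r)
      = d powr (p + q - 2) * (rker q (1 - x) * rker p x)" for x
  proof -
    have t: "t - (r + d * x) = d * (1 - x)"
      by (simp add: d_def algebra_simps)
    have "d powr (p + q - 2) = d powr (q - 1) * d powr (p - 1)"
      by (simp flip: powr_add add: algebra_simps)
    then show ?thesis
      unfolding t using d by (simp add: rker_def zero_less_mult_iff powr_mult)
  qed
  have "(\<integral>\<^sup>+s. ennreal (rker q (t - s) * rker p (s - r)) \<partial>lborel)
    = ennreal \<bar>d\<bar> * (\<integral>\<^sup>+x. ennreal (rker q (t - (r + d * x)) * rker p (r + d * x - r)) \<partial>lborel)"
    by (subst nn_integral_real_affine[where c = d and t = r]) (use d in auto)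
  also have "\<dots> = ennreal d * (ennreal (d powr (p + q - 2)) * ennreal (Beta p q))"
    unfolding scale using d assms
    by (simp add: ennreal_mult' nn_integral_cmult flip: nn_integral_rker_conv_unit)
  also have "\<dots> = ennreal (Beta p q * (d * d powr (p + q - 2)))"
    using d assms Beta_real_pos[of p q] by (simp add: mult_ac flip: ennreal_mult)
  also have "d * d powr (p + q - 2) = rker (p + q) (t - r)"
    using True d by (simp add: rker_def d_def powr_mult_base)
  finally show ?thesis .
qed

lemma has_bochner_integral_rker_conv:
  assumes "0 < p" "0 < q"
  shows "has_bochner_integral lborel (\<lambda>s. rker q (t - s) * rker p (s - r))
    (Beta p q * rker (p + q) (t - r))"
  using assms Beta_real_pos[of p q]
  by (intro has_bochner_integral_nn_integral) (auto simp: nn_integral_rker_conv)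

lemma
  assumes "0 < p" "0 < q"
  shows integrable_rker_conv: "integrable lborel (\<lambda>s. rker q (t - s) * rker p s)"
    and integral_rker_conv:
      "(LBINT s. rker q (t - s) * rker p s) = Beta p q * rker (p + q) t"
  using has_bochner_integral_rker_conv[OF assms, of t 0]
  by (auto simp: has_bochner_integral_iff)

text \<open>Tonelli's criterion in the form needed before each use of Fubini below: the inner
  integrals of the absolute value are only estimated, by an integrable function of the outer
  variable.\<close>

lemma integrable_pair_bounded:
  fixes F :: "real \<Rightarrow> real \<Rightarrow> real"
  assumes meas: "case_prod F \<in> borel_measurable (borel \<Otimes>\<^sub>M borel)"
    and int: "\<And>x. integrable lborel (F x)"
    and bnd: "\<And>x. (LBINT y. \<bar>F x y\<bar>) \<le> B x"
    and B: "integrable lborel B"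
  shows "integrable (lborel \<Otimes>\<^sub>M lborel) (case_prod F)"
proof -
  have m: "case_prod F \<in> borel_measurable (lborel \<Otimes>\<^sub>M lborel)"
    using meas by (simp cong: measurable_cong_sets sets_pair_measure_cong)
  show ?thesis
  proof (rule lborel_pair.Fubini_integrable[OF m])
    have "(\<lambda>x. LBINT y. norm (case_prod F (x, y))) \<in> borel_measurable lborel"
      by (rule lborel.borel_measurable_lebesgue_integral) (use m in measurable)
    then show "integrable lborel (\<lambda>x. LBINT y. norm (case_prod F (x, y)))"
      by (rule Bochner_Integration.integrable_bound[OF B])
        (use bnd in \<open>auto intro!: AE_I2 order_trans[OF _ abs_ge_self]\<close>)
  qed (use int in auto)
qed

lemma RL_measurable [measurable]:
  assumes [measurable]: "v \<in> borel_measurable borel"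
  shows "RL p v \<in> borel_measurable borel"
  unfolding RL_def[abs_def]
  by measurable

lemma RL_cong: "(\<And>s. s < t \<Longrightarrow> v s = w s) \<Longrightarrow> RL p v t = RL p w t"
  unfolding RL_def by (rule Bochner_Integration.integral_cong) (auto simp: rker_def)

lemma RL_cmult: "RL p (\<lambda>s. c * v s) t = c * RL p v t"
  unfolding RL_def by (simp add: mult.left_commute)

lemma integrable_abs_le:
  fixes f g :: "real \<Rightarrow> real"
  assumes "integrable lborel g" "f \<in> borel_measurable borel" "\<And>s. \<bar>f s\<bar> \<le> g s"
  shows "integrable lborel f"
  by (rule Bochner_Integration.integrable_bound[OF assms(1)])
    (use assms(2,3) in \<open>auto intro!: AE_I2 order_trans[OF _ abs_ge_self]\<close>)

lemma integrable_rker_conv_bounded: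
  assumes pq: "0 < p" "0 < q" and [measurable]: "w \<in> borel_measurable borel"
    and w: "\<And>s. \<bar>w s\<bar> \<le> C * rker p s"
  shows "integrable lborel (\<lambda>s. rker q (t - s) * w s)"
    and "\<bar>RL q w t\<bar> \<le> C * (Beta p q * rker (p + q) t)"
proof -
  have conv: "integrable lborel (\<lambda>s. C * (rker q (t - s) * rker p s))"
    using pq by (intro integrable_mult_right integrable_rker_conv)
  have bnd: "\<bar>rker q (t - s) * w s\<bar> \<le> C * (rker q (t - s) * rker p s)" for s
    using mult_left_mono[OF w[of s], of "rker q (t - s)"] by (simp add: abs_mult mult.left_commute)
  show int: "integrable lborel (\<lambda>s. rker q (t - s) * w s)"
    by (rule integrable_abs_le[OF conv _ bnd]) measurable
  have "\<bar>RL q w t\<bar> \<le> (LBINT s. \<bar>rker q (t - s) * w s\<bar>)"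
    unfolding RL_def by (rule integral_abs_bound)
  also have "\<dots> \<le> (LBINT s. C * (rker q (t - s) * rker p s))"
    using int conv bnd by (intro integral_mono) auto
  also have "\<dots> = C * (Beta p q * rker (p + q) t)"
    using integral_rker_conv[OF pq] by simp
  finally show "\<bar>RL q w t\<bar> \<le> C * (Beta p q * rker (p + q) t)" .
qed

text \<open>Semigroup law of fractional integration. The factor \<open>Beta p q\<close> appears
  because \<open>RL\<close> lacks the normalization by the Gamma function. Since both kernels are
  nonnegative, the integral over the middle variable is exact, so integrability against the combined
  kernel suffices for Fubini.\<close>

lemma RL_RL:
  assumes pq: "0 < p" "0 < q" and [measurable]: "v \<in> borel_measurable borel"
    and int: "integrable lborel (\<lambda>s. rker (p + q) (t - s) * v s)"
  shows "RL q (RL p v) t = Beta p q * RL (p + q) v t"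
proof -
  define F where "F r s = rker q (t - s) * rker p (s - r) * v r" for r s
  have conv: "has_bochner_integral lborel (\<lambda>s. rker q (t - s) * rker p (s - r))
      (Beta p q * rker (p + q) (t - r))" for r
    using pq by (rule has_bochner_integral_rker_conv)
  have "integrable (lborel \<Otimes>\<^sub>M lborel) (case_prod F)"
  proof (rule integrable_pair_bounded)
    show "case_prod F \<in> borel_measurable (borel \<Otimes>\<^sub>M borel)"
      unfolding F_def[abs_def] by measurable
    show "integrable lborel (F r)" for r
      unfolding F_def using conv[of r] by (intro integrable_mult_left) (simp add: has_bochner_integral_iff)
    show "(LBINT s. \<bar>F r s\<bar>) \<le> Beta p q * \<bar>rker (p + q) (t - r) * v r\<bar>" for r
      unfolding F_def using conv[of r] by (simp add: abs_mult has_bochner_integral_iff)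
    show "integrable lborel (\<lambda>r. Beta p q * \<bar>rker (p + q) (t - r) * v r\<bar>)"
      using int by auto
  qed
  from lborel_pair.Fubini_integral[OF this]
  have "(LBINT s. LBINT r. F r s) = (LBINT r. LBINT s. F r s)" .
  moreover have "(LBINT s. F r s) = Beta p q * (rker (p + q) (t - r) * v r)" for r
    unfolding F_def using conv[of r] by (simp add: has_bochner_integral_iff)
  moreover have "(LBINT r. F r s) = rker q (t - s) * RL p v s" for s
    unfolding F_def RL_def by (simp add: mult.assoc)
  ultimately show ?thesis
    by (simp add: RL_def)
qed

section \<open>Elementary inequalities for powers and weighted products\<close>

lemma powr_add_le:
  fixes x y a :: real
  assumes "0 \<le> a" "a \<le> 1" "0 \<le> x" "0 \<le> y"
  shows "(x + y) powr a \<le> x powr a + y powr a"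
proof (cases "x + y = 0")
  case False
  define z where "z = x + y"
  have z: "z > 0" using assms False by (simp add: z_def)
  \<comment> \<open>A ratio in [0,1] does not exceed its power with exponent \<open>a\<close> in
    [0,1]. Adding the two instances \<open>w = x\<close> and \<open>w = y\<close> gives
    subadditivity.\<close>
  have *: "w / z * z powr a \<le> w powr a" if "0 \<le> w" "w \<le> z" for w
  proof -
    have "w / z \<le> (w / z) powr a"
      using powr_mono'[of a 1 "w / z"] that z assms by (simp add: powr_one_gt_zero_iff)
    then show ?thesis
      using z that by (simp add: powr_divide pos_le_divide_eq)
  qed
  have "z powr a = x / z * z powr a + y / z * z powr a"
    using z by (simp add: z_def flip: distrib_right add_divide_distrib)
  also have "\<dots> \<le> x powr a + y powr a"
    using assms z by (intro add_mono *) (auto simp: z_def)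
  finally show ?thesis by (simp add: z_def)
qed (use assms in \<open>auto simp: add_nonneg_eq_0_iff\<close>)

lemma powr_diff_le:
  fixes s t a :: real
  assumes "0 \<le> a" "a \<le> 1" "0 \<le> s" "s \<le> t"
  shows "t powr a - s powr a \<le> (t - s) powr a"
  using powr_add_le[of a s "t - s"] assms by simp

lemma rker_increment:
  assumes "0 \<le> a" "a \<le> 1" "0 < h"
  shows "0 \<le> rker (1 + a) (x + h) - rker (1 + a) x"
    and "rker (1 + a) (x + h) - rker (1 + a) x \<le> h powr a"
  using assms powr_diff_le[of a "max 0 x" "x + h"] powr_mono2[of a "max 0 x" "x + h"]
    powr_mono2[of a "x + h" h]
  by (auto simp: rker_def max_def split: if_splits)

text \<open>Plays the part of the Cauchy--Schwarz inequality: the weight \<open>l\<close> is later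
  chosen as a power of the time increment so that both terms have the same order. This also yields
  integrability of the product from a pointwise bound.\<close>

lemma abs_mult_le_weighted:
  fixes x y l :: real
  assumes "0 < l"
  shows "\<bar>x * y\<bar> \<le> (l * x\<^sup>2 + y\<^sup>2 / l) / 2"
proof -
  have "0 \<le> (sqrt l * \<bar>x\<bar> - \<bar>y\<bar> / sqrt l)\<^sup>2"
    by simp
  also have "\<dots> = l * x\<^sup>2 + y\<^sup>2 / l - 2 * \<bar>x * y\<bar>"
    using assms by (simp add: power2_diff power_mult_distrib power_divide abs_mult)
  finally show ?thesis
    by simp
qed

lemma rker_square: "(rker p x)\<^sup>2 = rker (2 * p - 1) x"
  by (simp add: power2_eq_square rker_mult)

lemma holder_on_imp_continuous_on:
  fixes f :: "real \<Rightarrow> 'a::real_normed_vector"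
  assumes "0 < \<gamma>"
    and "\<And>s t. s \<in> S \<Longrightarrow> t \<in> S \<Longrightarrow> s \<le> t \<Longrightarrow> norm (f t - f s) \<le> C * (t - s) powr \<gamma>"
  shows "continuous_on S f"
  unfolding continuous_on_def
proof
  fix s assume s: "s \<in> S"
  have lim: "((\<lambda>t. C * \<bar>t - s\<bar> powr \<gamma>) \<longlongrightarrow> 0) (at s within S)"
  proof -
    have "((\<lambda>t. C * \<bar>t - s\<bar> powr \<gamma>) \<longlongrightarrow> C * \<bar>s - s\<bar> powr \<gamma>) (at s within S)"
      using \<open>0 < \<gamma>\<close> by (intro tendsto_intros) (auto simp: eventually_at_filter)
    then show ?thesis by simp
  qed
  have bnd: "\<forall>\<^sub>F t in at s within S. norm (f t - f s) \<le> C * \<bar>t - s\<bar> powr \<gamma>"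
    unfolding eventually_at_filter
  proof (intro always_eventually allI impI)
    fix t assume "t \<in> S"
    then show "norm (f t - f s) \<le> C * \<bar>t - s\<bar> powr \<gamma>"
      using assms(2)[OF s, of t] assms(2)[OF _ s, of t]
      by (cases "s \<le> t") (auto simp: norm_minus_commute)
  qed
  have "((\<lambda>t. f t - f s) \<longlongrightarrow> 0) (at s within S)"
    using bnd lim by (rule Lim_null_comparison)
  then show "(f \<longlongrightarrow> f s) (at s within S)"
    by (simp add: LIM_zero_iff)
qed

section \<open>Growth and Hoelder estimates for \<open>G\<close>, the fractional integral of a
  weighted square-integrable function\<close>

definition square_integrable :: "(real \<Rightarrow> real) \<Rightarrow> bool" where
  "square_integrable u \<longleftrightarrow> u \<in> borel_measurable borel \<and> integrable lborel (\<lambda>s. (u s)\<^sup>2)"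

text \<open>With this weight the function \<open>G\<close> of the overview is
  \<open>RL (1 + a) (weighted a u)\<close>. For \<open>a = 0\<close> only the cutoff to positive
  times remains.\<close>

definition weighted :: "real \<Rightarrow> (real \<Rightarrow> real) \<Rightarrow> real \<Rightarrow> real" where
  "weighted a u s = rker (1 - a) s * u s"

lemma weighted_measurable [measurable]: "u \<in> borel_measurable borel \<Longrightarrow> weighted a u \<in> borel_measurable borel"
  unfolding weighted_def[abs_def] by measurable

text \<open>Splitting the product leaves the squared kernel \<open>(t - s)^(2a) s^(-2a)\<close>,
  whose integral is \<open>Beta (1 - 2 * a) (1 + 2 * a) * t\<close>. Both Beta arguments are
  positive exactly for \<open>a\<close> strictly between -1/2 and 1/2.\<close>

lemma RL_weighted_bound:
  assumes a: "- 1/2 < a" "a < 1/2" and u: "square_integrable u" and t: "0 < t"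
  defines "C \<equiv> (Beta (1 - 2 * a) (1 + 2 * a) + (LBINT s. (u s)\<^sup>2)) / 2"
  shows "integrable lborel (\<lambda>s. rker (1 + a) (t - s) * weighted a u s)"
    and "(LBINT s. \<bar>rker (1 + a) (t - s) * weighted a u s\<bar>) \<le> C * sqrt t"
    and "\<bar>RL (1 + a) (weighted a u) t\<bar> \<le> C * sqrt t"
proof -
  have [measurable]: "u \<in> borel_measurable borel" and u2: "integrable lborel (\<lambda>s. (u s)\<^sup>2)"
    using u by (auto simp: square_integrable_def)
  \<comment> \<open>The first term is of order \<open>l * t\<close> and the second of order
    \<open>1 / l\<close>; this choice makes both of order \<open>sqrt t\<close>.\<close>
  define l where "l = 1 / sqrt t"
  have l: "l > 0" using t by (simp add: l_def)
  define B where "B s = (l * (rker (1 + 2 * a) (t - s) * rker (1 - 2 * a) s) + (u s)\<^sup>2 / l) / 2" for s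
  have conv: "integrable lborel (\<lambda>s. rker (1 + 2 * a) (t - s) * rker (1 - 2 * a) s)"
    using a by (intro integrable_rker_conv) auto
  have B: "integrable lborel B"
    unfolding B_def[abs_def] using conv u2 by auto
  have bnd: "\<bar>rker (1 + a) (t - s) * weighted a u s\<bar> \<le> B s" for s
  proof -
    have "\<bar>(rker (1 + a) (t - s) * rker (1 - a) s) * u s\<bar>
        \<le> (l * (rker (1 + a) (t - s) * rker (1 - a) s)\<^sup>2 + (u s)\<^sup>2 / l) / 2"
      using l by (rule abs_mult_le_weighted)
    then show ?thesis
      by (simp add: B_def weighted_def power_mult_distrib rker_square mult.assoc algebra_simps)
  qed
  show int: "integrable lborel (\<lambda>s. rker (1 + a) (t - s) * weighted a u s)"
    by (rule integrable_abs_le[OF B _ bnd]) measurable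
  have "(LBINT s. \<bar>rker (1 + a) (t - s) * weighted a u s\<bar>) \<le> (LBINT s. B s)"
    using int B bnd by (intro integral_mono) auto
  also have "\<dots> = (l * (Beta (1 - 2 * a) (1 + 2 * a) * t) + (LBINT s. (u s)\<^sup>2) / l) / 2"
    unfolding B_def using conv u2 a t integral_rker_conv[of "1 - 2 * a" "1 + 2 * a" t]
    by (simp add: rker_def)
  also have "\<dots> = C * sqrt t"
    using t real_sqrt_mult_self[of t] by (simp add: C_def l_def field_simps)
  finally show "(LBINT s. \<bar>rker (1 + a) (t - s) * weighted a u s\<bar>) \<le> C * sqrt t" .
  moreover have "\<bar>RL (1 + a) (weighted a u) t\<bar> \<le> (LBINT s. \<bar>rker (1 + a) (t - s) * weighted a u s\<bar>)"
    unfolding RL_def by (rule integral_abs_bound)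
  ultimately show "\<bar>RL (1 + a) (weighted a u) t\<bar> \<le> C * sqrt t"
    by simp
qed

lemma RL_weighted_nonpos: "t \<le> 0 \<Longrightarrow> RL p (weighted a u) t = 0"
proof -
  assume "t \<le> 0"
  then have "(\<lambda>s. rker p (t - s) * weighted a u s) = (\<lambda>s. 0)"
    by (auto simp: rker_def weighted_def)
  then show ?thesis by (simp add: RL_def)
qed

lemma RL_weighted_integrable:
  assumes "- 1/2 < a" "a < 1/2" "square_integrable u"
  shows "integrable lborel (\<lambda>s. rker (1 + a) (t - s) * weighted a u s)"
proof (cases "0 < t")
  case False
  then have "(\<lambda>s. rker (1 + a) (t - s) * weighted a u s) = (\<lambda>s. 0)"
    by (auto simp: rker_def weighted_def)
  then show ?thesis by simp
qed (use RL_weighted_bound(1)[OF assms] in auto)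

lemma RL_weighted_bound_ex:
  assumes a: "- 1/2 < a" "a < 1/2" and u: "square_integrable u"
  obtains C where "0 \<le> C"
    "\<And>t. 0 \<le> t \<Longrightarrow> (LBINT s. \<bar>rker (1 + a) (t - s) * weighted a u s\<bar>) \<le> C * sqrt t"
    "\<And>t. 0 \<le> t \<Longrightarrow> \<bar>RL (1 + a) (weighted a u) t\<bar> \<le> C * sqrt t"
proof
  let ?C = "(Beta (1 - 2 * a) (1 + 2 * a) + (LBINT s. (u s)\<^sup>2)) / 2"
  have "0 \<le> Beta (1 - 2 * a) (1 + 2 * a)"
    using a by (intro less_imp_le Beta_real_pos) auto
  then show "0 \<le> ?C" by simp
  fix t :: real assume t: "0 \<le> t"
  show 1: "(LBINT s. \<bar>rker (1 + a) (t - s) * weighted a u s\<bar>) \<le> ?C * sqrt t"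
  proof (cases "t = 0")
    case True
    then have "(\<lambda>s. \<bar>rker (1 + a) (t - s) * weighted a u s\<bar>) = (\<lambda>s. 0)"
      by (auto simp: rker_def weighted_def)
    with True show ?thesis by simp
  qed (use t RL_weighted_bound(2)[OF a u] in auto)
  have "\<bar>RL (1 + a) (weighted a u) t\<bar> \<le> (LBINT s. \<bar>rker (1 + a) (t - s) * weighted a u s\<bar>)"
    unfolding RL_def by (rule integral_abs_bound)
  with 1 show "\<bar>RL (1 + a) (weighted a u) t\<bar> \<le> ?C * sqrt t" by simp
qed

text \<open>For \<open>a \<ge> 0\<close> the kernel increment \<open>D\<close> satisfies
  \<open>0 \<le> D \<le> h^a\<close>. Only one factor \<open>D\<close> is kept in each term: against
  \<open>r^(-2a)\<close> it integrates to at most a multiple of \<open>h^(1 - a)\<close>, and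
  against the square of \<open>u\<close> it is bounded by \<open>h^a\<close>.\<close>

lemma RL_weighted_holder_nonneg:
  assumes a: "0 \<le> a" "a < 1/2" and u: "square_integrable u"
  obtains C where "0 \<le> C"
    "\<And>s t. 0 \<le> s \<Longrightarrow> s < t \<Longrightarrow>
      \<bar>RL (1 + a) (weighted a u) t - RL (1 + a) (weighted a u) s\<bar> \<le> C * (t - s) powr (1/2)"
proof
  have [measurable]: "u \<in> borel_measurable borel" and u2: "integrable lborel (\<lambda>s. (u s)\<^sup>2)"
    using u by (auto simp: square_integrable_def)
  define b U where "b = Beta (1 - 2 * a) (1 + a)" and "U = (LBINT s. (u s)\<^sup>2)"
  have b: "b > 0"
    unfolding b_def using a by (intro Beta_real_pos) auto
  have U: "U \<ge> 0" by (simp add: U_def)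
  show "0 \<le> (b + U) / 2" using b U by simp
  fix t t' :: real assume t: "0 \<le> t" "t < t'"
  define h where "h = t' - t"
  have h: "h > 0" using t by (simp add: h_def)
  \<comment> \<open>Balances \<open>l * h powr (1 - a)\<close> against \<open>h powr a / l\<close>;
    both become \<open>h powr (1/2)\<close>.\<close>
  define l where "l = h powr (a - 1/2)"
  have l: "l > 0" using h by (simp add: l_def)
  define D where "D r = rker (1 + a) (t' - r) - rker (1 + a) (t - r)" for r
  have D: "0 \<le> D r" "D r \<le> h powr a" for r
    using rker_increment[of a h "t - r"] a h by (auto simp: D_def h_def algebra_simps)
  have [measurable]: "D \<in> borel_measurable borel"
    unfolding D_def[abs_def] by measurable
  have conv: "integrable lborel (\<lambda>r. rker (1 + a) (x - r) * rker (1 - 2 * a) r)"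
      "(LBINT r. rker (1 + a) (x - r) * rker (1 - 2 * a) r) = b * rker (2 - a) x" for x
    using a integrable_rker_conv[of "1 - 2 * a" "1 + a" x] integral_rker_conv[of "1 - 2 * a" "1 + a" x]
    by (auto simp: b_def algebra_simps)
  have D_rker: "integrable lborel (\<lambda>r. D r * rker (1 - 2 * a) r)"
    "(LBINT r. D r * rker (1 - 2 * a) r) = b * (rker (2 - a) t' - rker (2 - a) t)"
    unfolding D_def using conv by (auto simp: algebra_simps)
  define B where "B r = (l * (D r * rker (1 - 2 * a) r) + h powr a * (u r)\<^sup>2 / l) / 2" for r
  have B: "integrable lborel B"
    unfolding B_def[abs_def] using D_rker u2 by auto
  have bnd: "\<bar>D r * weighted a u r\<bar> \<le> B r" for r
  proof -
    have "\<bar>D r * weighted a u r\<bar> = D r * \<bar>rker (1 - a) r * u r\<bar>"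
      using D by (simp add: weighted_def abs_mult)
    also have "\<dots> \<le> D r * ((l * (rker (1 - a) r)\<^sup>2 + (u r)\<^sup>2 / l) / 2)"
      using D l by (intro mult_left_mono abs_mult_le_weighted)
    also have "\<dots> = (l * (D r * rker (1 - 2 * a) r) + D r * ((u r)\<^sup>2 / l)) / 2"
      by (simp add: rker_square algebra_simps)
    also have "\<dots> \<le> B r"
      unfolding B_def using mult_right_mono[OF D(2), of "(u r)\<^sup>2 / l" r] l
      by (intro divide_right_mono add_left_mono) auto
    finally show ?thesis .
  qed
  have int: "integrable lborel (\<lambda>r. D r * weighted a u r)"
    by (rule integrable_abs_le[OF B _ bnd]) measurable
  have "RL (1 + a) (weighted a u) t' - RL (1 + a) (weighted a u) t = (LBINT r. D r * weighted a u r)"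
    unfolding RL_def D_def using RL_weighted_integrable[of a u] a u
    by (simp add: algebra_simps)
  also have "\<bar>\<dots>\<bar> \<le> (LBINT r. \<bar>D r * weighted a u r\<bar>)"
    by (rule integral_abs_bound)
  also have "\<dots> \<le> (LBINT r. B r)"
    using int B bnd by (intro integral_mono) auto
  also have "\<dots> = (l * (b * (rker (2 - a) t' - rker (2 - a) t)) + h powr a * U / l) / 2"
    unfolding B_def U_def using D_rker u2 by simp
  also have "\<dots> \<le> (l * (b * h powr (1 - a)) + h powr a * U / l) / 2"
    using rker_increment(2)[of "1 - a" h t] a h b l by (simp add: h_def)
  also have "l * (b * h powr (1 - a)) = b * h powr (1/2)"
    unfolding l_def by (simp flip: powr_add)
  also have "h powr a * U / l = U * h powr (1/2)"
    using powr_diff[of h a "a - 1/2"] by (simp add: l_def field_simps)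
  finally show "\<bar>RL (1 + a) (weighted a u) t' - RL (1 + a) (weighted a u) t\<bar> \<le> (b + U) / 2 * (t' - t) powr (1/2)"
    by (simp add: h_def algebra_simps)
qed

text \<open>For negative \<open>a\<close> the roles are exchanged: the kernel is singular on the
  diagonal, while the weight \<open>s^(-a)\<close> is bounded on [0,T]. So the square of the kernel
  increment is integrated, and the weight is absorbed into the constant by means of the support
  condition. The index of the squared kernel is \<open>q = 1 + 2 * a\<close>, which explains the
  order \<open>q / 2\<close>.\<close>

lemma RL_weighted_holder_neg:
  assumes a: "- 1/2 < a" "a < 0" and u: "square_integrable u" and supp: "\<And>s. T < s \<Longrightarrow> u s = 0"
  obtains C where "0 \<le> C"
    "\<And>s t. 0 \<le> s \<Longrightarrow> s < t \<Longrightarrow>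
      \<bar>RL (1 + a) (weighted a u) t - RL (1 + a) (weighted a u) s\<bar> \<le> C * (t - s) powr (1/2 + a)"
proof
  have [measurable]: "u \<in> borel_measurable borel" and u2: "integrable lborel (\<lambda>s. (u s)\<^sup>2)"
    using u by (auto simp: square_integrable_def)
  define q U where "q = 1 + 2 * a" and "U = T powr (- 2 * a) * (LBINT s. (u s)\<^sup>2)"
  have q: "0 < q" "q \<le> 1" using a by (auto simp: q_def)
  have U: "U \<ge> 0" by (simp add: U_def)
  show "0 \<le> (2 / q + U) / 2" using q U by simp
  fix t t' :: real assume t: "0 \<le> t" "t < t'"
  define h where "h = t' - t"
  have h: "h > 0" using t by (simp add: h_def)
  define l where "l = h powr (- q / 2)"
  have l: "l > 0" using h by (simp add: l_def)
  define D where "D r = rker (1 + a) (t' - r) - rker (1 + a) (t - r)" for r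
  have [measurable]: "D \<in> borel_measurable borel"
    unfolding D_def[abs_def] by measurable
  \<comment> \<open>A majorant of the squared increment that integrates explicitly. Before
    \<open>t\<close> it is the difference of the two squares; between \<open>t\<close> and
    \<open>t'\<close> the factor 2 overcompensates the negative term and leaves exactly the square.
    At \<open>r = t\<close> itself it is negative, so that point is excluded and the comparison is
    made almost everywhere.\<close>
  define E where "E r = rker q (t - r) * rker 1 r - rker q (t' - r) * rker 1 r
    + 2 * (rker q (t' - r) * rker 1 (r - t))" for r
  \<comment> \<open>uses \<open>(p - q)\<^sup>2 \<le> p\<^sup>2 - q\<^sup>2\<close> for \<open>0 \<le> q \<le> p\<close>\<close>
  have DE: "(D r)\<^sup>2 \<le> E r" if "0 < r" "r \<noteq> t" for r
  proof (cases "r < t")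
    case True
    have "rker (1 + a) (t' - r) \<le> rker (1 + a) (t - r)"
      using True t a powr_mono2'[of a "t - r" "t' - r"] by (simp add: rker_def)
    then have "0 \<le> rker (1 + a) (t' - r) * (rker (1 + a) (t - r) - rker (1 + a) (t' - r))"
      by (intro mult_nonneg_nonneg) auto
    then have "(D r)\<^sup>2 \<le> (rker (1 + a) (t - r))\<^sup>2 - (rker (1 + a) (t' - r))\<^sup>2"
      by (simp add: D_def power2_eq_square algebra_simps)
    then show ?thesis
      using that True by (simp add: E_def rker_square q_def)
  next
    case False
    with that show ?thesis
      by (simp add: E_def D_def rker_square q_def)
  qed
  have conv: "integrable lborel (\<lambda>r. rker q (x - r) * rker 1 r)"
      "(LBINT r. rker q (x - r) * rker 1 r) = rker (1 + q) x / q" for x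
    using q integrable_rker_conv[of 1 q x] integral_rker_conv[of 1 q x]
    by (auto simp: Beta_1_left simp del: rker_1)
  have conv': "integrable lborel (\<lambda>r. rker q (t' - r) * rker 1 (r - t))"
      "(LBINT r. rker q (t' - r) * rker 1 (r - t)) = rker (1 + q) (t' - t) / q"
    using q has_bochner_integral_rker_conv[of 1 q t' t]
    by (auto simp: Beta_1_left has_bochner_integral_iff simp del: rker_1)
  define B where "B r = (l * E r + T powr (- 2 * a) * (u r)\<^sup>2 / l) / 2" for r
  have E: "integrable lborel E"
    "(LBINT r. E r) = rker (1 + q) t / q - rker (1 + q) t' / q + 2 * (rker (1 + q) (t' - t) / q)"
    unfolding E_def[abs_def] using conv conv' by (auto simp del: rker_1)
  have B: "integrable lborel B"
    unfolding B_def[abs_def] using E u2 by auto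
  have E0: "0 \<le> E r" if "r \<le> 0" for r
    using that t by (simp add: E_def)
  have bnd: "\<bar>D r * weighted a u r\<bar> \<le> B r" if "r \<noteq> t" for r
  proof (cases "0 < r \<and> r \<le> T")
    case True
    have "\<bar>D r * weighted a u r\<bar> \<le> (l * (D r)\<^sup>2 + (weighted a u r)\<^sup>2 / l) / 2"
      using l by (rule abs_mult_le_weighted)
    also have "(weighted a u r)\<^sup>2 \<le> T powr (- 2 * a) * (u r)\<^sup>2"
    proof -
      have "(r powr - a)\<^sup>2 \<le> T powr (- 2 * a)"
        using True a powr_mono2[of "- 2 * a" r T] by (simp add: power2_eq_square flip: powr_add)
      then show ?thesis
        using True by (auto simp: weighted_def power_mult_distrib rker_def intro!: mult_right_mono)
    qed
    also have "(D r)\<^sup>2 \<le> E r" using DE that True by simp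
    finally show ?thesis using l by (simp add: B_def divide_right_mono)
  next
    case False
    then have z: "weighted a u r = 0"
      using supp by (auto simp: weighted_def rker_def)
    have "0 \<le> E r"
      using E0[of r] order_trans[OF _ DE[of r]] that by (cases "0 < r") auto
    with z show ?thesis using l by (simp add: B_def)
  qed
  have "RL (1 + a) (weighted a u) t' - RL (1 + a) (weighted a u) t = (LBINT r. D r * weighted a u r)"
    unfolding RL_def D_def using RL_weighted_integrable[of a u] a u
    by (simp add: algebra_simps)
  also have "\<bar>\<dots>\<bar> \<le> (LBINT r. \<bar>D r * weighted a u r\<bar>)"
    by (rule integral_abs_bound)
  also have "\<dots> \<le> (LBINT r. B r)"
  proof (rule integral_mono_AE[OF _ B])
    have ae: "AE r in lborel. \<bar>D r * weighted a u r\<bar> \<le> B r"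
      using AE_lborel_singleton[of t] by eventually_elim (use bnd in auto)
    then show "AE r in lborel. \<bar>D r * weighted a u r\<bar> \<le> B r" .
    show "integrable lborel (\<lambda>r. \<bar>D r * weighted a u r\<bar>)"
      by (rule Bochner_Integration.integrable_bound[OF B])
        (use ae in \<open>auto elim!: eventually_mono\<close>)
  qed
  also have "\<dots> = (l * (LBINT r. E r) + U / l) / 2"
    unfolding B_def U_def using E(1) u2 by simp
  also have "(LBINT r. E r) \<le> 2 / q * h powr q"
  proof -
    have "rker (1 + q) t \<le> rker (1 + q) t'"
      using rker_increment(1)[of q h t] q h by (simp add: h_def)
    then have "rker (1 + q) t / q \<le> rker (1 + q) t' / q"
      using q by (simp add: divide_right_mono)
    then show ?thesis
      unfolding E using h by (simp add: h_def rker_def)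
  qed
  also have "l * (2 / q * h powr q) = 2 / q * h powr (q / 2)"
    unfolding l_def by (simp flip: powr_add)
  also have "U / l = U * h powr (q / 2)"
    unfolding l_def by (simp add: powr_minus field_simps)
  finally show "\<bar>RL (1 + a) (weighted a u) t' - RL (1 + a) (weighted a u) t\<bar>
      \<le> (2 / q + U) / 2 * (t' - t) powr (1/2 + a)"
    using l by (simp add: h_def q_def algebra_simps add_divide_distrib)
qed

subsection \<open>The Volterra operator on scalar functions\<close>

lemma rker_mult_sqrt: "rker a r * sqrt r = rker (a + 1/2) r"
proof (cases "0 < r")
  case True
  have "r powr (a - 1) * r powr (1/2) = r powr (a + 1/2 - 1)"
    by (simp flip: powr_add)
  with True show ?thesis
    by (simp add: rker_def powr_half_sqrt)
qed simp

lemma RL_1_bound: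
  assumes p: "0 < p" and [measurable]: "w \<in> borel_measurable borel"
    and w: "\<And>r. \<bar>w r\<bar> \<le> C * rker p r"
  shows "integrable lborel (\<lambda>r. rker 1 (t - r) * w r)"
    and "\<And>s. 0 \<le> s \<Longrightarrow> s \<le> t \<Longrightarrow> \<bar>RL 1 w t - RL 1 w s\<bar> \<le> C / p * (t powr p - s powr p)"
    and "\<And>s. \<bar>RL 1 w s\<bar> \<le> C / p * rker (p + 1) s"
proof -
  have conv: "integrable lborel (\<lambda>r. rker 1 (x - r) * rker p r)"
      "(LBINT r. rker 1 (x - r) * rker p r) = rker (p + 1) x / p" for x
    using p integrable_rker_conv[of p 1 x] integral_rker_conv[of p 1 x]
    by (auto simp: Beta_1_left Beta_commute[of p] simp del: rker_1)
  have int: "integrable lborel (\<lambda>r. rker 1 (x - r) * w r)" for x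
    using p w by (intro integrable_rker_conv_bounded(1)) auto
  then show "integrable lborel (\<lambda>r. rker 1 (t - r) * w r)" .
  have diff: "\<bar>RL 1 w t - RL 1 w s\<bar> \<le> C / p * (rker (p + 1) t - rker (p + 1) s)" if "s \<le> t" for s t
  proof -
    have "RL 1 w t - RL 1 w s = (LBINT r. rker 1 (t - r) * w r - rker 1 (s - r) * w r)"
      unfolding RL_def using int by (simp del: rker_1)
    also have "\<bar>\<dots>\<bar> \<le> (LBINT r. \<bar>rker 1 (t - r) * w r - rker 1 (s - r) * w r\<bar>)"
      by (rule integral_abs_bound)
    also have "\<dots> \<le> (LBINT r. C * (rker 1 (t - r) * rker p r - rker 1 (s - r) * rker p r))"
    proof (rule integral_mono)
      fix r
      have "0 \<le> C * rker p r"
        using w[of r] by simp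
      then show "\<bar>rker 1 (t - r) * w r - rker 1 (s - r) * w r\<bar>
          \<le> C * (rker 1 (t - r) * rker p r - rker 1 (s - r) * rker p r)"
        using w[of r] \<open>s \<le> t\<close> by (auto split: split_indicator)
    qed (use int conv in \<open>auto simp del: rker_1\<close>)
    also have "\<dots> = C / p * (rker (p + 1) t - rker (p + 1) s)"
      using conv by (simp add: diff_divide_distrib algebra_simps del: rker_1)
    finally show ?thesis .
  qed
  show "\<bar>RL 1 w t - RL 1 w s\<bar> \<le> C / p * (t powr p - s powr p)" if "0 \<le> s" "s \<le> t" for s
    using diff[OF that(2)] that by (auto simp: rker_def split: if_splits)
  show "\<bar>RL 1 w s\<bar> \<le> C / p * rker (p + 1) s" for s
  proof -
    \<comment> \<open>The primitive vanishes at nonpositive times, so the increment bound started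
      from there also controls the value.\<close>
    have "RL 1 w (min s 0) = 0"
    proof -
      have "(\<lambda>r. rker 1 (min s 0 - r) * w r) = (\<lambda>r. 0)"
      proof
        fix r
        show "rker 1 (min s 0 - r) * w r = 0"
          using w[of r] by (cases "0 < r") auto
      qed
      then show ?thesis by (simp add: RL_def del: rker_1)
    qed
    then show ?thesis using diff[of "min s 0" s] by simp
  qed
qed

text \<open>This is one coordinate of \<open>K_op\<close> without the factor \<open>c_H H\<close>.
  The second integrand is of order \<open>r^(a - 1/2)\<close> because \<open>G\<close> is of order
  \<open>sqrt r\<close>, so the formula makes sense for negative \<open>a\<close> as well.\<close>

definition volterra :: "real \<Rightarrow> (real \<Rightarrow> real) \<Rightarrow> real \<Rightarrow> real" where
  "volterra a u t = t powr a * RL (1 + a) (weighted a u) t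
     - a * RL 1 (\<lambda>r. rker a r * RL (1 + a) (weighted a u) r) t"

lemma rker_RL_weighted_bound:
  assumes C: "\<And>t. 0 \<le> t \<Longrightarrow> \<bar>RL (1 + a) (weighted a u) t\<bar> \<le> C * sqrt t"
  shows "\<bar>rker a r * RL (1 + a) (weighted a u) r\<bar> \<le> C * rker (a + 1/2) r"
proof (cases "0 < r")
  case True
  then have "\<bar>rker a r * RL (1 + a) (weighted a u) r\<bar> \<le> rker a r * (C * sqrt r)"
    unfolding abs_mult using C[of r] by (simp add: mult_left_mono)
  then show ?thesis by (simp add: mult_ac rker_mult_sqrt[symmetric])
qed simp

text \<open>The inner integral of the kernel is taken over \<open>r\<close> between \<open>s\<close>
  and \<open>t\<close>; exchanging it with the integral over \<open>s\<close> produces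
  \<open>G(r)\<close> under an outer integral in \<open>r\<close>. Domination uses the
  \<open>sqrt r\<close> bound for the absolute integrals, which leaves the integrable weight
  \<open>rker (a + 1/2) r\<close>.\<close>

lemma integral_K_kernel:
  assumes H: "0 < H" "H < 1" and u: "square_integrable u" and t: "0 < t"
  defines "a \<equiv> H - 1/2"
  shows "integrable lborel (\<lambda>s. indicator {0<..<t} s * (K_kernel H t s * u s))"
    and "(LBINT s. indicator {0<..<t} s * (K_kernel H t s * u s)) = c_H H * volterra a u t"
proof -
  have a: "- 1/2 < a" "a < 1/2" using H by (auto simp: a_def)
  have [measurable]: "u \<in> borel_measurable borel" using u by (auto simp: square_integrable_def)
  obtain C where C: "0 \<le> C"
    "\<And>t. 0 \<le> t \<Longrightarrow> (LBINT s. \<bar>rker (1 + a) (t - s) * weighted a u s\<bar>) \<le> C * sqrt t"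
    using RL_weighted_bound_ex[OF a u] by metis
  define F where "F r s = rker 1 (t - r) * rker a r * (rker (1 + a) (r - s) * weighted a u s)" for r s
  have F_bnd: "(LBINT s. \<bar>F r s\<bar>) \<le> C * (rker 1 (t - r) * rker (a + 1/2) r)" for r
  proof (cases "0 < r")
    case True
    have "(LBINT s. \<bar>F r s\<bar>)
        = rker 1 (t - r) * rker a r * (LBINT s. \<bar>rker (1 + a) (r - s) * weighted a u s\<bar>)"
      unfolding F_def abs_mult[of "rker 1 (t - r) * rker a r"] by (simp del: rker_1)
    also have "\<dots> \<le> rker 1 (t - r) * rker a r * (C * sqrt r)"
      using True C(2)[of r] by (intro mult_left_mono) auto
    finally show ?thesis
      by (simp add: rker_mult_sqrt[symmetric] mult_ac del: rker_1)
  qed (simp add: F_def)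
  have F: "integrable (lborel \<Otimes>\<^sub>M lborel) (case_prod F)"
  proof (rule integrable_pair_bounded[OF _ _ F_bnd])
    show "case_prod F \<in> borel_measurable (borel \<Otimes>\<^sub>M borel)"
      unfolding F_def[abs_def] by measurable
    show "integrable lborel (F r)" for r
      unfolding F_def using RL_weighted_integrable[OF a u] by (intro integrable_mult_right)
    show "integrable lborel (\<lambda>r. C * (rker 1 (t - r) * rker (a + 1/2) r))"
      using a by (intro integrable_mult_right integrable_rker_conv) auto
  qed
  have pw: "indicator {0<..<t} s * (K_kernel H t s * u s)
      = c_H H * (t powr a * (rker (1 + a) (t - s) * weighted a u s) - a * (LBINT r. F r s))" for s
  proof (cases "0 < s \<and> s < t")
    case True
    define I where "I = (LBINT r. rker 1 (t - r) * rker a r * rker (1 + a) (r - s))"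
    have "(LBINT r:{s<..<t}. r powr (H - 3/2) * (r - s) powr (H - 1/2)) = (LBINT r. rker 1 (t - r) * rker a r * rker (1 + a) (r - s))"
      unfolding set_lebesgue_integral_def using True
      by (intro Bochner_Integration.integral_cong)
        (auto simp: rker_def a_def split: split_indicator)
    then have "K_kernel H t s = c_H H * ((t / s) powr a * (t - s) powr a - a * s powr - a * I)"
      by (simp add: K_kernel_def a_def I_def)
    moreover have "(t / s) powr a = t powr a * s powr - a"
      using True t by (simp add: powr_divide powr_minus_divide)
    ultimately have K: "K_kernel H t s = c_H H * (t powr a * s powr - a * (t - s) powr a - a * s powr - a * I)"
      by simp
    have F: "(LBINT r. F r s) = I * weighted a u s"
      unfolding F_def I_def by (simp add: mult.assoc[symmetric] del: rker_1)
    show ?thesis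
      unfolding K F using True by (simp add: weighted_def rker_def algebra_simps)
  next
    case False
    have "F r s = 0" for r
      using False by (auto simp: F_def weighted_def rker_def)
    then show ?thesis
      using False by (auto simp: weighted_def)
  qed
  have i1: "integrable lborel (\<lambda>s. rker (1 + a) (t - s) * weighted a u s)"
    using a u by (rule RL_weighted_integrable)
  have i2: "integrable lborel (\<lambda>s. LBINT r. F r s)"
    using F by (rule lborel_pair.integrable_snd)
  show "integrable lborel (\<lambda>s. indicator {0<..<t} s * (K_kernel H t s * u s))"
    unfolding pw using i1 i2 by auto
  have "(LBINT s. indicator {0<..<t} s * (K_kernel H t s * u s))
      = c_H H * (t powr a * RL (1 + a) (weighted a u) t - a * (LBINT s. LBINT r. F r s))"
    unfolding pw RL_def using i1 i2 by simp
  also have "(LBINT s. LBINT r. F r s) = (LBINT r. LBINT s. F r s)"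
    using F by (rule lborel_pair.Fubini_integral)
  also have "\<dots> = RL 1 (\<lambda>r. rker a r * RL (1 + a) (weighted a u) r) t"
    unfolding F_def RL_def by (simp add: mult.assoc del: rker_1)
  finally show "(LBINT s. indicator {0<..<t} s * (K_kernel H t s * u s)) = c_H H * volterra a u t"
    by (simp add: volterra_def)
qed

lemma volterra_nonpos: "t \<le> 0 \<Longrightarrow> volterra a u t = 0"
proof -
  assume t: "t \<le> 0"
  have "(\<lambda>r. rker 1 (t - r) * (rker a r * RL (1 + a) (weighted a u) r)) = (\<lambda>r. 0)"
    using t by (auto simp: rker_def)
  then have "RL 1 (\<lambda>r. rker a r * RL (1 + a) (weighted a u) r) t = 0"
    by (simp add: RL_def del: rker_1)
  then show ?thesis
    using t by (simp add: volterra_def RL_weighted_nonpos)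
qed

lemma volterra_cong:
  assumes "\<And>s. 0 < s \<Longrightarrow> s < t \<Longrightarrow> u s = w s"
  shows "volterra a u t = volterra a w t"
proof -
  have eq: "weighted a u s = weighted a w s" if "s < t" for s
    using assms[of s] that by (cases "0 < s") (auto simp: weighted_def)
  have G: "RL (1 + a) (weighted a u) r = RL (1 + a) (weighted a w) r" if "r \<le> t" for r
    using that eq by (intro RL_cong) auto
  have "RL 1 (\<lambda>r. rker a r * RL (1 + a) (weighted a u) r) t = RL 1 (\<lambda>r. rker a r * RL (1 + a) (weighted a w) r) t"
    using G by (intro RL_cong) auto
  then show ?thesis
    using G[of t] by (simp add: volterra_def)
qed

lemma volterra_continuous:
  assumes a: "- 1/2 < a" "a < 1/2" and u: "square_integrable u" and supp: "\<And>s. T < s \<Longrightarrow> u s = 0"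
  shows "continuous_on {0..T} (volterra a u)"
proof -
  have [measurable]: "u \<in> borel_measurable borel" using u by (auto simp: square_integrable_def)
  let ?G = "RL (1 + a) (weighted a u)"
  let ?R = "RL 1 (\<lambda>r. rker a r * ?G r)"
  obtain C where C: "0 \<le> C" "\<And>t. 0 \<le> t \<Longrightarrow> \<bar>?G t\<bar> \<le> C * sqrt t"
    using RL_weighted_bound_ex[OF a u] by metis
  have G: "continuous_on {0..T} ?G"
  proof (cases "0 \<le> a")
    case True
    obtain D where "0 \<le> D" "\<And>s t. 0 \<le> s \<Longrightarrow> s < t \<Longrightarrow> \<bar>?G t - ?G s\<bar> \<le> D * (t - s) powr (1/2)"
      using RL_weighted_holder_nonneg[OF True a(2) u] by metis
    then show ?thesis
      by (intro holder_on_imp_continuous_on[of "1/2" _ _ D]) (auto simp: le_less)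
  next
    case False
    then have "a < 0" by simp
    then obtain D where "0 \<le> D" "\<And>s t. 0 \<le> s \<Longrightarrow> s < t \<Longrightarrow> \<bar>?G t - ?G s\<bar> \<le> D * (t - s) powr (1/2 + a)"
      using RL_weighted_holder_neg[OF a(1) _ u supp] by metis
    then show ?thesis
      using a by (intro holder_on_imp_continuous_on[of "1/2 + a" _ _ D]) (auto simp: le_less)
  qed
  have R: "\<bar>?R t - ?R s\<bar>
      \<le> C / (a + 1/2) * (t - s) powr (a + 1/2)" if "0 \<le> s" "s \<le> t" for s t
  proof -
    have "\<bar>?R t - ?R s\<bar>
        \<le> C / (a + 1/2) * (t powr (a + 1/2) - s powr (a + 1/2))"
      using a that rker_RL_weighted_bound[OF C(2)] by (intro RL_1_bound(2)) auto
    also have "\<dots> \<le> C / (a + 1/2) * (t - s) powr (a + 1/2)"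
      using a C that by (intro mult_left_mono powr_diff_le) auto
    finally show ?thesis .
  qed
  have cR: "continuous_on {0..T} ?R"
    using R a by (intro holder_on_imp_continuous_on[of "a + 1/2" _ _ "C / (a + 1/2)"]) auto
  have cG: "continuous_on {0..T} (\<lambda>t. t powr a * ?G t)"
    unfolding continuous_on_eq_continuous_within
  proof
    fix t assume t: "t \<in> {0..T}"
    show "continuous (at t within {0..T}) (\<lambda>t. t powr a * ?G t)"
    proof (cases "t = 0")
      case False
      then show ?thesis
        using G t by (intro continuous_intros) (auto simp: continuous_on_eq_continuous_within)
    next
      \<comment> \<open>At zero the factor \<open>t powr a\<close> may blow up. The value there is
        0, and the growth bound for \<open>G\<close> turns the product into one of order
        \<open>t powr (a + 1/2)\<close>, which tends to 0.\<close>
      case True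
      have lim: "((\<lambda>t. C * t powr (a + 1/2)) \<longlongrightarrow> 0) (at 0 within {0..T})"
      proof -
        have "((\<lambda>t. C * t powr (a + 1/2)) \<longlongrightarrow> C * 0 powr (a + 1/2)) (at 0 within {0..T})"
          using a by (intro tendsto_intros) (auto simp: eventually_at_filter)
        then show ?thesis by simp
      qed
      have "((\<lambda>t. t powr a * ?G t) \<longlongrightarrow> 0) (at 0 within {0..T})"
      proof (rule Lim_null_comparison[OF _ lim], unfold eventually_at_filter,
          intro always_eventually allI impI)
        fix t assume t: "t \<noteq> 0" "t \<in> {0..T}"
        have "norm (t powr a * ?G t) \<le> t powr a * (C * sqrt t)"
          using C(2)[of t] t by (simp add: abs_mult mult_left_mono)
        also have "\<dots> = C * t powr (a + 1/2)"
          using t by (simp add: powr_add powr_half_sqrt)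
        finally show "norm (t powr a * ?G t) \<le> C * t powr (a + 1/2)" .
      qed
      with True show ?thesis by (simp add: continuous_within)
    qed
  qed
  show "continuous_on {0..T} (volterra a u)"
    unfolding volterra_def[abs_def] by (intro continuous_intros cG cR)
qed

text \<open>The prefactor \<open>t powr a\<close> alone is only Hoelder of order
  \<open>a < 1/2\<close>; its increment is always multiplied by \<open>G(s)\<close>, of order
  \<open>sqrt s\<close>, and the product regains order 1/2. The resulting order exceeds
  \<open>a\<close>, which is what the Abel equation later requires.\<close>

lemma volterra_holder:
  assumes a: "0 < a" "a < 1/2" and u: "square_integrable u"
  obtains C where "0 \<le> C"
    "\<And>s t. 0 \<le> s \<Longrightarrow> s \<le> t \<Longrightarrow> t \<le> T \<Longrightarrow> \<bar>volterra a u t - volterra a u s\<bar> \<le> C * (t - s) powr (1/2)"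
proof -
  have [measurable]: "u \<in> borel_measurable borel" using u by (auto simp: square_integrable_def)
  let ?G = "RL (1 + a) (weighted a u)"
  let ?R = "RL 1 (\<lambda>r. rker a r * ?G r)"
  have a': "- 1/2 < a" using a by simp
  obtain C where C: "0 \<le> C" "\<And>t. 0 \<le> t \<Longrightarrow> \<bar>?G t\<bar> \<le> C * sqrt t"
    using RL_weighted_bound_ex[OF a' a(2) u] by metis
  obtain D where D: "0 \<le> D" "\<And>s t. 0 \<le> s \<Longrightarrow> s < t \<Longrightarrow> \<bar>?G t - ?G s\<bar> \<le> D * (t - s) powr (1/2)"
    using RL_weighted_holder_nonneg[OF _ a(2) u] a by (metis less_imp_le)
  let ?K = "T powr a * (D + C + a * (C / (a + 1/2)))"
  have "\<bar>volterra a u t - volterra a u s\<bar> \<le> ?K * (t - s) powr (1/2)"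
    if st: "0 \<le> s" "s \<le> t" "t \<le> T" for s t
  proof -
  have h: "(t - s) powr (a + 1/2) \<le> T powr a * (t - s) powr (1/2)"
    using st a by (simp add: powr_add powr_mono2 mult_right_mono)
  have p: "t powr (a + 1/2) - s powr (a + 1/2) \<le> T powr a * (t - s) powr (1/2)"
    using powr_diff_le[of "a + 1/2" s t] h st a by simp
  have "\<bar>t powr a * (?G t - ?G s)\<bar> \<le> T powr a * (D * (t - s) powr (1/2))"
    unfolding abs_mult using D(2)[of s t] st a D(1)
    by (cases "s = t") (auto intro!: mult_mono powr_mono2)
  moreover have "\<bar>(t powr a - s powr a) * ?G s\<bar> \<le> C * (T powr a * (t - s) powr (1/2))"
  proof -
    have m: "s powr a \<le> t powr a" using st a by (intro powr_mono2) auto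
    then have "\<bar>(t powr a - s powr a) * ?G s\<bar> \<le> (t powr a - s powr a) * (C * sqrt s)"
      unfolding abs_mult using C(2)[of s] st by (simp add: mult_left_mono)
    also have "\<dots> = C * (t powr a * sqrt s - s powr a * sqrt s)"
      by (simp add: algebra_simps)
    \<comment> \<open>Raising \<open>sqrt s\<close> to \<open>sqrt t\<close> in the first product
      completes the expression to an increment of \<open>x powr (a + 1/2)\<close>, to which
      \<open>powr_diff_le\<close> applies.\<close>
    also have "\<dots> \<le> C * (t powr a * sqrt t - s powr a * sqrt s)"
      using C st by (intro mult_left_mono diff_right_mono mult_left_mono) auto
    also have "\<dots> = C * (t powr (a + 1/2) - s powr (a + 1/2))"
      using st by (simp add: powr_add powr_half_sqrt)
    also have "\<dots> \<le> C * (T powr a * (t - s) powr (1/2))"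
      using p C(1) by (rule mult_left_mono)
    finally show ?thesis .
  qed
  moreover have "\<bar>a * (?R t - ?R s)\<bar>
      \<le> a * (C / (a + 1/2) * (T powr a * (t - s) powr (1/2)))"
  proof -
    have "\<bar>?R t - ?R s\<bar>
        \<le> C / (a + 1/2) * (t powr (a + 1/2) - s powr (a + 1/2))"
      using a st rker_RL_weighted_bound[OF C(2)] by (intro RL_1_bound(2)) auto
    also have "\<dots> \<le> C / (a + 1/2) * (T powr a * (t - s) powr (1/2))"
      using p a C by (intro mult_left_mono) auto
    finally show ?thesis
      unfolding abs_mult using a by (intro mult_mono) auto
  qed
  moreover have "volterra a u t - volterra a u s = t powr a * (?G t - ?G s) + (t powr a - s powr a) * ?G s
      - a * (?R t - ?R s)"
    by (simp add: volterra_def algebra_simps)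
  ultimately have "\<bar>volterra a u t - volterra a u s\<bar> \<le> T powr a * (D * (t - s) powr (1/2))
      + C * (T powr a * (t - s) powr (1/2)) + a * (C / (a + 1/2) * (T powr a * (t - s) powr (1/2)))"
    by linarith
  then show "\<bar>volterra a u t - volterra a u s\<bar> \<le> ?K * (t - s) powr (1/2)"
    by (simp add: algebra_simps)
  qed
  moreover have "0 \<le> ?K" using C D a by simp
  ultimately show thesis using that by blast
qed

subsection \<open>Injectivity of the Volterra operator\<close>

text \<open>For \<open>a > - 1/4\<close> the Volterra equation \<open>t\<^sup>a G(t) = a \<integral>\<^sub>0\<^sup>t r\<^sup>a\<^sup>-\<^sup>1 G(r) dr\<close> improves a bound
  \<open>|G(t)| \<le> C \<surd>t\<close> by the factor \<open>|a| / (a + 1/2) < 1\<close>.\<close>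

lemma volterra_zero_imp_RL_zero:
  assumes a: "- 1/4 < a" "a < 1/2" and u: "square_integrable u"
    and zero: "\<And>t. t \<in> {0..T} \<Longrightarrow> volterra a u t = 0" and t: "t \<in> {0..T}"
  shows "RL (1 + a) (weighted a u) t = 0"
proof -
  have [measurable]: "u \<in> borel_measurable borel" using u by (auto simp: square_integrable_def)
  let ?G = "RL (1 + a) (weighted a u)"
  have a': "- 1/2 < a" using a by simp
  obtain C where C: "0 \<le> C" "\<And>t. 0 \<le> t \<Longrightarrow> \<bar>?G t\<bar> \<le> C * sqrt t"
    using RL_weighted_bound_ex[OF a' a(2) u] by metis
  define \<theta> where "\<theta> = \<bar>a\<bar> / (a + 1/2)"
  have \<theta>: "0 \<le> \<theta>" "\<theta> < 1" using a by (auto simp: \<theta>_def)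
  have bnd: "\<bar>?G t\<bar> \<le> C * \<theta> ^ n * sqrt t" if "t \<in> {0..T}" for n t
    using that
  proof (induction n arbitrary: t)
    case (Suc n)
    show ?case
    proof (cases "t = 0")
      case False
      with Suc.prems have t: "0 < t" "t \<le> T" by auto
      \<comment> \<open>Truncation at \<open>T\<close> turns the induction hypothesis, valid only on
        [0,T], into a bound for all \<open>r\<close>; values after \<open>t\<close> do not affect
        the integral up to \<open>t\<close>.\<close>
      define w where "w r = (if r \<le> T then rker a r * ?G r else 0)" for r
      have w: "\<bar>w r\<bar> \<le> C * \<theta> ^ n * rker (a + 1/2) r" for r
      proof (cases "0 < r \<and> r \<le> T")
        case True
        then have "\<bar>w r\<bar> \<le> rker a r * (C * \<theta> ^ n * sqrt r)"
          unfolding w_def using Suc.IH[of r] by (simp add: abs_mult mult_left_mono)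
        then show ?thesis by (simp add: mult_ac rker_mult_sqrt[symmetric])
      qed (use C \<theta> in \<open>auto simp: w_def\<close>)
      have [measurable]: "w \<in> borel_measurable borel"
        unfolding w_def[abs_def] by measurable
      have "t powr a * ?G t = a * RL 1 w t"
        using zero[of t] t RL_cong[of t "\<lambda>r. rker a r * ?G r" w 1] by (simp add: volterra_def w_def)
      then have "t powr a * \<bar>?G t\<bar> = \<bar>a\<bar> * \<bar>RL 1 w t\<bar>"
        by (metis abs_mult abs_of_nonneg powr_ge_zero)
      also have "\<dots> \<le> \<bar>a\<bar> * (C * \<theta> ^ n / (a + 1/2) * rker (a + 1/2 + 1) t)"
        using a w by (intro mult_left_mono RL_1_bound(3)) auto
      also have "\<dots> = t powr a * (C * \<theta> ^ Suc n * sqrt t)"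
        using t by (simp add: \<theta>_def rker_def powr_add powr_half_sqrt)
      finally show ?thesis
        using t by simp
    qed (simp add: RL_weighted_nonpos)
  qed (use C in auto)
  have "(\<lambda>n. C * \<theta> ^ n * sqrt t) \<longlonglongrightarrow> C * 0 * sqrt t"
    using \<theta> by (intro tendsto_intros LIMSEQ_power_zero) auto
  then have "\<bar>?G t\<bar> \<le> C * 0 * sqrt t"
    using bnd[OF t] by (intro LIMSEQ_le_const) auto
  then show ?thesis by simp
qed

lemma continuous_integral_zero_imp_zero:
  fixes f :: "real \<Rightarrow> real"
  assumes f: "continuous_on {0..T} f" and T: "0 < T"
    and zero: "\<And>t. t \<in> {0..T} \<Longrightarrow> integral {0..t} f = 0" and t: "t \<in> {0..T}"
  shows "f t = 0"
proof -
  have *: "((\<lambda>x. integral {0..x} f) has_vector_derivative f t) (at t within {0..T})"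
    using f t by (rule integral_has_vector_derivative)
  have "((\<lambda>x. 0) has_vector_derivative f t) (at t within {0..T})"
    by (rule has_vector_derivative_transform[OF t _ *]) (simp add: zero)
  moreover have "((\<lambda>x. 0) has_vector_derivative 0) (at t within {0..T})"
    by simp
  ultimately show ?thesis
    using T t vector_derivative_unique_within_closed_interval[of 0 T t "\<lambda>x. 0" "f t" 0] by simp
qed

text \<open>The positive and negative parts of \<open>f\<close> are densities of two finite measures
  that agree on all half-lines, hence are equal; uniqueness of densities makes the parts equal
  almost everywhere, and they are never both positive.\<close>

lemma AE_zero_if_tail_integrals_zero:
  fixes f :: "real \<Rightarrow> real"
  assumes f: "integrable lborel f"
    and zero: "\<And>x. (LBINT s. indicator {x<..} s * f s) = 0"
  shows "AE s in lborel. f s = 0"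
proof -
  define p n where "p s = max 0 (f s)" and "n s = max 0 (- f s)" for s
  have p: "integrable lborel p" and n: "integrable lborel n"
    unfolding p_def[abs_def] n_def[abs_def] using f by auto
  note [measurable] = borel_measurable_integrable[OF p] borel_measurable_integrable[OF n]
  have ind: "integrable lborel (\<lambda>s. indicator {x<..} s * g s)"
    if "integrable lborel g" for x and g :: "real \<Rightarrow> real"
    using integrable_mult_indicator[OF _ that, of "{x<..}"] by simp
  have em: "emeasure (density lborel (\<lambda>s. ennreal (g s))) {x<..}
      = ennreal (LBINT s. indicator {x<..} s * g s)"
    if g: "integrable lborel g" and nn: "\<And>s. 0 \<le> g s" for x and g :: "real \<Rightarrow> real"
  proof -
    have "emeasure (density lborel (\<lambda>s. ennreal (g s))) {x<..}
        = (\<integral>\<^sup>+s. ennreal (g s) * indicator {x<..} s \<partial>lborel)"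
      using borel_measurable_integrable[OF g] by (intro emeasure_density) auto
    also have "\<dots> = (\<integral>\<^sup>+s. ennreal (indicator {x<..} s * g s) \<partial>lborel)"
      by (intro nn_integral_cong) (auto split: split_indicator)
    also have "\<dots> = ennreal (LBINT s. indicator {x<..} s * g s)"
      using ind[OF g] nn by (intro nn_integral_eq_integral) auto
    finally show ?thesis .
  qed
  have eq: "(LBINT s. indicator {x<..} s * p s) = (LBINT s. indicator {x<..} s * n s)" for x
  proof -
    have "(LBINT s. indicator {x<..} s * p s) - (LBINT s. indicator {x<..} s * n s)
        = (LBINT s. indicator {x<..} s * p s - indicator {x<..} s * n s)"
      using ind[OF p] ind[OF n] by simp
    also have "(\<lambda>s. indicator {x<..} s * p s - indicator {x<..} s * n s) = (\<lambda>s. indicator {x<..} s * f s)"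
      by (auto simp: p_def n_def max_def fun_eq_iff split: split_indicator)
    finally show ?thesis using zero by simp
  qed
  have pos: "0 \<le> p s" "0 \<le> n s" for s by (auto simp: p_def n_def)
  have "density lborel (\<lambda>s. ennreal (p s)) = density lborel (\<lambda>s. ennreal (n s))"
    by (rule measure_eqI_lessThan) (auto simp: em p n pos eq)
  then have "AE s in lborel. ennreal (p s) = ennreal (n s)"
    by (subst (asm) sigma_finite_measure.density_unique_iff[OF sigma_finite_lborel]) auto
  then show ?thesis
    by eventually_elim (auto simp: p_def n_def max_def split: if_splits)
qed

lemma weighted_integrable:
  assumes a: "- 1/2 < a" "a < 1/2" and u: "square_integrable u" and supp: "\<And>s. T < s \<Longrightarrow> u s = 0"
  shows "integrable lborel (weighted a u)"
proof -
  have [measurable]: "u \<in> borel_measurable borel" and u2: "integrable lborel (\<lambda>s. (u s)\<^sup>2)"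
    using u by (auto simp: square_integrable_def)
  \<comment> \<open>The shift to \<open>T + 1\<close> makes the strict cutoff equal to 1 for all
    \<open>s \<le> T\<close>, the endpoint included.\<close>
  have "integrable lborel (\<lambda>s. (rker 1 (T + 1 - s) * rker (1 - 2 * a) s + (u s)\<^sup>2) / 2)"
    using a u2 by (intro integrable_divide Bochner_Integration.integrable_add integrable_rker_conv) auto
  then show ?thesis
  proof (rule integrable_abs_le)
    show "\<bar>weighted a u s\<bar> \<le> (rker 1 (T + 1 - s) * rker (1 - 2 * a) s + (u s)\<^sup>2) / 2" for s
      using abs_mult_le_weighted[of 1 "rker (1 - a) s" "u s"] supp[of s]
      by (cases "T < s") (auto simp: weighted_def rker_square)
  qed measurable
qed

lemma RL_1_eq_integral:
  assumes w: "integrable lborel (\<lambda>s. indicator {0..t} s * w s)" and "\<And>s. s \<le> 0 \<Longrightarrow> w s = 0"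
  shows "RL 1 w t = integral {0..t} w"
proof -
  have "RL 1 w t = (LBINT s:{0..t}. w s)"
    unfolding RL_def set_lebesgue_integral_def
  proof (rule integral_cong_AE)
    have [measurable]: "(\<lambda>s. indicator {0..t} s * w s) \<in> borel_measurable borel"
      using w by auto
    show "(\<lambda>s. indicator {0..t} s *\<^sub>R w s) \<in> borel_measurable lborel"
      by simp
    have "(\<lambda>s. rker 1 (t - s) * w s) = (\<lambda>s. rker 1 (t - s) * (indicator {0..t} s * w s))"
      using assms(2) by (fastforce split: split_indicator)
    then show "(\<lambda>s. rker 1 (t - s) * w s) \<in> borel_measurable lborel"
      by (simp del: rker_1)
    show "AE s in lborel. rker 1 (t - s) * w s = indicator {0..t} s *\<^sub>R w s"
      using AE_lborel_singleton[of t]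
      by eventually_elim (use assms(2) in \<open>force split: split_indicator\<close>)
  qed
  also have "\<dots> = integral {0..t} w"
    using w by (intro set_borel_integral_eq_integral) (simp add: set_integrable_def)
  finally show ?thesis .
qed

lemma RL_1_continuous:
  assumes w: "integrable lborel (\<lambda>s. indicator {0..T} s * w s)" and z: "\<And>s. s \<le> 0 \<Longrightarrow> w s = 0"
  shows "continuous_on {0..T} (RL 1 w)" and "\<And>t. t \<in> {0..T} \<Longrightarrow> RL 1 w t = integral {0..t} w"
proof -
  show eq: "RL 1 w t = integral {0..t} w" if "t \<in> {0..T}" for t
  proof (rule RL_1_eq_integral[OF _ z])
    have "(\<lambda>s. indicator {0..t} s * w s) = (\<lambda>s. indicator {0..t} s *\<^sub>R (indicator {0..T} s * w s))"
      using that by (auto split: split_indicator)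
    then show "integrable lborel (\<lambda>s. indicator {0..t} s * w s)"
      using integrable_mult_indicator[OF _ w, of "{0..t}"] by simp
  qed
  have "w integrable_on {0..T}"
    using w by (intro set_borel_integral_eq_integral) (simp add: set_integrable_def)
  then have "continuous_on {0..T} (\<lambda>t. integral {0..t} w)"
    by (rule indefinite_integral_continuous_1)
  then show "continuous_on {0..T} (RL 1 w)"
    using eq by (auto intro: continuous_on_eq)
qed

text \<open>Once \<open>G\<close> vanishes on [0,T], applying \<open>RL (1 - a)\<close> raises the
  index to 2: the second primitive of \<open>weighted a u\<close> is zero. Its first primitive is
  continuous, hence zero too, and zero tail integrals give the claim. Nothing can be said for
  \<open>s \<le> 0\<close>, where the weight erases \<open>u\<close>.\<close>

lemma volterra_injective:
  assumes a: "- 1/4 < a" "a < 1/2" and u: "square_integrable u" and supp: "\<And>s. T < s \<Longrightarrow> u s = 0"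
    and T: "0 < T" and zero: "\<And>t. t \<in> {0..T} \<Longrightarrow> volterra a u t = 0"
  shows "AE s in lborel. 0 < s \<longrightarrow> u s = 0"
proof -
  have [measurable]: "u \<in> borel_measurable borel" using u by (auto simp: square_integrable_def)
  have a': "- 1/2 < a" using a by simp
  let ?v = "weighted a u"
  have v: "integrable lborel ?v"
    using a' a(2) u supp by (rule weighted_integrable)
  have v0: "?v s = 0" if "s \<le> 0" for s
    using that by (simp add: weighted_def)
  have ind: "integrable lborel (\<lambda>s. indicator A s * ?v s)" if "A \<in> sets borel" for A
    using integrable_mult_indicator[OF _ v, of A] that by simp
  have V: "continuous_on {0..T} (RL 1 ?v)"
    using ind v0 by (intro RL_1_continuous) auto
  have V0: "RL 1 ?v s = 0" if "s \<le> 0" for s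
    using that by (rule RL_weighted_nonpos)
  have RL2: "RL 2 ?v t = 0" and i2: "integrable lborel (\<lambda>s. rker 2 (t - s) * ?v s)" if t: "t \<in> {0..T}" for t
  proof -
    show i2: "integrable lborel (\<lambda>s. rker 2 (t - s) * ?v s)"
    proof (rule integrable_abs_le)
      show "integrable lborel (\<lambda>s. t * \<bar>?v s\<bar>)" using v by simp
      show "\<bar>rker 2 (t - s) * ?v s\<bar> \<le> t * \<bar>?v s\<bar>" for s
        using t v0[of s] by (cases "s \<le> 0") (auto simp: abs_mult rker_def intro!: mult_right_mono)
    qed measurable
    have "RL (1 - a) (RL (1 + a) ?v) t = RL (1 - a) (\<lambda>s. 0) t"
    proof (rule RL_cong)
      fix s assume "s < t"
      then show "RL (1 + a) ?v s = 0"
        using volterra_zero_imp_RL_zero[OF a u zero, of s] RL_weighted_nonpos[of s] t by (cases "0 \<le> s") auto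
    qed
    then have "RL (1 - a) (RL (1 + a) ?v) t = 0" by (simp add: RL_def)
    moreover have "RL (1 - a) (RL (1 + a) ?v) t = Beta (1 + a) (1 - a) * RL 2 ?v t"
      using RL_RL[of "1 + a" "1 - a" ?v t] a i2 by simp
    moreover have "Beta (1 + a) (1 - a) > 0"
      using a by (intro Beta_real_pos) auto
    ultimately show "RL 2 ?v t = 0" by simp
  qed
  have V_int: "integrable lborel (\<lambda>s. indicator {0..T} s * RL 1 ?v s)"
    using borel_integrable_compact[OF _ V] by (simp add: set_integrable_def)
  have "RL 1 ?v t = 0" if t: "t \<in> {0..T}" for t
  proof (rule continuous_integral_zero_imp_zero[OF V T _ t])
    fix t assume t: "t \<in> {0..T}"
    have "RL 1 (RL 1 ?v) t = Beta 1 1 * RL 2 ?v t"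
      using RL_RL[of 1 1 ?v t] i2[OF t] by simp
    then show "integral {0..t} (RL 1 ?v) = 0"
      using RL2[OF t] RL_1_continuous(2)[OF V_int V0 t] by simp
  qed
  then have V_zero: "RL 1 ?v t = 0" if "t \<le> T" for t
    using that V0[of t] by (cases "0 \<le> t") auto
  have "AE s in lborel. ?v s = 0"
  proof (rule AE_zero_if_tail_integrals_zero[OF v])
    fix x
    have vT: "?v s = 0" if "T < s" for s
      using that supp by (simp add: weighted_def)
    \<comment> \<open>Since the function vanishes after \<open>T\<close>, a tail integral is an
      increment of the primitive between \<open>min x T\<close> and \<open>T\<close>.\<close>
    have "(LBINT s. indicator {x<..} s * ?v s) = (LBINT s. rker 1 (T - s) * ?v s - rker 1 (min x T - s) * ?v s)"
    proof (rule integral_cong_AE)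
      show "AE s in lborel. indicator {x<..} s * ?v s = rker 1 (T - s) * ?v s - rker 1 (min x T - s) * ?v s"
        using AE_lborel_singleton[of x] AE_lborel_singleton[of T]
        by eventually_elim (use vT in \<open>force split: split_indicator\<close>)
    qed measurable
    also have "\<dots> = RL 1 ?v T - RL 1 ?v (min x T)"
    proof -
      have "integrable lborel (\<lambda>s. rker 1 (y - s) * ?v s)" for y
      proof -
        have "(\<lambda>s. rker 1 (y - s) * ?v s) = (\<lambda>s. indicator {..<y} s * ?v s)"
          by (auto split: split_indicator)
        then show ?thesis using ind[of "{..<y}"] by (simp del: rker_1)
      qed
      then show ?thesis
        unfolding RL_def by (simp del: rker_1)
    qed
    finally show "(LBINT s. indicator {x<..} s * ?v s) = 0"
      using V_zero by simp
  qed
  then show ?thesis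
    by eventually_elim (auto simp: weighted_def rker_def split: if_splits)
qed

subsection \<open>Fractional derivatives of weighted functions and the range of the Volterra operator\<close>

text \<open>The singular kernel \<open>rker (- a)\<close> is not integrable at 0. Shifting its
  argument by \<open>d\<close> makes it bounded, and it increases to the singular kernel as
  \<open>d\<close> decreases to 0.\<close>

definition reg_ker :: "real \<Rightarrow> real \<Rightarrow> real \<Rightarrow> real" where
  "reg_ker a d x = (if 0 < x then (x + d) powr (- a - 1) else 0)"

text \<open>The primitive of \<open>reg_ker a d\<close> that vanishes at 0. It contains the term
  \<open>d powr - a / a\<close>, which diverges as \<open>d\<close> tends to 0.\<close>

definition reg_int :: "real \<Rightarrow> real \<Rightarrow> real \<Rightarrow> real" where
  "reg_int a d x = (if 0 < x then (d powr - a - (x + d) powr - a) / a else 0)"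

lemma reg_ker_measurable [measurable]: "reg_ker a d \<in> borel_measurable borel"
  unfolding reg_ker_def[abs_def] by measurable

lemma reg_int_measurable [measurable]: "reg_int a d \<in> borel_measurable borel"
  unfolding reg_int_def[abs_def] by measurable

lemma reg_ker_bounds:
  assumes "0 < a" "0 < d"
  shows "0 \<le> reg_ker a d x" "reg_ker a d x \<le> rker (- a) x" "reg_ker a d x \<le> d powr (- a - 1)"
  using assms powr_mono2'[of "- a - 1" x "x + d"] powr_mono2'[of "- a - 1" d "x + d"]
  by (auto simp: reg_ker_def rker_def)

lemma reg_int_bounds:
  assumes "0 < a" "0 < d"
  shows "0 \<le> reg_int a d x" "reg_int a d x \<le> d powr - a / a"
  using assms powr_mono2'[of "- a" d "x + d"]
  by (auto simp: reg_int_def divide_right_mono)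

lemma reg_ker_integral:
  assumes a: "0 < a" and d: "0 < d"
  shows "has_bochner_integral lborel (\<lambda>s. rker 1 (t - s) * reg_ker a d (s - r)) (reg_int a d (t - r))"
proof (cases "r < t")
  case False
  then have "(\<lambda>s. rker 1 (t - s) * reg_ker a d (s - r)) = (\<lambda>s. 0)"
    by (auto simp: reg_ker_def)
  with False show ?thesis by (simp add: reg_int_def has_bochner_integral_zero)
next
  case True
  have "has_bochner_integral lborel (\<lambda>s. indicator {r..t} s *\<^sub>R (s - r + d) powr (- a - 1))
      (- ((t - r + d) powr - a) / a - (- ((r - r + d) powr - a) / a))"
  proof (rule has_bochner_integral_FTC_Icc)
    show "r \<le> t" using True by simp
    fix x assume x: "r \<le> x" "x \<le> t"
    have "((\<lambda>s. - ((s - r + d) powr - a) / a) has_real_derivative (x - r + d) powr (- a - 1)) (at x within {r..t})"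
    proof -
      have "((\<lambda>z. z powr - a) has_real_derivative - a * (x - r + d) powr (- a - 1)) (at (x - r + d))"
        using x d by (intro has_real_derivative_powr) auto
      then have "((\<lambda>s. (s - r + d) powr - a) has_real_derivative - a * (x - r + d) powr (- a - 1) * 1) (at x within {r..t})"
        by (rule DERIV_chain2) (auto intro!: derivative_eq_intros)
      from DERIV_cdivide[OF DERIV_minus[OF this], of a] show ?thesis
        using a by simp
    qed
    then show "((\<lambda>s. - ((s - r + d) powr - a) / a) has_vector_derivative (x - r + d) powr (- a - 1)) (at x within {r..t})"
      by (simp add: has_real_derivative_iff_has_vector_derivative)
  next
    show "continuous_on {r..t} (\<lambda>s. (s - r + d) powr (- a - 1))"
      using d by (intro continuous_intros) auto
  qed
  then have "has_bochner_integral lborel (\<lambda>s. indicator {r..t} s *\<^sub>R (s - r + d) powr (- a - 1)) (reg_int a d (t - r))"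
    using True by (simp add: reg_int_def diff_divide_distrib)
  then show ?thesis
  proof (rule has_bochner_integralI_AE)
    show "AE s in lborel. indicator {r..t} s *\<^sub>R (s - r + d) powr (- a - 1) = rker 1 (t - s) * reg_ker a d (s - r)"
      using AE_lborel_singleton[of r] AE_lborel_singleton[of t]
      by eventually_elim (auto simp: reg_ker_def split: split_indicator)
  qed measurable
qed


lemma reg_ker_integral_swap:
  assumes "0 < a" "0 < d"
  shows "has_bochner_integral lborel (\<lambda>r. rker 1 r * reg_ker a d (s - r)) (reg_int a d s)"
proof -
  have "has_bochner_integral lborel (\<lambda>x. rker 1 (s - x) * reg_ker a d x) (reg_int a d s)"
    using reg_ker_integral[OF assms, of s 0] by simp
  then have "has_bochner_integral lborel (\<lambda>r. rker 1 (s - (s + (-1) * r)) * reg_ker a d (s + (-1) * r))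
      (reg_int a d s /\<^sub>R \<bar>-1\<bar>)"
    by (subst (asm) lborel_has_bochner_integral_real_affine_iff[of "-1" _ _ s]) (simp_all del: rker_1)
  then show ?thesis by (simp del: rker_1)
qed

text \<open>The increment of \<open>s^(-a) f(s)\<close> splits into an increment of \<open>f\<close>
  and an increment of the weight. The first is Hoelder of order \<gamma>, leaving the kernel index
  \<open>\<gamma> - a\<close>. The second is at most \<open>r^(-a) (s - r) / s\<close>, because
  \<open>r / s \<le> (r / s)^a\<close>; the factor \<open>s - r\<close> removes one order of the
  singularity.\<close>

lemma weighted_difference_bound:
  fixes f :: "real \<Rightarrow> real"
  assumes a: "0 < a" "a < 1"
    and M: "\<And>r. \<bar>f r\<bar> \<le> M"
    and L: "\<And>r s. \<bar>f s - f r\<bar> \<le> L * \<bar>s - r\<bar> powr \<gamma>"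
  shows "\<bar>rker 1 r * (weighted a f s - weighted a f r) * rker (- a) (s - r)\<bar>
    \<le> L * rker (1 - a) s * (rker (\<gamma> - a) (s - r) * rker 1 r)
      + M * rker 0 s * (rker (1 - a) (s - r) * rker (1 - a) r)" (is "\<bar>?D\<bar> \<le> ?B")
proof -
  have M0: "0 \<le> M" using order_trans[OF abs_ge_zero M] .
  have L0: "0 \<le> L" using order_trans[OF abs_ge_zero L[of 1 0]] by simp
  show ?thesis
  proof (cases "0 < r \<and> r < s")
    case True
    define x where "x = s - r"
    have x: "0 < x" "0 < r" "0 < s" using True by (auto simp: x_def)
    have gs: "weighted a f s = s powr - a * f s" and gr: "weighted a f r = r powr - a * f r"
      using x by (auto simp: weighted_def rker_def)
    have "r powr - a - s powr - a \<le> r powr - a * (x / s)"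
    proof -
      have "r / s \<le> (r / s) powr a"
        using powr_mono'[of a 1 "r / s"] a True by simp
      then have "r powr - a * (r / s) \<le> r powr - a * (r / s) powr a"
        by (intro mult_left_mono) auto
      also have "\<dots> = s powr - a"
        using x by (simp add: powr_divide powr_minus_divide)
      finally show ?thesis
        using x by (simp add: x_def diff_divide_distrib algebra_simps)
    qed
    moreover have "s powr - a \<le> r powr - a"
      using a True powr_mono2'[of "- a" r s] by simp
    ultimately have 2: "\<bar>(r powr - a - s powr - a) * f r\<bar> \<le> r powr - a * (x / s) * M"
      unfolding abs_mult using M[of r] M0 x by (intro mult_mono) auto
    have 1: "\<bar>s powr - a * (f s - f r)\<bar> \<le> s powr - a * (L * x powr \<gamma>)"
      unfolding abs_mult using L[of s r] True by (intro mult_mono) (auto simp: x_def)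
    have "weighted a f s - weighted a f r = s powr - a * (f s - f r) - (r powr - a - s powr - a) * f r"
      by (simp add: gs gr algebra_simps)
    then have "\<bar>weighted a f s - weighted a f r\<bar> \<le> s powr - a * (L * x powr \<gamma>) + r powr - a * (x / s) * M"
      using 1 2 by linarith
    then have "\<bar>?D\<bar> \<le> (s powr - a * (L * x powr \<gamma>) + r powr - a * (x / s) * M) * x powr (- a - 1)"
      using x by (simp add: abs_mult rker_def x_def[symmetric] mult_right_mono)
    also have "\<dots> = ?B"
    proof -
      have "(s powr - a * (L * x powr \<gamma>) + r powr - a * (x / s) * M) * x powr (- a - 1)
          = L * s powr - a * (x powr \<gamma> * x powr (- a - 1)) + M * (1 / s) * (r powr - a * (x * x powr (- a - 1)))"
        by (simp add: algebra_simps)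
      also have "x powr \<gamma> * x powr (- a - 1) = x powr (\<gamma> - a - 1)"
        by (simp add: algebra_simps flip: powr_add)
      also have "x * x powr (- a - 1) = x powr - a"
        using x by (simp add: powr_mult_base)
      also have "1 / s = s powr - 1"
        using x by (simp add: powr_minus_divide)
      finally show ?thesis
        using x by (simp add: rker_def x_def[symmetric] mult_ac)
    qed
    finally show ?thesis .
  next
    case False
    then have "?D = 0" by (auto simp: rker_def)
    moreover have "0 \<le> ?B"
      using L0 M0 by (intro add_nonneg_nonneg mult_nonneg_nonneg) auto
    ultimately show ?thesis by (simp only: abs_zero)
  qed
qed

text \<open>For bounded kernels the difference \<open>g s - g r\<close> may be separated. In the
  part with \<open>g s\<close> the kernel is integrated over \<open>r\<close>, giving
  \<open>reg_int a d s\<close>; in the part with \<open>g r\<close> Fubini moves the integration to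
  \<open>s\<close>, giving \<open>reg_int a d (t - r)\<close>.\<close>

lemma regularized_integral:
  assumes a: "0 < a" "a < 1/2" and [measurable]: "g \<in> borel_measurable borel"
    and g: "\<And>r. \<bar>g r\<bar> \<le> M * rker (1 - a) r" and d: "0 < d"
  defines "h \<equiv> \<lambda>t s. rker 1 (t - s) * g s"
  shows "(LBINT s. rker 1 (t - s) * (LBINT r. rker 1 r * (g s - g r) * reg_ker a d (s - r)))
    = (LBINT s. h t s * (reg_int a d s - reg_int a d (t - s)))"
proof -
  have M0: "0 \<le> M" using order_trans[OF abs_ge_zero g[of 1]] by (simp add: rker_def)
  have g0: "g r = 0" if "r \<le> 0" for r
    using g[of r] that by simp
  have h_int: "integrable lborel (h t)"
    unfolding h_def using integrable_rker_conv_bounded(1)[of "1 - a" 1 g M t] a g by auto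
  have [measurable]: "h t \<in> borel_measurable borel"
    unfolding h_def by measurable
  define F where "F r s = rker 1 (t - s) * reg_ker a d (s - r) * g r" for r s
  note ker = reg_ker_integral[OF a(1) d] reg_ker_integral_swap[OF a(1) d]
  have F_pair: "integrable (lborel \<Otimes>\<^sub>M lborel) (case_prod F)"
  proof (rule integrable_pair_bounded)
    show "case_prod F \<in> borel_measurable (borel \<Otimes>\<^sub>M borel)"
      unfolding F_def[abs_def] by measurable
    show "integrable lborel (F r)" for r
      unfolding F_def using ker(1)[of t r]
      by (intro integrable_mult_left) (simp add: has_bochner_integral_iff del: rker_1)
    show "(LBINT s. \<bar>F r s\<bar>) \<le> d powr - a / a * \<bar>h t r\<bar>" for r
    proof -
      have "(LBINT s. \<bar>F r s\<bar>) = reg_int a d (t - r) * \<bar>g r\<bar>"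
        unfolding F_def using ker(1)[of t r] reg_ker_bounds(1)[OF a(1) d]
        by (simp add: abs_mult has_bochner_integral_iff del: rker_1)
      then show ?thesis
        using mult_right_mono[OF reg_int_bounds(2)[OF a(1) d, of "t - r"], of "\<bar>g r\<bar>"]
        by (auto simp: h_def reg_int_def split: split_indicator if_splits)
    qed
    show "integrable lborel (\<lambda>r. d powr - a / a * \<bar>h t r\<bar>)"
      using h_int by auto
  qed
  have i2: "integrable lborel (\<lambda>s. LBINT r. F r s)"
    using F_pair by (rule lborel_pair.integrable_snd)
  have i0: "integrable lborel (\<lambda>s. h t s * reg_int a d (k s))" if [measurable]: "k \<in> borel_measurable borel" for k
  proof (rule integrable_abs_le)
    show "integrable lborel (\<lambda>s. d powr - a / a * \<bar>h t s\<bar>)" using h_int by auto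
    show "\<bar>h t s * reg_int a d (k s)\<bar> \<le> d powr - a / a * \<bar>h t s\<bar>" for s
      using mult_right_mono[OF reg_int_bounds(2)[OF a(1) d, of "k s"], of "\<bar>h t s\<bar>"]
        reg_int_bounds(1)[OF a(1) d, of "k s"]
      by (simp add: abs_mult mult.commute)
  qed measurable
  have i1: "integrable lborel (\<lambda>s. h t s * reg_int a d s)"
    using i0[of "\<lambda>s. s"] by simp
  have inner: "rker 1 (t - s) * (LBINT r. rker 1 r * (g s - g r) * reg_ker a d (s - r))
      = h t s * reg_int a d s - (LBINT r. F r s)" for s
  proof -
    have gi: "integrable lborel (\<lambda>r. g r * reg_ker a d (s - r))"
    proof (rule integrable_abs_le)
      show "integrable lborel (\<lambda>r. d powr (- a - 1) * (M * (rker 1 (s - r) * rker (1 - a) r)))"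
        using a by (intro integrable_mult_right integrable_rker_conv) auto
      fix r
      have "\<bar>reg_ker a d (s - r)\<bar> \<le> d powr (- a - 1) * rker 1 (s - r)"
        using reg_ker_bounds[OF a(1) d, of "s - r"] by (auto simp: reg_ker_def)
      then have "\<bar>g r * reg_ker a d (s - r)\<bar> \<le> (M * rker (1 - a) r) * (d powr (- a - 1) * rker 1 (s - r))"
        unfolding abs_mult using g[of r] M0 by (intro mult_mono) auto
      then show "\<bar>g r * reg_ker a d (s - r)\<bar> \<le> d powr (- a - 1) * (M * (rker 1 (s - r) * rker (1 - a) r))"
        by (simp only: mult_ac)
    qed measurable
    have eq: "rker 1 r * (g s - g r) * reg_ker a d (s - r)
        = g s * (rker 1 r * reg_ker a d (s - r)) - g r * reg_ker a d (s - r)" for r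
      using g0[of r] by (auto simp: algebra_simps split: split_indicator)
    have J: "(LBINT r. rker 1 r * (g s - g r) * reg_ker a d (s - r))
        = g s * reg_int a d s - (LBINT r. g r * reg_ker a d (s - r))"
      unfolding eq using gi ker(2)[of s] by (simp add: has_bochner_integral_iff del: rker_1)
    have F: "(LBINT r. F r s) = rker 1 (t - s) * (LBINT r. g r * reg_ker a d (s - r))"
      by (subst integral_mult_right_zero[symmetric], intro Bochner_Integration.integral_cong)
        (auto simp: F_def mult_ac simp del: rker_1)
    show ?thesis
      unfolding J F h_def by (rule right_diff_distrib[THEN trans]) (simp only: mult.assoc)
  qed
  have "(LBINT s. LBINT r. F r s) = (LBINT r. LBINT s. F r s)"
    using F_pair by (rule lborel_pair.Fubini_integral)
  also have "\<dots> = (LBINT r. reg_int a d (t - r) * g r)"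
    unfolding F_def using ker(1) by (simp add: has_bochner_integral_iff del: rker_1)
  also have "\<dots> = (LBINT r. h t r * reg_int a d (t - r))"
    by (intro Bochner_Integration.integral_cong) (auto simp: h_def reg_int_def)
  finally have F_eq: "(LBINT s. LBINT r. F r s) = (LBINT r. h t r * reg_int a d (t - r))" .
  have i3: "integrable lborel (\<lambda>s. h t s * reg_int a d (t - s))"
    by (rule i0) measurable
  show ?thesis
    unfolding inner using i1 i2 i3 F_eq by (simp add: right_diff_distrib)
qed

text \<open>The Marchaud form of the fractional derivative, \<open>w = const \<sqdot> D\<^sup>a g\<close> with \<open>g(s) = s\<^sup>-\<^sup>a f(s)\<close>.
  The singular kernel \<open>(s - r)\<^sup>-\<^sup>a\<^sup>-\<^sup>1\<close> is replaced by \<open>(s - r + d)\<^sup>-\<^sup>a\<^sup>-\<^sup>1\<close>; then the two parts of the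
  difference \<open>g(s) - g(r)\<close> can be integrated separately and their divergent terms \<open>d\<^sup>-\<^sup>a\<close> cancel.\<close>

lemma marchaud_inverse:
  fixes f :: "real \<Rightarrow> real"
  assumes a: "0 < a" "a < 1/2" and \<gamma>: "a < \<gamma>"
    and [measurable]: "f \<in> borel_measurable borel"
    and M: "\<And>r. \<bar>f r\<bar> \<le> M"
    and L: "\<And>r s. \<bar>f s - f r\<bar> \<le> L * \<bar>s - r\<bar> powr \<gamma>"
  obtains w C where "w \<in> borel_measurable borel" "0 \<le> C"
    "\<And>s. \<bar>w s\<bar> \<le> C * (rker (1 - 2 * a) s + rker (1 + \<gamma> - 2 * a) s)"
    "\<And>t. RL 1 w t = RL (1 - a) (weighted a f) t"
proof -
  have M0: "0 \<le> M" using order_trans[OF abs_ge_zero M] .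
  have L0: "0 \<le> L" using order_trans[OF abs_ge_zero L[of 1 0]] by simp
  define g where "g = weighted a f"
  have g: "\<bar>g r\<bar> \<le> M * rker (1 - a) r" for r
    using mult_right_mono[OF M[of r], of "rker (1 - a) r"] by (simp add: g_def weighted_def abs_mult mult.commute)
  have g2: "\<bar>rker (1 - a) s * g s\<bar> \<le> M * rker (1 - 2 * a) s" for s
    using mult_left_mono[OF g[of s], of "rker (1 - a) s"]
    by (simp add: abs_mult mult.left_commute rker_mult)
  have g0: "g r = 0" if "r \<le> 0" for r
    using that by (simp add: g_def weighted_def)
  have [measurable]: "g \<in> borel_measurable borel"
    unfolding g_def by measurable
  define D where "D s r = rker 1 r * (g s - g r) * rker (- a) (s - r)" for s r
  define Bd where "Bd s r = L * rker (1 - a) s * (rker (\<gamma> - a) (s - r) * rker 1 r)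
    + M * rker 0 s * (rker (1 - a) (s - r) * rker (1 - a) r)" for s r
  have D_Bd: "\<bar>D s r\<bar> \<le> Bd s r" for s r
    unfolding D_def Bd_def g_def using a by (intro weighted_difference_bound M L) auto
  define c where "c = L / (\<gamma> - a) + M * Beta (1 - a) (1 - a)"
  have c0: "0 \<le> c"
    using L0 M0 \<gamma> a Beta_real_pos[of "1 - a" "1 - a"] by (simp add: c_def)
  define B where "B s = c * (rker (1 - 2 * a) s + rker (1 + \<gamma> - 2 * a) s)" for s
  have Bd: "integrable lborel (Bd s)" "(LBINT r. Bd s r) \<le> B s" for s
  proof -
    have c1: "integrable lborel (\<lambda>r. rker (\<gamma> - a) (s - r) * rker 1 r)"
      "(LBINT r. rker (\<gamma> - a) (s - r) * rker 1 r) = 1 / (\<gamma> - a) * rker (1 + \<gamma> - a) s"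
      using integrable_rker_conv[of 1 "\<gamma> - a" s] integral_rker_conv[of 1 "\<gamma> - a" s] \<gamma>
      by (auto simp: Beta_1_left algebra_simps simp del: rker_1)
    have c2: "integrable lborel (\<lambda>r. rker (1 - a) (s - r) * rker (1 - a) r)"
      "(LBINT r. rker (1 - a) (s - r) * rker (1 - a) r) = Beta (1 - a) (1 - a) * rker (2 - 2 * a) s"
      using integrable_rker_conv[of "1 - a" "1 - a" s] integral_rker_conv[of "1 - a" "1 - a" s] a
      by (auto simp: algebra_simps)
    show "integrable lborel (Bd s)"
      unfolding Bd_def[abs_def] using c1 c2 by (auto simp del: rker_1)
    have "(LBINT r. Bd s r) = L / (\<gamma> - a) * (rker (1 - a) s * rker (1 + \<gamma> - a) s)
        + M * Beta (1 - a) (1 - a) * (rker 0 s * rker (2 - 2 * a) s)"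
      unfolding Bd_def using c1 c2 by (simp del: rker_1)
    also have "\<dots> = L / (\<gamma> - a) * rker (1 + \<gamma> - 2 * a) s + M * Beta (1 - a) (1 - a) * rker (1 - 2 * a) s"
      unfolding rker_mult by (simp add: algebra_simps)
    also have "\<dots> \<le> B s"
    proof -
      have "L / (\<gamma> - a) \<le> c" "M * Beta (1 - a) (1 - a) \<le> c"
        using L0 M0 \<gamma> a Beta_real_pos[of "1 - a" "1 - a"] by (auto simp: c_def)
      then show ?thesis
        unfolding B_def distrib_left
        by (subst add.commute) (intro add_mono mult_right_mono, auto)
    qed
    finally show "(LBINT r. Bd s r) \<le> B s" .
  qed
  have B_int: "integrable lborel (\<lambda>s. rker 1 (t - s) * B s)" for t
  proof -
    have "integrable lborel (\<lambda>s. c * (rker 1 (t - s) * rker (1 - 2 * a) s + rker 1 (t - s) * rker (1 + \<gamma> - 2 * a) s))"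
      using a \<gamma> by (intro integrable_mult_right Bochner_Integration.integrable_add integrable_rker_conv) auto
    then show ?thesis by (simp add: B_def algebra_simps del: rker_1)
  qed
  have [measurable]: "case_prod D \<in> borel_measurable (borel \<Otimes>\<^sub>M borel)"
    unfolding D_def[abs_def] by measurable
  define I where "I s = (LBINT r. D s r)" for s
  have I_meas [measurable]: "I \<in> borel_measurable borel"
    unfolding I_def[abs_def] D_def by measurable
  have I_bnd: "\<bar>I s\<bar> \<le> B s" for s
  proof -
    have "\<bar>I s\<bar> \<le> (LBINT r. \<bar>D s r\<bar>)"
      unfolding I_def by (rule integral_abs_bound)
    also have "\<dots> \<le> (LBINT r. Bd s r)"
    proof (rule integral_mono[OF _ Bd(1)])
      show "integrable lborel (\<lambda>r. \<bar>D s r\<bar>)"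
        by (rule integrable_abs_le[OF Bd(1)[of s]]) (use D_Bd in \<open>auto simp: D_def\<close>)
    qed (rule D_Bd)
    finally show ?thesis using Bd(2)[of s] by simp
  qed
  have I0: "I s = 0" if "s \<le> 0" for s
    using I_bnd[of s] that by (simp add: B_def)
  \<comment> \<open>Marchaud's formula on a half-line has a boundary term besides the singular
    integral: here \<open>s^(-a) g(s)\<close>, since \<open>g\<close> is set to zero before time
    0.\<close>
  define w where "w s = rker (1 - a) s * g s + a * I s" for s
  have [measurable]: "w \<in> borel_measurable borel"
    unfolding w_def[abs_def] by measurable
  have w_bnd: "\<bar>w s\<bar> \<le> (M + a * c) * (rker (1 - 2 * a) s + rker (1 + \<gamma> - 2 * a) s)" for s
  proof -
    have "\<bar>rker (1 - a) s * g s\<bar> \<le> M * rker (1 - 2 * a) s" by (rule g2)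
    moreover have "\<bar>a * I s\<bar> \<le> a * B s"
      using mult_left_mono[OF I_bnd[of s], of a] a by (simp add: abs_mult)
    ultimately have "\<bar>w s\<bar> \<le> M * rker (1 - 2 * a) s + a * B s"
      unfolding w_def by linarith
    also have "\<dots> \<le> M * rker (1 - 2 * a) s + a * B s + M * rker (1 + \<gamma> - 2 * a) s"
      using M0 by simp
    also have "\<dots> = (M + a * c) * (rker (1 - 2 * a) s + rker (1 + \<gamma> - 2 * a) s)"
      by (simp add: B_def algebra_simps)
    finally show ?thesis .
  qed
  have w_eq: "RL 1 w t = RL (1 - a) g t" for t
  proof -
    define h where "h s = rker 1 (t - s) * g s" for s
    have [measurable]: "h \<in> borel_measurable borel" unfolding h_def[abs_def] by measurable
    define \<delta> where "\<delta> n = 1 / real (Suc n)" for n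
    have \<delta>: "0 < \<delta> n" for n by (simp add: \<delta>_def)
    have \<delta>_lim: "\<delta> \<longlonglongrightarrow> 0" 
      unfolding \<delta>_def[abs_def] using LIMSEQ_inverse_real_of_nat by (simp add: inverse_eq_divide)
    have conv_g: "integrable lborel (\<lambda>s. rker p (t - s) * g s)" if "0 < p" for p
      using integrable_rker_conv_bounded(1)[of "1 - a" p g M t] a g that by auto
    have h_int: "integrable lborel h"
      unfolding h_def[abs_def] by (rule conv_g) simp
    note reg = regularized_integral[OF a \<open>g \<in> borel_measurable borel\<close> g \<delta>, of t, folded h_def]
    define E where "E n s r = rker 1 r * (g s - g r) * reg_ker a (\<delta> n) (s - r)" for n s r
    \<comment> \<open>Dominated convergence is applied twice, to the inner and to the outer
      integral. As the regularized kernel stays below the singular one, \<open>Bd\<close> and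
      \<open>B\<close> dominate uniformly in \<open>n\<close>.\<close>
    have lim1: "(\<lambda>n. LBINT s. rker 1 (t - s) * (LBINT r. E n s r))
        \<longlonglongrightarrow> (LBINT s. rker 1 (t - s) * I s)"
    proof (rule integral_dominated_convergence[where w = "\<lambda>s. rker 1 (t - s) * B s"])
      have E_bnd: "norm (E n s r) \<le> Bd s r" for n s r
      proof -
        have "norm (E n s r) \<le> \<bar>D s r\<bar>"
          unfolding E_def D_def real_norm_def abs_mult
          using reg_ker_bounds[OF a(1) \<delta>[of n], of "s - r"] by (intro mult_left_mono) auto
        then show ?thesis using D_Bd[of s r] by simp
      qed
      show "AE s in lborel. (\<lambda>n. rker 1 (t - s) * (LBINT r. E n s r))
          \<longlonglongrightarrow> rker 1 (t - s) * I s"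
      proof (intro AE_I2 tendsto_mult_left)
        fix s
        show "(\<lambda>n. LBINT r. E n s r) \<longlonglongrightarrow> I s"
          unfolding I_def
        proof (rule integral_dominated_convergence[where w = "Bd s"])
          have "(\<lambda>n. reg_ker a (\<delta> n) x) \<longlonglongrightarrow> rker (- a) x" for x
          proof (cases "0 < x")
            case True
            then have "(\<lambda>n. (x + \<delta> n) powr (- a - 1)) \<longlonglongrightarrow> (x + 0) powr (- a - 1)"
              using \<delta>_lim by (intro tendsto_intros) auto
            then show ?thesis using True by (simp add: reg_ker_def rker_def)
          qed (simp add: reg_ker_def)
          then show "AE r in lborel. (\<lambda>n. E n s r) \<longlonglongrightarrow> D s r"
            unfolding E_def D_def by (intro AE_I2 tendsto_mult_left)
          show "AE r in lborel. norm (E n s r) \<le> Bd s r" for n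
            using E_bnd by (intro AE_I2)
        qed (use Bd(1) in \<open>auto simp: D_def E_def\<close>)
      qed
      show "AE s in lborel. norm (rker 1 (t - s) * (LBINT r. E n s r))
          \<le> rker 1 (t - s) * B s" for n
      proof (intro AE_I2)
        fix s
        have "\<bar>LBINT r. E n s r\<bar>
            \<le> (LBINT r. \<bar>E n s r\<bar>)"
          by (rule integral_abs_bound)
        also have "\<dots> \<le> (LBINT r. Bd s r)"
        proof (rule integral_mono[OF _ Bd(1)])
          show "integrable lborel (\<lambda>r. \<bar>E n s r\<bar>)"
            by (rule integrable_abs_le[OF Bd(1)[of s]]) (use E_bnd in \<open>auto simp: E_def simp del: rker_1\<close>)
        qed (use E_bnd in auto)
        also note Bd(2)[of s]
        finally show "norm (rker 1 (t - s) * (LBINT r. E n s r))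
          \<le> rker 1 (t - s) * B s"
          by (simp add: abs_mult mult_left_mono del: rker_1)
      qed
    qed (use B_int in \<open>auto simp: E_def simp del: rker_1\<close>)
    have lim2: "(\<lambda>n. LBINT s. h s * (reg_int a (\<delta> n) s - reg_int a (\<delta> n) (t - s)))
        \<longlonglongrightarrow> (LBINT s. (rker (1 - a) (t - s) * g s - rker 1 (t - s) * (rker (1 - a) s * g s)) / a)"
    proof (rule integral_dominated_convergence[where
          w = "\<lambda>s. (rker (1 - a) (t - s) * \<bar>g s\<bar> + M * (rker 1 (t - s) * rker (1 - 2 * a) s)) / a"])
      have "integrable lborel (\<lambda>s. \<bar>rker (1 - a) (t - s) * g s\<bar>)"
        using conv_g[of "1 - a"] a by auto
      then show "integrable lborel (\<lambda>s. (rker (1 - a) (t - s) * \<bar>g s\<bar> + M * (rker 1 (t - s) * rker (1 - 2 * a) s)) / a)"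
        using a by (intro integrable_divide Bochner_Integration.integrable_add integrable_mult_right
            integrable_rker_conv) (auto simp: abs_mult)
      \<comment> \<open>The terms \<open>\<delta> n powr - a\<close> cancel here, so the limit can
        be taken. Outside the interval between 0 and \<open>t\<close> the factor \<open>h s\<close>
        vanishes.\<close>
      have diff: "h s * (reg_int a (\<delta> n) s - reg_int a (\<delta> n) (t - s))
          = h s * ((t - s + \<delta> n) powr - a - (s + \<delta> n) powr - a) / a" for s n
        by (auto simp: h_def reg_int_def diff_divide_distrib g0 algebra_simps)
      show "AE s in lborel. (\<lambda>n. h s * (reg_int a (\<delta> n) s - reg_int a (\<delta> n) (t - s)))
          \<longlonglongrightarrow> (rker (1 - a) (t - s) * g s - rker 1 (t - s) * (rker (1 - a) s * g s)) / a"
      proof (intro AE_I2)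
        fix s
        show "(\<lambda>n. h s * (reg_int a (\<delta> n) s - reg_int a (\<delta> n) (t - s)))
          \<longlonglongrightarrow> (rker (1 - a) (t - s) * g s - rker 1 (t - s) * (rker (1 - a) s * g s)) / a"
        proof (cases "0 < s \<and> s < t")
          case True
          have "(\<lambda>n. h s * ((t - s + \<delta> n) powr - a - (s + \<delta> n) powr - a) / a)
              \<longlonglongrightarrow> h s * ((t - s + 0) powr - a - (s + 0) powr - a) / a"
            using \<delta>_lim True a by (intro tendsto_intros) auto
          then show ?thesis
            unfolding diff using True by (simp add: h_def rker_def algebra_simps)
        next
          case False
          then show ?thesis
            using g0[of s] by (cases "s \<le> 0") (auto simp: h_def)
        qed
      qed
      show "AE s in lborel. norm (h s * (reg_int a (\<delta> n) s - reg_int a (\<delta> n) (t - s)))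
          \<le> (rker (1 - a) (t - s) * \<bar>g s\<bar> + M * (rker 1 (t - s) * rker (1 - 2 * a) s)) / a" for n
      proof (intro AE_I2)
        fix s
        show "norm (h s * (reg_int a (\<delta> n) s - reg_int a (\<delta> n) (t - s)))
          \<le> (rker (1 - a) (t - s) * \<bar>g s\<bar> + M * (rker 1 (t - s) * rker (1 - 2 * a) s)) / a"
        proof (cases "0 < s \<and> s < t")
          case True
          have "(t - s + \<delta> n) powr - a \<le> (t - s) powr - a" "(s + \<delta> n) powr - a \<le> s powr - a"
            using True \<delta>[of n] a by (auto intro!: powr_mono2')
          moreover have "0 \<le> (t - s + \<delta> n) powr - a" "0 \<le> (s + \<delta> n) powr - a"
            by auto
          ultimately have "\<bar>(t - s + \<delta> n) powr - a - (s + \<delta> n) powr - a\<bar> \<le> (t - s) powr - a + s powr - a"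
            by linarith
          then have "\<bar>g s\<bar> * \<bar>(t - s + \<delta> n) powr - a - (s + \<delta> n) powr - a\<bar> \<le> \<bar>g s\<bar> * ((t - s) powr - a + s powr - a)"
            by (intro mult_left_mono) auto
          also have "\<dots> \<le> (t - s) powr - a * \<bar>g s\<bar> + M * rker (1 - 2 * a) s"
          proof -
            have "s powr - a * \<bar>g s\<bar> \<le> s powr - a * (M * rker (1 - a) s)"
              using g[of s] by (intro mult_left_mono) auto
            also have "\<dots> = M * rker (1 - 2 * a) s"
              using True rker_mult[of "1 - a" s "1 - a"] by (simp add: rker_def)
            finally show ?thesis by (simp add: algebra_simps)
          qed
          finally show ?thesis
            unfolding diff using True a
            by (simp add: abs_mult h_def rker_def divide_right_mono)
        next
          case False
          then have "h s = 0" using g0[of s] by (auto simp: h_def)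
          then show ?thesis using a M0 by simp
        qed
      qed
    qed measurable
    have c1: "integrable lborel (\<lambda>s. rker (1 - a) (t - s) * g s)"
      using a by (intro conv_g) auto
    have c2: "integrable lborel (\<lambda>s. rker 1 (t - s) * (rker (1 - a) s * g s))"
      using a g2 by (intro integrable_rker_conv_bounded(1)[of "1 - 2 * a" 1 _ M]) auto
    have c3: "integrable lborel (\<lambda>s. rker 1 (t - s) * I s)"
      by (rule integrable_abs_le[OF B_int[of t]])
        (use I_bnd in \<open>auto simp: abs_mult mult_left_mono simp del: rker_1\<close>)
    have "(LBINT s. rker 1 (t - s) * I s)
        = (LBINT s. (rker (1 - a) (t - s) * g s - rker 1 (t - s) * (rker (1 - a) s * g s)) / a)"
      using lim1 lim2 by (simp add: reg E_def LIMSEQ_unique del: rker_1)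
    also have "\<dots> = (RL (1 - a) g t - RL 1 (\<lambda>s. rker (1 - a) s * g s) t) / a"
      unfolding RL_def using c1 c2 by (simp del: rker_1)
    finally have "a * RL 1 I t = RL (1 - a) g t - RL 1 (\<lambda>s. rker (1 - a) s * g s) t"
      using a by (simp add: RL_def field_simps del: rker_1)
    moreover have "RL 1 w t = RL 1 (\<lambda>s. rker (1 - a) s * g s) t + a * RL 1 I t"
    proof -
      have "(\<lambda>s. rker 1 (t - s) * w s) = (\<lambda>s. rker 1 (t - s) * (rker (1 - a) s * g s) + a * (rker 1 (t - s) * I s))"
        by (simp add: w_def algebra_simps del: rker_1)
      then show ?thesis
        unfolding RL_def using c2 c3 by (simp del: rker_1)
    qed
    ultimately show ?thesis by simp
  qed
  have "0 \<le> M + a * c" using M0 a c0 by simp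
  then show thesis
    by (rule that[OF \<open>w \<in> borel_measurable borel\<close> _ w_bnd w_eq[unfolded g_def]])
qed

section \<open>The Abel equation and the solution of the Volterra equation for an integral\<close>

lemma weighted_bound:
  assumes "\<And>r. \<bar>f r\<bar> \<le> M"
  shows "\<bar>weighted a f r\<bar> \<le> M * rker (1 - a) r"
  using mult_right_mono[OF assms[of r], of "rker (1 - a) r"] by (simp add: weighted_def abs_mult mult.commute)

text \<open>For negative \<open>a\<close> the semigroup law gives \<open>v\<close> as a fractional
  integral of order \<open>- a\<close>; for \<open>a = 0\<close> nothing is to be solved. For
  positive \<open>a\<close>, \<open>v\<close> is a multiple of the Marchaud derivative, and the
  equation follows on applying \<open>RL a\<close> to its defining identity. The bound by
  \<open>s^(-2a)\<close> is what later makes \<open>s^a v(s)\<close> square integrable.\<close>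

lemma abel_solve:
  fixes f :: "real \<Rightarrow> real"
  assumes a: "- 1/2 < a" "a < 1/2" and [measurable]: "f \<in> borel_measurable borel"
    and M: "\<And>r. \<bar>f r\<bar> \<le> M"
    and hoelder: "0 < a \<Longrightarrow> \<exists>L \<gamma>. a < \<gamma> \<and> (\<forall>r s. \<bar>f s - f r\<bar> \<le> L * \<bar>s - r\<bar> powr \<gamma>)"
  obtains v C where "v \<in> borel_measurable borel" "0 \<le> C"
    "\<And>s. s \<le> T \<Longrightarrow> \<bar>v s\<bar> \<le> C * rker (1 - 2 * a) s"
    "\<And>t. RL (1 + a) v t = RL 1 (weighted a f) t"
proof -
  have M0: "0 \<le> M" using order_trans[OF abs_ge_zero M] .
  note g = weighted_bound[of f M a, OF M]
  consider "a < 0" | "a = 0" | "0 < a" by linarith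
  then show thesis
  proof cases
    case 1
    define b where "b = Beta (- a) (1 + a)"
    have b: "0 < b" unfolding b_def using 1 a by (intro Beta_real_pos) auto
    show thesis
    proof (rule that[of "\<lambda>s. 1 / b * RL (- a) (weighted a f) s" "1 / b * (M * Beta (1 - a) (- a))"])
      show "(\<lambda>s. 1 / b * RL (- a) (weighted a f) s) \<in> borel_measurable borel" by measurable
      have "0 < Beta (1 - a) (- a)" using 1 by (intro Beta_real_pos) auto
      then show "0 \<le> 1 / b * (M * Beta (1 - a) (- a))" using b M0 by simp
      show "\<bar>1 / b * RL (- a) (weighted a f) s\<bar> \<le> 1 / b * (M * Beta (1 - a) (- a)) * rker (1 - 2 * a) s" for s
        using integrable_rker_conv_bounded(2)[of "1 - a" "- a" "weighted a f" M s] g 1 b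
        by (simp add: abs_mult divide_right_mono algebra_simps)
      show "RL (1 + a) (\<lambda>s. 1 / b * RL (- a) (weighted a f) s) t = RL 1 (weighted a f) t" for t
        using RL_RL[of "- a" "1 + a" "weighted a f" t] integrable_rker_conv_bounded(1)[of "1 - a" 1 "weighted a f" M t]
          1 a b g unfolding RL_cmult by (simp add: b_def del: rker_1)
    qed
  next
    case 2
    show thesis
    proof (rule that[of "weighted a f" M])
      show "\<bar>weighted a f s\<bar> \<le> M * rker (1 - 2 * a) s" for s using g[of s] 2 by simp
    qed (use M0 2 in auto)
  next
    case 3
    obtain L \<gamma> where \<gamma>: "a < \<gamma>" and L: "\<And>r s. \<bar>f s - f r\<bar> \<le> L * \<bar>s - r\<bar> powr \<gamma>"
      using hoelder[OF 3] by blast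
    obtain w C where [measurable]: "w \<in> borel_measurable borel" and C: "0 \<le> C"
      and w: "\<And>s. \<bar>w s\<bar> \<le> C * (rker (1 - 2 * a) s + rker (1 + \<gamma> - 2 * a) s)"
      and eq: "\<And>t. RL 1 w t = RL (1 - a) (weighted a f) t"
      using marchaud_inverse[OF 3 a(2) \<gamma> _ M L] by auto
    \<comment> \<open>Quotient of the two semigroup constants that arise when \<open>RL a\<close> is
      applied to \<open>RL 1 w\<close> and to \<open>RL (1 - a) (weighted a f)\<close>.\<close>
    define b where "b = Beta 1 a / Beta (1 - a) a"
    have b: "0 < Beta 1 a" "0 < Beta (1 - a) a" using 3 a by (auto intro!: Beta_real_pos)
    then have b0: "0 < b" by (simp add: b_def)
    have w_int: "integrable lborel (\<lambda>s. rker (1 + a) (t - s) * w s)" for t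
    proof (rule integrable_abs_le)
      show "integrable lborel (\<lambda>s. C * (rker (1 + a) (t - s) * rker (1 - 2 * a) s
          + rker (1 + a) (t - s) * rker (1 + \<gamma> - 2 * a) s))"
        using 3 a \<gamma> by (intro integrable_mult_right Bochner_Integration.integrable_add integrable_rker_conv) auto
      show "\<bar>rker (1 + a) (t - s) * w s\<bar> \<le> C * (rker (1 + a) (t - s) * rker (1 - 2 * a) s
          + rker (1 + a) (t - s) * rker (1 + \<gamma> - 2 * a) s)" for s
        using mult_left_mono[OF w[of s], of "rker (1 + a) (t - s)"] by (simp add: abs_mult algebra_simps)
    qed measurable
    show thesis
    \<comment> \<open>The factor \<open>1 + T powr \<gamma>\<close> absorbs the less singular of the
      two terms bounding \<open>w\<close>, which is possible up to time \<open>T\<close>.\<close>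
    proof (rule that[of "\<lambda>s. b * w s" "b * (C * (1 + T powr \<gamma>))"])
      show "0 \<le> b * (C * (1 + T powr \<gamma>))" using b0 C by simp
      show "\<bar>b * w s\<bar> \<le> b * (C * (1 + T powr \<gamma>)) * rker (1 - 2 * a) s" if "s \<le> T" for s
      proof (cases "0 < s")
        case True
        have "s powr (1 + \<gamma> - 2 * a - 1) = s powr \<gamma> * s powr (1 - 2 * a - 1)"
          by (simp flip: powr_add)
        also have "\<dots> \<le> T powr \<gamma> * s powr (1 - 2 * a - 1)"
          using True that \<gamma> 3 by (intro mult_right_mono powr_mono2) auto
        finally have "rker (1 + \<gamma> - 2 * a) s \<le> T powr \<gamma> * rker (1 - 2 * a) s"
          using True by (simp add: rker_def)
        then have "C * (rker (1 - 2 * a) s + rker (1 + \<gamma> - 2 * a) s) \<le> C * ((1 + T powr \<gamma>) * rker (1 - 2 * a) s)"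
          using C by (intro mult_left_mono) (auto simp: algebra_simps)
        with w[of s] have "\<bar>w s\<bar> \<le> C * ((1 + T powr \<gamma>) * rker (1 - 2 * a) s)" by linarith
        then show ?thesis
          using b0 by (simp add: abs_mult mult.assoc)
      qed (use w[of s] in simp)
      show "RL (1 + a) (\<lambda>s. b * w s) t = RL 1 (weighted a f) t" for t
      proof -
        have "RL a (RL 1 w) t = Beta 1 a * RL (1 + a) w t"
          using RL_RL[of 1 a w t] w_int[of t] 3 by simp
        moreover have "RL a (RL (1 - a) (weighted a f)) t = Beta (1 - a) a * RL 1 (weighted a f) t"
          using RL_RL[of "1 - a" a "weighted a f" t] integrable_rker_conv_bounded(1)[of "1 - a" 1 "weighted a f" M t] 3 a g
          by (simp del: rker_1)
        ultimately have "Beta 1 a * RL (1 + a) w t = Beta (1 - a) a * RL 1 (weighted a f) t"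
          using RL_cong[of t "RL 1 w" "RL (1 - a) (weighted a f)" a] eq by simp
        then show ?thesis
          unfolding RL_cmult using b by (simp add: b_def field_simps)
      qed
    qed measurable
  qed
qed

text \<open>Integration by parts for the product of \<open>r^a\<close> and the primitive of
  \<open>r^(-a) f(r)\<close>. It is carried out by Fubini, so that the possible singularity of
  \<open>r^(a - 1)\<close> at 0 needs no boundary limit.\<close>

lemma RL_1_powr_parts:
  fixes f :: "real \<Rightarrow> real"
  assumes a: "- 1/2 < a" "a < 1/2" and [measurable]: "f \<in> borel_measurable borel"
    and M: "\<And>r. \<bar>f r\<bar> \<le> M" and t: "0 < t"
  shows "t powr a * RL 1 (weighted a f) t - a * RL 1 (\<lambda>r. rker a r * RL 1 (weighted a f) r) t = RL 1 (weighted 0 f) t"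
proof (cases "a = 0")
  case True
  then show ?thesis using t by simp
next
  case False
  have M0: "0 \<le> M" using order_trans[OF abs_ge_zero M] .
  let ?g = "weighted a f"
  note g = weighted_bound[of f M a, OF M]
  define F where "F s r = rker 1 (t - r) * rker 1 (r - s) * rker a r * ?g s" for s r
  \<comment> \<open>The integral of \<open>r^(a - 1)\<close> from \<open>s\<close> to
    \<open>t\<close>; the division by \<open>a\<close> is the reason for treating
    \<open>a = 0\<close> separately.\<close>
  define k where "k s = (if 0 < s \<and> s < t then (t powr a - s powr a) / a else 0)" for s
  have ker: "has_bochner_integral lborel (\<lambda>r. rker 1 (t - r) * rker 1 (r - s) * rker a r) (k s)"
    if "0 < s" for s
  proof (cases "s < t")
    case False
    then have "(\<lambda>r. rker 1 (t - r) * rker 1 (r - s) * rker a r) = (\<lambda>s. 0)"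
      by (auto split: split_indicator)
    with False show ?thesis by (simp add: k_def has_bochner_integral_zero)
  next
    case True
    have "has_bochner_integral lborel (\<lambda>r. indicator {s..t} r *\<^sub>R r powr (a - 1)) (t powr a / a - s powr a / a)"
    proof (rule has_bochner_integral_FTC_Icc)
      show "s \<le> t" using True by simp
      fix x assume x: "s \<le> x" "x \<le> t"
      have "((\<lambda>z. z powr a) has_real_derivative a * x powr (a - 1)) (at x within {s..t})"
        using x \<open>0 < s\<close> by (simp add: has_field_derivative_at_within has_real_derivative_powr)
      from DERIV_cdivide[OF this, of a]
      show "((\<lambda>z. z powr a / a) has_vector_derivative x powr (a - 1)) (at x within {s..t})"
        using \<open>a \<noteq> 0\<close> by (simp add: has_real_derivative_iff_has_vector_derivative)
    next
      show "continuous_on {s..t} (\<lambda>r. r powr (a - 1))"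
        using \<open>0 < s\<close> by (intro continuous_intros) auto
    qed
    then have "has_bochner_integral lborel (\<lambda>r. indicator {s..t} r *\<^sub>R r powr (a - 1)) (k s)"
      using True \<open>0 < s\<close> by (simp add: k_def diff_divide_distrib)
    then show ?thesis
    proof (rule has_bochner_integralI_AE)
      show "AE r in lborel. indicator {s..t} r *\<^sub>R r powr (a - 1) = rker 1 (t - r) * rker 1 (r - s) * rker a r"
        using AE_lborel_singleton[of s] AE_lborel_singleton[of t]
        by eventually_elim (use \<open>0 < s\<close> in \<open>auto simp: rker_def split: split_indicator\<close>)
    qed measurable
  qed
  have F_int: "has_bochner_integral lborel (F s) (k s * ?g s)" for s
  proof (cases "0 < s")
    case True
    then show ?thesis unfolding F_def[abs_def] using ker by (intro has_bochner_integral_mult_left) auto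
  next
    case False
    then have "F s = (\<lambda>r. 0)" "k s = 0" by (auto simp: F_def weighted_def k_def)
    then show ?thesis by (simp add: has_bochner_integral_zero)
  qed
  have pw: "k s * ?g s * a = t powr a * (rker 1 (t - s) * ?g s) - rker 1 (t - s) * weighted 0 f s" for s
  proof (cases "0 < s \<and> s < t")
    case True
    then have 1: "s powr a * s powr - a = 1" by (simp flip: powr_add)
    have "k s * ?g s * a = (t powr a - s powr a) * (s powr - a * f s)"
      using True \<open>a \<noteq> 0\<close> by (simp add: k_def weighted_def rker_def)
    also have "\<dots> = t powr a * (s powr - a * f s) - (s powr a * s powr - a) * f s"
      by (simp only: left_diff_distrib mult.assoc)
    also have "\<dots> = t powr a * (s powr - a * f s) - f s"
      by (simp only: 1 mult_1)
    finally show ?thesis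
      using True by (simp add: weighted_def rker_def)
  qed (auto simp: k_def weighted_def)
  have i1: "integrable lborel (\<lambda>s. rker 1 (t - s) * ?g s)"
    using integrable_rker_conv_bounded(1)[of "1 - a" 1 ?g M t] a g by (auto simp del: rker_1)
  have i2: "integrable lborel (\<lambda>s. rker 1 (t - s) * weighted 0 f s)"
    using integrable_rker_conv_bounded(1)[of 1 1 "weighted 0 f" M t] weighted_bound[of f M 0, OF M] by (auto simp del: rker_1)
  have k_eq: "k s * ?g s = (t powr a * (rker 1 (t - s) * ?g s) - rker 1 (t - s) * weighted 0 f s) / a" for s
    unfolding pw[symmetric] using \<open>a \<noteq> 0\<close> by simp
  have F: "integrable (lborel \<Otimes>\<^sub>M lborel) (case_prod F)"
  proof (rule integrable_pair_bounded)
    show "case_prod F \<in> borel_measurable (borel \<Otimes>\<^sub>M borel)"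
      unfolding F_def[abs_def] by measurable
    show "integrable lborel (F s)" for s
      using F_int by (auto simp: has_bochner_integral_iff)
    show "(LBINT r. \<bar>F s r\<bar>) \<le> \<bar>k s * ?g s\<bar>" for s
    proof -
      \<comment> \<open>All kernel factors are nonnegative, so the sign of \<open>F s r\<close> is
        that of \<open>weighted a f s\<close> and does not depend on \<open>r\<close>; the integral
        of the absolute value is then known exactly.\<close>
      have "\<bar>F s r\<bar> = F s r * sgn (?g s)" for r
        unfolding F_def abs_mult abs_of_nonneg[OF rker_nonneg] abs_sgn[of "?g s"] by (simp only: mult.assoc)
      then have "(LBINT r. \<bar>F s r\<bar>) = k s * ?g s * sgn (?g s)"
        using F_int[of s] by (simp add: has_bochner_integral_iff)
      also have "\<dots> \<le> \<bar>k s * ?g s\<bar>"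
        by (auto simp: sgn_if abs_mult)
      finally show ?thesis .
    qed
    show "integrable lborel (\<lambda>s. \<bar>k s * ?g s\<bar>)"
      unfolding k_eq using i1 i2 by (auto simp del: rker_1)
  qed
  have "rker 1 (t - r) * (rker a r * RL 1 ?g r) = (LBINT s. F s r)" for r
  proof -
    have "rker 1 (t - r) * (rker a r * RL 1 ?g r)
        = (LBINT s. rker 1 (t - r) * (rker a r * (rker 1 (r - s) * ?g s)))"
      by (simp add: RL_def del: rker_1)
    also have "\<dots> = (LBINT s. F s r)"
      by (intro Bochner_Integration.integral_cong) (auto simp: F_def mult_ac simp del: rker_1)
    finally show ?thesis .
  qed
  then have "RL 1 (\<lambda>r. rker a r * RL 1 ?g r) t = (LBINT r. LBINT s. F s r)"
    by (simp add: RL_def[of 1 "\<lambda>r. rker a r * RL 1 ?g r" t] del: rker_1)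
  also have "\<dots> = (LBINT s. LBINT r. F s r)"
    using F by (rule lborel_pair.Fubini_integral)
  also have "\<dots> = (LBINT s. k s * ?g s)"
    using F_int by (simp add: has_bochner_integral_iff)
  also have "\<dots> = (t powr a * RL 1 ?g t - RL 1 (weighted 0 f) t) / a"
    unfolding k_eq RL_def using i1 i2 by (simp del: rker_1)
  finally show ?thesis
    using \<open>a \<noteq> 0\<close> by (simp add: field_simps)
qed

text \<open>Formally, differentiating
  \<open>t^a G(t) - a \<integral> r^(a-1) G(r) dr = \<integral> f\<close> leaves
  \<open>t^a G'(t) = f(t)\<close>. Hence \<open>G\<close> must be the primitive of
  \<open>s^(-a) f(s)\<close>, an Abel equation for \<open>v = weighted a u\<close>.\<close>

lemma volterra_surjective:
  fixes f :: "real \<Rightarrow> real"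
  assumes a: "- 1/2 < a" "a < 1/2" and [measurable]: "f \<in> borel_measurable borel"
    and M: "\<And>r. \<bar>f r\<bar> \<le> M"
    and hoelder: "0 < a \<Longrightarrow> \<exists>L \<gamma>. a < \<gamma> \<and> (\<forall>r s. \<bar>f s - f r\<bar> \<le> L * \<bar>s - r\<bar> powr \<gamma>)"
  obtains u where "square_integrable u" "\<And>s. T < s \<Longrightarrow> u s = 0"
    "\<And>t. t \<in> {0..T} \<Longrightarrow> volterra a u t = RL 1 (weighted 0 f) t"
proof -
  obtain v C where [measurable]: "v \<in> borel_measurable borel" and C: "0 \<le> C"
    and v: "\<And>s. s \<le> T \<Longrightarrow> \<bar>v s\<bar> \<le> C * rker (1 - 2 * a) s"
    and eq: "\<And>t. RL (1 + a) v t = RL 1 (weighted a f) t"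
    using abel_solve[OF a _ M hoelder] by auto
  \<comment> \<open>Multiplying by \<open>s^a\<close> undoes the weight. As \<open>v\<close> is of
    order \<open>s^(-2a)\<close>, this \<open>u\<close> is of order \<open>s^(-a)\<close>, square
    integrable near 0 for \<open>a < 1/2\<close>.\<close>
  define u where "u s = (if s \<le> T then rker (1 + a) s * v s else 0)" for s
  have [measurable]: "u \<in> borel_measurable borel"
    unfolding u_def[abs_def] by measurable
  have v_eq: "weighted a u s = v s" if "s \<le> T" for s
  proof (cases "0 < s")
    case True
    then show ?thesis using that by (simp add: weighted_def u_def rker_def powr_minus_divide)
  qed (use v[OF that] in \<open>simp add: weighted_def\<close>)
  have u2: "(u s)\<^sup>2 \<le> C\<^sup>2 * (rker 1 (T + 1 - s) * rker (1 - 2 * a) s)" for s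
  proof (cases "s \<le> T")
    case True
    have "\<bar>u s\<bar> \<le> rker (1 + a) s * (C * rker (1 - 2 * a) s)"
      using True v[OF True] by (simp add: u_def abs_mult mult_left_mono)
    also have "\<dots> = C * rker (1 - a) s"
      by (simp add: mult.left_commute rker_mult)
    finally have "(u s)\<^sup>2 \<le> (C * rker (1 - a) s)\<^sup>2"
      by (metis abs_ge_zero power2_abs power_mono)
    then show ?thesis
      using True by (simp add: power_mult_distrib rker_square)
  qed (simp add: u_def)
  have "integrable lborel (\<lambda>s. (u s)\<^sup>2)"
  proof (rule integrable_abs_le)
    show "integrable lborel (\<lambda>s. C\<^sup>2 * (rker 1 (T + 1 - s) * rker (1 - 2 * a) s))"
      using a by (intro integrable_mult_right integrable_rker_conv) auto
  qed (use u2 in \<open>auto simp del: rker_1\<close>)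
  then have "square_integrable u" by (simp add: square_integrable_def)
  moreover have "volterra a u t = RL 1 (weighted 0 f) t" if t: "t \<in> {0..T}" for t
  proof (cases "t = 0")
    case True
    have "(\<lambda>s. rker 1 (0 - s) * weighted 0 f s) = (\<lambda>s. 0)"
      by (auto simp: weighted_def fun_eq_iff split: split_indicator)
    then show ?thesis
      using True volterra_nonpos[of 0 a u] by (simp add: RL_def del: rker_1)
  next
    case False
    have G: "RL (1 + a) (weighted a u) r = RL 1 (weighted a f) r" if "r \<le> t" for r
      unfolding eq[symmetric] using that t by (intro RL_cong v_eq) auto
    have "RL 1 (\<lambda>r. rker a r * RL (1 + a) (weighted a u) r) t = RL 1 (\<lambda>r. rker a r * RL 1 (weighted a f) r) t"
      using G by (intro RL_cong) auto
    then show ?thesis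
      using RL_1_powr_parts[of a f M t] a M t False G[of t] by (simp add: volterra_def)
  qed
  ultimately show thesis
    using that[of u] by (simp add: u_def)
qed

lemma volterra_surjective_on:
  fixes f :: "real \<Rightarrow> real"
  assumes a: "- 1/2 < a" "a < 1/2" and T: "0 < T" and f: "continuous_on {0..T} f"
    and hoelder: "0 < a \<Longrightarrow> \<exists>L \<gamma>. a < \<gamma> \<and> (\<forall>r\<in>{0..T}. \<forall>s\<in>{0..T}. \<bar>f s - f r\<bar> \<le> L * \<bar>s - r\<bar> powr \<gamma>)"
  obtains u where "square_integrable u" "\<And>s. T < s \<Longrightarrow> u s = 0"
    "\<And>t. t \<in> {0..T} \<Longrightarrow> volterra a u t = integral {0..t} f"
proof -
  \<comment> \<open>Clamping time to [0,T] extends \<open>f\<close> by constants; being a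
    contraction, it keeps both the bound and the Hoelder estimate.\<close>
  define p where "p s = max 0 (min T s)" for s
  have p: "p s \<in> {0..T}" "\<bar>p s - p r\<bar> \<le> \<bar>s - r\<bar>" for s r
    using T by (auto simp: p_def)
  define F where "F s = f (p s)" for s
  have "continuous_on UNIV F"
    unfolding F_def using p(1)
    by (intro continuous_on_compose2[OF f]) (auto simp: p_def[abs_def] intro!: continuous_intros)
  then have [measurable]: "F \<in> borel_measurable borel"
    by (rule borel_measurable_continuous_onI)
  have "compact (f ` {0..T})"
    using f by (rule compact_continuous_image) simp
  then obtain M where M: "\<And>s. s \<in> {0..T} \<Longrightarrow> norm (f s) \<le> M"
    by (meson compact_imp_bounded bounded_iff image_eqI)
  have F_M: "\<bar>F r\<bar> \<le> M" for r
    using M[OF p(1)[of r]] by (simp add: F_def)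
  have hF: "\<exists>L \<gamma>. a < \<gamma> \<and> (\<forall>r s. \<bar>F s - F r\<bar> \<le> L * \<bar>s - r\<bar> powr \<gamma>)" if a0: "0 < a"
  proof -
    obtain L \<gamma> where \<gamma>: "a < \<gamma>"
      and L: "\<And>r s. r \<in> {0..T} \<Longrightarrow> s \<in> {0..T} \<Longrightarrow> \<bar>f s - f r\<bar> \<le> L * \<bar>s - r\<bar> powr \<gamma>"
      using hoelder[OF a0] by blast
    have "\<bar>F s - F r\<bar> \<le> \<bar>L\<bar> * \<bar>s - r\<bar> powr \<gamma>" for r s
    proof -
      have "\<bar>F s - F r\<bar> \<le> L * \<bar>p s - p r\<bar> powr \<gamma>"
        unfolding F_def using p(1) by (intro L)
      also have "\<dots> \<le> \<bar>L\<bar> * \<bar>s - r\<bar> powr \<gamma>"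
        using p(2) \<gamma> a0 by (intro mult_mono powr_mono2) auto
      finally show ?thesis .
    qed
    with \<gamma> show ?thesis by blast
  qed
  obtain u where u: "square_integrable u" "\<And>s. T < s \<Longrightarrow> u s = 0"
    "\<And>t. t \<in> {0..T} \<Longrightarrow> volterra a u t = RL 1 (weighted 0 F) t"
    using volterra_surjective[OF a _ F_M hF] by auto
  moreover have "RL 1 (weighted 0 F) t = integral {0..t} f" if t: "t \<in> {0..T}" for t
  proof -
    have "set_integrable lborel {0..t} F"
      using \<open>continuous_on UNIV F\<close> by (intro borel_integrable_atLeastAtMost') (auto intro: continuous_on_subset)
    moreover have "AE s in lborel. indicator {0..t} s * F s = indicator {0..t} s * weighted 0 F s"
      using AE_lborel_singleton[of 0] by eventually_elim (auto simp: weighted_def split: split_indicator)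
    ultimately have "integrable lborel (\<lambda>s. indicator {0..t} s * weighted 0 F s)"
      unfolding set_integrable_def by (subst integrable_cong_AE[symmetric]) auto
    then have "RL 1 (weighted 0 F) t = integral {0..t} (weighted 0 F)"
      by (rule RL_1_eq_integral) (simp add: weighted_def)
    also have "\<dots> = integral {0..t} f"
      using t by (intro integral_spike[of "{0}"]) (auto simp: weighted_def F_def p_def)
    finally show ?thesis .
  qed
  ultimately show thesis using that by simp
qed

subsection \<open>Young integrals against diagonal coefficients\<close>

text \<open>The increments of the candidate primitive \<open>P\<close> telescope over a tagged
  division. A local error that is small relative to the interval length, uniformly in position and
  tag, therefore sums to a small total error.\<close>

lemma has_young_integral_local:
  assumes T: "0 \<le> T"
    and loc: "\<And>e. 0 < e \<Longrightarrow> \<exists>\<delta>>0. \<forall>c x d. 0 \<le> c \<longrightarrow> c \<le> x \<longrightarrow> x \<le> d \<longrightarrow> d \<le> T \<longrightarrow> d - c < \<delta> \<longrightarrow>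
      norm (A x *v (g d - g c) - (P d - P c)) \<le> e * (d - c)"
  shows "has_young_integral A g (P T - P 0) 0 T"
  unfolding has_young_integral_def
proof (intro allI impI)
  fix e :: real assume e: "0 < e"
  \<comment> \<open>The total error \<open>e' * T\<close> is then strictly below \<open>e\<close>,
    also for \<open>T = 0\<close>.\<close>
  define e' where "e' = e / (T + 1)"
  have e': "0 < e'" using e T by (simp add: e'_def)
  obtain \<delta> where \<delta>: "0 < \<delta>" and d: "\<And>c x d. 0 \<le> c \<Longrightarrow> c \<le> x \<Longrightarrow> x \<le> d \<Longrightarrow> d \<le> T \<Longrightarrow> d - c < \<delta> \<Longrightarrow>
      norm (A x *v (g d - g c) - (P d - P c)) \<le> e' * (d - c)"
    using loc[OF e'] by blast
  show "\<exists>\<delta>>0. \<forall>p. p tagged_division_of {0..T} \<and> (\<lambda>x. ball x \<delta>) fine p \<longrightarrow>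
      norm ((\<Sum>(x, k)\<in>p. A x *v (g (Sup k) - g (Inf k))) - (P T - P 0)) < e"
  \<comment> \<open>Both endpoints of an interval lie within \<open>\<delta> / 2\<close> of its tag,
    so its length is below \<delta>.\<close>
  proof (intro exI[of _ "\<delta> / 2"] conjI allI impI)
    show "0 < \<delta> / 2" using \<delta> by simp
    fix p assume "p tagged_division_of {0..T} \<and> (\<lambda>x. ball x (\<delta> / 2)) fine p"
    then have p: "p tagged_division_of {0..T}" and fine: "(\<lambda>x. ball x (\<delta> / 2)) fine p" by auto
    have est: "norm (A x *v (g (Sup k) - g (Inf k)) - (P (Sup k) - P (Inf k))) \<le> e' * (Sup k - Inf k)"
      if xk: "(x, k) \<in> p" for x k
    proof -
      obtain a b where k: "k = {a..b}"
        using tagged_division_ofD(4)[OF p xk] by auto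
      have x: "x \<in> k" and sub: "k \<subseteq> {0..T}"
        using tagged_division_ofD(2,3)[OF p xk] by auto
      have ab: "a \<le> x" "x \<le> b" using x k by auto
      have "0 \<le> a" "b \<le> T" using sub ab unfolding k by auto
      have "a \<in> ball x (\<delta> / 2)" "b \<in> ball x (\<delta> / 2)"
        using fineD[OF fine xk] ab unfolding k by (auto simp del: mem_ball)
      then have "b - a < \<delta>" using ab by (simp add: dist_real_def)
      then show ?thesis
        using d[of a x b] ab \<open>0 \<le> a\<close> \<open>b \<le> T\<close> by (simp add: k)
    qed
    have "(\<Sum>(x, k)\<in>p. A x *v (g (Sup k) - g (Inf k))) - (P T - P 0)
        = (\<Sum>(x, k)\<in>p. A x *v (g (Sup k) - g (Inf k))) - (\<Sum>(x, k)\<in>p. P (Sup k) - P (Inf k))"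
      using additive_tagged_division_1[OF T p, of P] by simp
    also have "\<dots> = (\<Sum>(x, k)\<in>p. A x *v (g (Sup k) - g (Inf k)) - (P (Sup k) - P (Inf k)))"
      by (simp add: sum_subtractf case_prod_unfold)
    also have "norm \<dots> \<le> (\<Sum>(x, k)\<in>p. e' * (Sup k - Inf k))"
      using est by (intro sum_norm_le) auto
    also have "\<dots> = e' * T"
      using additive_tagged_division_1[OF T p, of "\<lambda>x. x"]
      by (simp add: case_prod_unfold flip: sum_distrib_left)
    also have "\<dots> < e"
      using e T by (simp add: e'_def field_simps)
    finally show "norm ((\<Sum>(x, k)\<in>p. A x *v (g (Sup k) - g (Inf k))) - (P T - P 0)) < e" .
  qed
qed

lemma has_young_integral_unique:
  assumes "has_young_integral A g I a b" "has_young_integral A g K a b"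
  shows "I = K"
proof (rule ccontr)
  assume "I \<noteq> K"
  define e where "e = norm (I - K) / 2"
  have e: "0 < e" using \<open>I \<noteq> K\<close> by (simp add: e_def)
  let ?S = "\<lambda>p. \<Sum>(x, k)\<in>p. A x *v (g (Sup k) - g (Inf k))"
  obtain d1 where d1: "0 < d1"
    "\<And>p. p tagged_division_of {a..b} \<Longrightarrow> (\<lambda>x. ball x d1) fine p \<Longrightarrow> norm (?S p - I) < e"
    using assms(1)[unfolded has_young_integral_def, rule_format, OF e] by auto
  obtain d2 where d2: "0 < d2"
    "\<And>p. p tagged_division_of {a..b} \<Longrightarrow> (\<lambda>x. ball x d2) fine p \<Longrightarrow> norm (?S p - K) < e"
    using assms(2)[unfolded has_young_integral_def, rule_format, OF e] by auto
  have "gauge (\<lambda>x::real. ball x (min d1 d2))" using d1 d2 by (intro gauge_ball) auto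
  then obtain p where p: "p tagged_division_of {a..b}" "(\<lambda>x. ball x (min d1 d2)) fine p"
    by (rule fine_division_exists_real)
  then have "(\<lambda>x. ball x d1) fine p" "(\<lambda>x. ball x d2) fine p"
    by (auto simp: fine_def subset_iff)
  then have "norm (?S p - I) < e" "norm (?S p - K) < e"
    using d1 d2 p by auto
  then have "norm (I - K) < e + e"
    using norm_triangle_ineq4[of "?S p - K" "?S p - I"] by simp
  then show False by (simp add: e_def)
qed

lemma young_integral_eqI: "has_young_integral A g I a b \<Longrightarrow> young_integral A g a b = I"
  unfolding young_integral_def using has_young_integral_unique by blast

lemma continuous_on_Icc_bounded:
  fixes f :: "real \<Rightarrow> 'a::real_normed_vector"
  assumes "continuous_on {a..b} f"
  obtains M where "0 < M" "\<And>x. x \<in> {a..b} \<Longrightarrow> norm (f x) \<le> M"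
proof -
  have "compact (f ` {a..b})"
    using assms by (rule compact_continuous_image) simp
  then obtain M where "0 < M" "\<forall>y\<in>f ` {a..b}. norm y \<le> M"
    using bounded_pos compact_imp_bounded by blast
  then show thesis using that[of M] by auto
qed

text \<open>Since \<open>s\<close> is continuously differentiable, integration by parts defines the
  candidate \<open>P\<close> for merely continuous \<open>g\<close>. The local error involves only
  increments of \<open>g\<close> multiplied by \<open>s'\<close>, and uniform continuity makes it
  small.\<close>

lemma young_parts_local:
  fixes s s' g :: "real \<Rightarrow> real"
  assumes s: "\<And>t. t \<in> {0..T} \<Longrightarrow> (s has_real_derivative s' t) (at t within {0..T})"
    and s': "continuous_on {0..T} s'" and g: "continuous_on {0..T} g" and e: "0 < e"
  defines "P \<equiv> \<lambda>t. s t * g t - integral {0..t} (\<lambda>r. s' r * g r)"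
  shows "\<exists>\<delta>>0. \<forall>c x d. 0 \<le> c \<longrightarrow> c \<le> x \<longrightarrow> x \<le> d \<longrightarrow> d \<le> T \<longrightarrow> d - c < \<delta> \<longrightarrow>
    \<bar>s x * (g d - g c) - (P d - P c)\<bar> \<le> e * (d - c)"
proof -
  obtain S where S: "0 < S" "\<And>r. r \<in> {0..T} \<Longrightarrow> \<bar>s' r\<bar> \<le> S"
    using continuous_on_Icc_bounded[OF s'] by (auto simp: real_norm_def)
  have "uniformly_continuous_on {0..T} g"
    using g by (rule compact_uniformly_continuous) simp
  moreover have "0 < e / S" using e S by simp
  ultimately obtain \<delta> where \<delta>: "0 < \<delta>"
    and ug: "\<And>r q. r \<in> {0..T} \<Longrightarrow> q \<in> {0..T} \<Longrightarrow> \<bar>r - q\<bar> < \<delta> \<Longrightarrow> \<bar>g r - g q\<bar> < e / S"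
    unfolding uniformly_continuous_on_def dist_real_def by metis
  have "\<bar>s x * (g d - g c) - (P d - P c)\<bar> \<le> e * (d - c)"
    if cd: "0 \<le> c" "c \<le> x" "x \<le> d" "d \<le> T" "d - c < \<delta>" for c x d
  proof -
    have cont: "continuous_on {a..b} s'" "continuous_on {a..b} g" if "0 \<le> a" "b \<le> T" for a b
      using that by (auto intro: continuous_on_subset[OF s'] continuous_on_subset[OF g])
    have ftc: "integral {a..b} s' = s b - s a" if "0 \<le> a" "a \<le> b" "b \<le> T" for a b
    proof (rule integral_unique, rule fundamental_theorem_of_calculus[OF \<open>a \<le> b\<close>])
      fix y assume "y \<in> {a..b}"
      then show "(s has_vector_derivative s' y) (at y within {a..b})"
        using s[of y] that
        by (auto simp: has_real_derivative_iff_has_vector_derivative intro: has_vector_derivative_within_subset)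
    qed
    have est: "\<bar>integral {a..b} (\<lambda>r. s' r * (g r - g q))\<bar> \<le> e * (b - a)"
      if "0 \<le> a" "a \<le> b" "b \<le> T" "q \<in> {c..d}" "{a..b} \<subseteq> {c..d}" for a b q
    proof -
      have "norm (integral {a..b} (\<lambda>r. s' r * (g r - g q))) \<le> e * (b - a)"
      proof (rule integral_bound)
        fix r assume r: "r \<in> {a..b}"
        have "\<bar>s' r\<bar> * \<bar>g r - g q\<bar> \<le> S * (e / S)"
        proof (intro mult_mono S)
          show "\<bar>g r - g q\<bar> \<le> e / S"
            using r that cd by (intro less_imp_le ug) (auto simp: subset_iff abs_if)
        qed (use r that S in auto)
        then show "norm (s' r * (g r - g q)) \<le> e"
          using S by (simp add: abs_mult)
      qed (use that cont in \<open>auto intro!: continuous_intros\<close>)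
      then show ?thesis by simp
    qed
    have split: "integral {a..b} (\<lambda>r. s' r * (g r - g q)) = integral {a..b} (\<lambda>r. s' r * g r) - (s b - s a) * g q"
      if "0 \<le> a" "a \<le> b" "b \<le> T" for a b q
    proof -
      have "integral {a..b} (\<lambda>r. s' r * (g r - g q))
          = integral {a..b} (\<lambda>r. s' r * g r) - integral {a..b} (\<lambda>r. s' r * g q)"
        unfolding right_diff_distrib using that cont
        by (intro Henstock_Kurzweil_Integration.integral_diff integrable_continuous_interval continuous_intros) auto
      then show ?thesis using ftc[OF that] by simp
    qed
    have comb: "integral {a..b} (\<lambda>r. s' r * g r) + integral {b..q} (\<lambda>r. s' r * g r) = integral {a..q} (\<lambda>r. s' r * g r)"
      if "0 \<le> a" "a \<le> b" "b \<le> q" "q \<le> T" for a b q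
      using that cont by (intro Henstock_Kurzweil_Integration.integral_combine integrable_continuous_interval continuous_intros) auto
    \<comment> \<open>The tag \<open>x\<close> divides the error: before it \<open>g\<close> is
      compared with its left endpoint value, after it with its right one. This handles an arbitrary
      tag.\<close>
    have "s x * (g d - g c) - (P d - P c)
        = integral {c..x} (\<lambda>r. s' r * (g r - g c)) + integral {x..d} (\<lambda>r. s' r * (g r - g d))"
      using split[of c x c] split[of x d d] comb[of c x d] comb[of 0 c d] cd
      by (simp add: P_def algebra_simps)
    moreover have "\<bar>integral {c..x} (\<lambda>r. s' r * (g r - g c))\<bar> \<le> e * (x - c)"
      using cd by (intro est) auto
    moreover have "\<bar>integral {x..d} (\<lambda>r. s' r * (g r - g d))\<bar> \<le> e * (d - x)"
      using cd by (intro est) auto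
    ultimately have "\<bar>s x * (g d - g c) - (P d - P c)\<bar> \<le> e * (x - c) + e * (d - x)"
      by linarith
    then show ?thesis by (simp add: algebra_simps)
  qed
  with \<delta> show ?thesis by blast
qed

text \<open>A diagonal matrix acts coordinatewise, so the scalar estimate applies to each
  coordinate, and the minimum over the finitely many coordinates gives a common mesh. The condition
  \<open>g 0 = 0\<close> removes the boundary term at 0.\<close>

lemma has_young_integral_diagonal:
  fixes \<sigma> :: "real \<Rightarrow> real^'n^'n" and g :: "real \<Rightarrow> real^'n"
  assumes t: "t \<in> {0..T}"
    and diag: "\<And>s i j. s \<in> {0..T} \<Longrightarrow> i \<noteq> j \<Longrightarrow> \<sigma> s $ i $ j = 0"
    and s: "\<And>s i. s \<in> {0..T} \<Longrightarrow> ((\<lambda>s. \<sigma> s $ i $ i) has_real_derivative \<sigma>' i s) (at s within {0..T})"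
    and s': "\<And>i. continuous_on {0..T} (\<sigma>' i)"
    and g: "continuous_on {0..T} g" and g0: "g 0 = 0"
  shows "has_young_integral \<sigma> g (\<chi> i. \<sigma> t $ i $ i * g t $ i - integral {0..t} (\<lambda>r. \<sigma>' i r * g r $ i)) 0 t"
proof -
  define P where "P t = (\<chi> i. \<sigma> t $ i $ i * g t $ i - integral {0..t} (\<lambda>r. \<sigma>' i r * g r $ i))" for t
  have mv: "(\<sigma> x *v y) $ i = \<sigma> x $ i $ i * y $ i" if "x \<in> {0..T}" for x y i
  proof -
    have "(\<sigma> x *v y) $ i = (\<Sum>j\<in>UNIV. \<sigma> x $ i $ j * y $ j)"
      by (simp add: matrix_vector_mult_def)
    also have "\<dots> = (\<Sum>j\<in>{i}. \<sigma> x $ i $ j * y $ j)"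
      using diag[OF that] by (intro sum.mono_neutral_right) auto
    finally show ?thesis by simp
  qed
  have "has_young_integral \<sigma> g (P t - P 0) 0 t"
  proof (rule has_young_integral_local)
    show "0 \<le> t" using t by simp
    fix e :: real assume e: "0 < e"
    define e' where "e' = e / real CARD('n)"
    have e': "0 < e'" using e by (simp add: e'_def)
    have "\<forall>i. \<exists>\<delta>>0. \<forall>c x d. 0 \<le> c \<longrightarrow> c \<le> x \<longrightarrow> x \<le> d \<longrightarrow> d \<le> T \<longrightarrow> d - c < \<delta> \<longrightarrow>
        \<bar>\<sigma> x $ i $ i * (g d $ i - g c $ i) - (P d $ i - P c $ i)\<bar> \<le> e' * (d - c)"
    proof
      fix i
      have "continuous_on {0..T} (\<lambda>r. g r $ i)" using g by (rule continuous_on_component)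
      from young_parts_local[OF s[of _ i] s' this e']
      show "\<exists>\<delta>>0. \<forall>c x d. 0 \<le> c \<longrightarrow> c \<le> x \<longrightarrow> x \<le> d \<longrightarrow> d \<le> T \<longrightarrow> d - c < \<delta> \<longrightarrow>
        \<bar>\<sigma> x $ i $ i * (g d $ i - g c $ i) - (P d $ i - P c $ i)\<bar> \<le> e' * (d - c)"
        by (simp add: P_def)
    qed
    then obtain \<delta> where \<delta>: "\<And>i. 0 < \<delta> i"
      "\<And>i c x d. 0 \<le> c \<Longrightarrow> c \<le> x \<Longrightarrow> x \<le> d \<Longrightarrow> d \<le> T \<Longrightarrow> d - c < \<delta> i \<Longrightarrow>
        \<bar>\<sigma> x $ i $ i * (g d $ i - g c $ i) - (P d $ i - P c $ i)\<bar> \<le> e' * (d - c)"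
      by metis
    define m where "m = Min (range \<delta>)"
    have m: "0 < m" "\<And>i. m \<le> \<delta> i"
      using \<delta>(1) by (auto simp: m_def)
    show "\<exists>\<delta>>0. \<forall>c x d. 0 \<le> c \<longrightarrow> c \<le> x \<longrightarrow> x \<le> d \<longrightarrow> d \<le> t \<longrightarrow> d - c < \<delta> \<longrightarrow>
      norm (\<sigma> x *v (g d - g c) - (P d - P c)) \<le> e * (d - c)"
    proof (intro exI[of _ m] conjI allI impI m(1))
      fix c x d assume cd: "0 \<le> c" "c \<le> x" "x \<le> d" "d \<le> t" "d - c < m"
      have "norm (\<sigma> x *v (g d - g c) - (P d - P c)) \<le> (\<Sum>i\<in>UNIV. \<bar>(\<sigma> x *v (g d - g c) - (P d - P c)) $ i\<bar>)"
        by (rule norm_le_l1_cart)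
      also have "\<dots> \<le> (\<Sum>i\<in>(UNIV::'n set). e' * (d - c))"
      proof (rule sum_mono)
        fix i
        show "\<bar>(\<sigma> x *v (g d - g c) - (P d - P c)) $ i\<bar> \<le> e' * (d - c)"
          using \<delta>(2)[of c x d i] cd t m(2)[of i] mv[of x "g d - g c" i] by simp
      qed
      also have "\<dots> = e * (d - c)" by (simp add: e'_def)
      finally show "norm (\<sigma> x *v (g d - g c) - (P d - P c)) \<le> e * (d - c)" .
    qed
  qed
  moreover have "P 0 = 0" by (simp add: P_def g0 vec_eq_iff)
  ultimately show ?thesis by (simp add: P_def)
qed

section \<open>Gronwall's lemma and the reduction of \<open>K_op\<close> to scalar
  coordinates\<close>

lemma gronwall:
  fixes y :: "real \<Rightarrow> real"
  assumes y: "continuous_on {0..T} y" and K: "0 \<le> K"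
    and le: "\<And>t. t \<in> {0..T} \<Longrightarrow> y t \<le> c + K * integral {0..t} y" and t: "t \<in> {0..T}"
  shows "y t \<le> c * exp (K * t)"
proof -
  define Z where "Z t = exp (- K * t) * (c + K * integral {0..t} y)" for t
  have dY: "((\<lambda>t. integral {0..t} y) has_real_derivative y x) (at x within {0..T})" if "x \<in> {0..T}" for x
    using integral_has_vector_derivative[OF y that] by (simp add: has_real_derivative_iff_has_vector_derivative)
  have dZ: "(Z has_real_derivative exp (- K * x) * K * (y x - (c + K * integral {0..x} y))) (at x within {0..T})"
    if "x \<in> {0..T}" for x
    unfolding Z_def
    by (auto intro!: derivative_eq_intros dY[OF that] simp: algebra_simps)
  have "Z t \<le> Z 0"
  proof (cases "t = 0")
    case False
    show ?thesis
    proof (rule DERIV_nonpos_imp_decreasing_open[of 0 t Z])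
      show "0 \<le> t" using t by simp
      show "continuous_on {0..t} Z"
        using t by (intro DERIV_continuous_on) (auto intro!: DERIV_subset[OF dZ])
      fix x assume x: "0 < x" "x < t"
      then have "(Z has_real_derivative exp (- K * x) * K * (y x - (c + K * integral {0..x} y))) (at x)"
        using dZ[of x] t at_within_Icc_at[of 0 x T] by simp
      moreover have "exp (- K * x) * K * (y x - (c + K * integral {0..x} y)) \<le> 0"
        using le[of x] x t K by (intro mult_nonneg_nonpos) auto
      ultimately show "\<exists>y. (Z has_real_derivative y) (at x) \<and> y \<le> 0" by blast
    qed
  qed simp
  then have "exp (- K * t) * (c + K * integral {0..t} y) \<le> c" by (simp add: Z_def)
  then have "c + K * integral {0..t} y \<le> c * exp (K * t)"
    by (simp add: exp_minus field_simps)
  then show ?thesis using le[OF t] by simp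
qed

text \<open>Membership in \<open>L2 T\<close> says nothing about values outside [0,T]; the cutoff
  makes each coordinate a square-integrable function on the whole line with the support required by
  the scalar results.\<close>

definition component :: "real \<Rightarrow> (real \<Rightarrow> real^'n) \<Rightarrow> 'n \<Rightarrow> real \<Rightarrow> real" where
  "component T u i s = indicator {0..T} s * (u s $ i)"

lemma square_integrable_component:
  fixes u :: "real \<Rightarrow> real^'n"
  assumes "u \<in> L2 T"
  shows "square_integrable (component T u i)"
proof -
  have m: "(\<lambda>s. indicator {0..T} s *\<^sub>R u s) \<in> borel_measurable borel"
    and i: "integrable lborel (\<lambda>s. indicator {0..T} s * (norm (u s))\<^sup>2)"
    using assms by (auto simp: L2_def set_borel_measurable_def set_integrable_def)
  have "(\<lambda>v::real^'n. v $ i) \<in> borel_measurable borel"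
    by (intro borel_measurable_continuous_onI continuous_intros)
  from measurable_compose[OF m this] have [measurable]: "component T u i \<in> borel_measurable borel"
    by (simp add: component_def[abs_def])
  have "integrable lborel (\<lambda>s. (component T u i s)\<^sup>2)"
  proof (rule Bochner_Integration.integrable_bound[OF i])
    show "AE s in lborel. norm ((component T u i s)\<^sup>2) \<le> norm (indicator {0..T} s * (norm (u s))\<^sup>2)"
      using component_le_norm_cart[of "u _" i]
      by (intro AE_I2) (auto simp: component_def abs_le_square_iff[symmetric] split: split_indicator)
  qed measurable
  then show ?thesis by (simp add: square_integrable_def)
qed

lemma vec_has_bochner_integral:
  fixes f :: "real \<Rightarrow> real^'n"
  assumes "\<And>i. has_bochner_integral M (\<lambda>s. f s $ i) (I $ i)"
  shows "has_bochner_integral M f I"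
proof -
  have "has_bochner_integral M (\<lambda>s. \<Sum>i\<in>UNIV. (f s $ i) *\<^sub>R axis i (1::real)) (\<Sum>i\<in>UNIV. (I $ i) *\<^sub>R axis i 1)"
    using assms by (intro has_bochner_integral_sum has_bochner_integral_scaleR_left) auto
  then show ?thesis
    by (simp add: basis_expansion flip: scalar_mult_eq_scaleR)
qed

lemma K_op_component:
  assumes H: "0 < H" "H < 1" and u: "u \<in> L2 T" and t: "t \<in> {0..T}"
  shows "K_op H u t $ i = c_H H * volterra (H - 1/2) (component T u i) t"
proof (cases "t = 0")
  case True
  then show ?thesis by (simp add: K_op_def set_lebesgue_integral_def volterra_nonpos)
next
  case False
  define I where "I = (\<chi> i. c_H H * volterra (H - 1/2) (component T u i) t)"
  have "has_bochner_integral lborel (\<lambda>s. indicator {0<..<t} s *\<^sub>R (K_kernel H t s *\<^sub>R u s)) I"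
  proof (rule vec_has_bochner_integral)
    fix i
    have "(\<lambda>s. (indicator {0<..<t} s *\<^sub>R (K_kernel H t s *\<^sub>R u s)) $ i)
        = (\<lambda>s. indicator {0<..<t} s * (K_kernel H t s * component T u i s))"
      using t by (auto simp: component_def split: split_indicator)
    then show "has_bochner_integral lborel (\<lambda>s. (indicator {0<..<t} s *\<^sub>R (K_kernel H t s *\<^sub>R u s)) $ i) (I $ i)"
      using integral_K_kernel[OF H square_integrable_component[OF u], of t i] t False
      by (simp add: has_bochner_integral_iff I_def)
  qed
  then show ?thesis
    by (simp add: K_op_def set_lebesgue_integral_def has_bochner_integral_iff I_def)
qed

subsection \<open>The Cameron--Martin space\<close>

lemma L2_diff:
  fixes u w :: "real \<Rightarrow> real^'n"
  assumes u: "u \<in> L2 T" and w: "w \<in> L2 T"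
  shows "(\<lambda>s. u s - w s) \<in> L2 T"
proof -
  let ?i = "\<lambda>s. indicator {0..T} s :: real"
  have mu: "(\<lambda>s. ?i s *\<^sub>R u s) \<in> borel_measurable borel"
    and iu: "integrable lborel (\<lambda>s. ?i s * (norm (u s))\<^sup>2)"
    and mw: "(\<lambda>s. ?i s *\<^sub>R w s) \<in> borel_measurable borel"
    and iw: "integrable lborel (\<lambda>s. ?i s * (norm (w s))\<^sup>2)"
    using u w by (auto simp: L2_def set_borel_measurable_def set_integrable_def)
  have m: "(\<lambda>s. ?i s *\<^sub>R (u s - w s)) \<in> borel_measurable borel"
    using borel_measurable_diff[OF mu mw] by (simp add: scaleR_diff_right)
  have "integrable lborel (\<lambda>s. ?i s * (norm (u s - w s))\<^sup>2)"
  proof (rule Bochner_Integration.integrable_bound)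
    show "integrable lborel (\<lambda>s. 2 * (?i s * (norm (u s))\<^sup>2 + ?i s * (norm (w s))\<^sup>2))"
      using iu iw by auto
    have eq: "(\<lambda>s. ?i s * (norm (u s - w s))\<^sup>2) = (\<lambda>s. (norm (?i s *\<^sub>R (u s - w s)))\<^sup>2)"
      by (auto split: split_indicator)
    show "(\<lambda>s. ?i s * (norm (u s - w s))\<^sup>2) \<in> borel_measurable lborel"
      unfolding eq measurable_lborel2 
      by (intro borel_measurable_power measurable_compose[OF m] borel_measurable_norm)
    show "AE s in lborel. norm (?i s * (norm (u s - w s))\<^sup>2)
        \<le> norm (2 * (?i s * (norm (u s))\<^sup>2 + ?i s * (norm (w s))\<^sup>2))"
    proof (intro AE_I2)
      fix s
      have "(norm (u s - w s))\<^sup>2 \<le> (norm (u s) + norm (w s))\<^sup>2"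
        by (intro power_mono norm_triangle_ineq4) auto
      also have "\<dots> \<le> 2 * ((norm (u s))\<^sup>2 + (norm (w s))\<^sup>2)"
        using sum_squares_bound[of "norm (u s)" "norm (w s)"] by (simp add: power2_sum)
      finally show "norm (?i s * (norm (u s - w s))\<^sup>2)
        \<le> norm (2 * (?i s * (norm (u s))\<^sup>2 + ?i s * (norm (w s))\<^sup>2))"
        by (auto split: split_indicator)
    qed
  qed
  with m show ?thesis
    by (simp add: L2_def set_borel_measurable_def set_integrable_def)
qed

lemma norm_square_vec: "(norm (x::real^'n))\<^sup>2 = (\<Sum>i\<in>UNIV. (x $ i)\<^sup>2)"
  by (simp add: norm_vec_def L2_set_def sum_nonneg)

lemma L2_vecI:
  assumes U: "\<And>i::'n::finite. square_integrable (U i)"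
  shows "(\<lambda>s. \<chi> i. U i s) \<in> L2 T"
proof -
  let ?u = "\<lambda>s. \<chi> i. U i s"
  have mU: "U i \<in> borel_measurable borel" and iU: "integrable lborel (\<lambda>s. (U i s)\<^sup>2)" for i
    using U by (auto simp: square_integrable_def)
  have "(\<lambda>s. \<Sum>i\<in>UNIV. U i s *\<^sub>R axis i (1::real)) \<in> borel_measurable borel"
    using mU by (intro borel_measurable_sum borel_measurable_scaleR) auto
  moreover have "?u = (\<lambda>s. \<Sum>i\<in>UNIV. U i s *\<^sub>R axis i 1)"
    using basis_expansion[of "?u _"] by (simp flip: scalar_mult_eq_scaleR)
  ultimately have m: "?u \<in> borel_measurable borel" by simp
  have "integrable lborel (\<lambda>s. (norm (?u s))\<^sup>2)"
    unfolding norm_square_vec using iU by simp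
  then have "set_integrable lborel {0..T} (\<lambda>s. (norm (?u s))\<^sup>2)"
    unfolding set_integrable_def by (intro integrable_mult_indicator) auto
  moreover have "(\<lambda>s. indicator {0..T} s *\<^sub>R ?u s) \<in> borel_measurable borel"
    using m by (intro borel_measurable_scaleR) auto
  ultimately show ?thesis
    by (simp add: L2_def set_borel_measurable_def)
qed

lemma c_H_pos:
  assumes "0 < H" "H < 1"
  shows "0 < c_H H"
  unfolding c_H_def using assms
  by (intro real_sqrt_gt_zero divide_pos_pos mult_pos_pos Gamma_real_pos) auto

lemma d_H_nonneg:
  assumes "0 < H" "H < 1"
  shows "0 \<le> d_H H"
  unfolding d_H_def using assms
  by (intro real_sqrt_ge_zero divide_nonneg_pos mult_nonneg_nonneg less_imp_le Gamma_real_pos) auto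

lemma has_real_derivative_imp_lipschitz:
  fixes f :: "real \<Rightarrow> real"
  assumes "\<And>t. t \<in> {0..T} \<Longrightarrow> (f has_real_derivative f' t) (at t within {0..T})"
    and "\<And>t. t \<in> {0..T} \<Longrightarrow> \<bar>f' t\<bar> \<le> S"
    and "s \<in> {0..T}" "t \<in> {0..T}"
  shows "\<bar>f t - f s\<bar> \<le> S * \<bar>t - s\<bar>"
  using field_differentiable_bound[of "{0..T}" f f' S t s] assms by (simp add: real_norm_def)

lemma lipschitz_imp_holder:
  assumes "0 \<le> h" "h \<le> T" "\<gamma> \<le> (1::real)"
  shows "h \<le> T powr (1 - \<gamma>) * h powr \<gamma>"
proof (cases "h = 0")
  case False
  then have "h = h powr (1 - \<gamma>) * h powr \<gamma>"
    using assms by (simp flip: powr_add)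
  also have "\<dots> \<le> T powr (1 - \<gamma>) * h powr \<gamma>"
    using assms by (intro mult_right_mono powr_mono2) auto
  finally show ?thesis .
qed simp

section \<open>Injectivity, range and path regularity of \<open>K_sigma\<close>\<close>

locale fractional_noise =
  fixes H T :: real and \<sigma> :: "real \<Rightarrow> real^'n^'n" and \<sigma>' :: "'n \<Rightarrow> real \<Rightarrow> real"
  assumes H: "1/4 < H" "H < 1" and T: "0 < T"
    and diag: "\<And>s i j. s \<in> {0..T} \<Longrightarrow> i \<noteq> j \<Longrightarrow> \<sigma> s $ i $ j = 0"
    and deriv: "\<And>s i. s \<in> {0..T} \<Longrightarrow> ((\<lambda>s. \<sigma> s $ i $ i) has_real_derivative \<sigma>' i s) (at s within {0..T})"
    and cont: "\<And>i. continuous_on {0..T} (\<sigma>' i)"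
    and lower: "\<And>i. \<exists>m>0. \<forall>s\<in>{0..T}. m \<le> \<sigma> s $ i $ i"
begin

lemma H0: "0 < H" "- 1/2 < H - 1/2" "- 1/4 < H - 1/2" "H - 1/2 < 1/2"
  using H by auto

lemma \<sigma>_cont: "continuous_on {0..T} (\<lambda>s. \<sigma> s $ i $ i)"
  using deriv by (intro DERIV_continuous_on) auto

lemma \<sigma>_pos: "s \<in> {0..T} \<Longrightarrow> 0 < \<sigma> s $ i $ i"
  using lower[of i] by (meson less_le_trans)

lemma K_op_0: "K_op H u 0 = 0"
  by (simp add: K_op_def set_lebesgue_integral_def)

lemma K_op_component_continuous:
  assumes u: "u \<in> L2 T"
  shows "continuous_on {0..T} (\<lambda>t. K_op H u t $ i)"
proof -
  have "continuous_on {0..T} (volterra (H - 1/2) (component T u i))"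
    using H0 square_integrable_component[OF u] by (intro volterra_continuous) (auto simp: component_def)
  then have "continuous_on {0..T} (\<lambda>t. c_H H * volterra (H - 1/2) (component T u i) t)"
    by (rule continuous_on_mult_left)
  then show ?thesis
    by (rule continuous_on_eq) (simp add: K_op_component[OF H0(1) H(2) u])
qed

lemma K_op_continuous:
  assumes u: "u \<in> L2 T"
  shows "continuous_on {0..T} (K_op H u)"
proof -
  have "continuous_on {0..T} (\<lambda>t. \<chi> i. K_op H u t $ i)"
    by (intro continuous_on_vec_lambda K_op_component_continuous u)
  then show ?thesis by simp
qed

lemma K_sigma_component:
  assumes u: "u \<in> L2 T" and t: "t \<in> {0..T}"
  shows "K_sigma H \<sigma> u t $ i = \<sigma> t $ i $ i * K_op H u t $ i - integral {0..t} (\<lambda>r. \<sigma>' i r * K_op H u r $ i)"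
proof -
  have "has_young_integral \<sigma> (K_op H u)
      (\<chi> i. \<sigma> t $ i $ i * K_op H u t $ i - integral {0..t} (\<lambda>r. \<sigma>' i r * K_op H u r $ i)) 0 t"
    by (rule has_young_integral_diagonal[OF t])
      (auto intro: diag deriv cont K_op_continuous u K_op_0)
  then show ?thesis
    by (simp add: K_sigma_def young_integral_eqI)
qed

lemma K_sigma_0:
  assumes u: "u \<in> L2 T"
  shows "K_sigma H \<sigma> u 0 = 0"
  using K_sigma_component[OF u, of 0] T by (simp add: vec_eq_iff K_op_0)

lemma K_op_diff:
  assumes u: "u \<in> L2 T" and w: "w \<in> L2 T" and t: "t \<in> {0..T}"
  shows "K_op H (\<lambda>s. u s - w s) t = K_op H u t - K_op H w t"
proof (cases "t = 0")
  case False
  then have t0: "0 < t" using t by simp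
  have "K_op H (\<lambda>s. u s - w s) t $ i = K_op H u t $ i - K_op H w t $ i" for i
  proof -
    note k = integral_K_kernel[OF H0(1) H(2) _ t0]
    let ?k = "\<lambda>v s. indicator {0<..<t} s * (K_kernel H t s * component T v i s)"
    have "(\<lambda>s. ?k (\<lambda>s. u s - w s) s) = (\<lambda>s. ?k u s - ?k w s)"
      by (auto simp: component_def algebra_simps)
    then have "(LBINT s. ?k (\<lambda>s. u s - w s) s) = (LBINT s. ?k u s) - (LBINT s. ?k w s)"
      using k(1)[OF square_integrable_component[OF u, of i]] k(1)[OF square_integrable_component[OF w, of i]] by simp
    then show ?thesis
      using k(2)[OF square_integrable_component[OF u, of i]] k(2)[OF square_integrable_component[OF w, of i]] k(2)[OF square_integrable_component[OF L2_diff[OF u w], of i]]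
      by (simp add: K_op_component[OF H0(1) H(2) _ t] u w L2_diff)
  qed
  then show ?thesis by (simp add: vec_eq_iff)
qed (simp add: K_op_0)

lemma K_sigma_diff:
  assumes u: "u \<in> L2 T" and w: "w \<in> L2 T" and t: "t \<in> {0..T}"
  shows "K_sigma H \<sigma> (\<lambda>s. u s - w s) t = K_sigma H \<sigma> u t - K_sigma H \<sigma> w t"
proof -
  have int: "(\<lambda>r. \<sigma>' i r * K_op H v r $ i) integrable_on {0..t}" if "v \<in> L2 T" for v i
    using t by (intro integrable_continuous_interval continuous_on_mult
        continuous_on_subset[OF cont] continuous_on_subset[OF K_op_component_continuous[OF that]]) auto
  have "K_sigma H \<sigma> (\<lambda>s. u s - w s) t $ i = (K_sigma H \<sigma> u t - K_sigma H \<sigma> w t) $ i" for i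
  proof -
    have "integral {0..t} (\<lambda>r. \<sigma>' i r * K_op H (\<lambda>s. u s - w s) r $ i)
        = integral {0..t} (\<lambda>r. \<sigma>' i r * K_op H u r $ i - \<sigma>' i r * K_op H w r $ i)"
      using t by (intro integral_cong) (auto simp: K_op_diff[OF u w] algebra_simps)
    also have "\<dots> = integral {0..t} (\<lambda>r. \<sigma>' i r * K_op H u r $ i) - integral {0..t} (\<lambda>r. \<sigma>' i r * K_op H w r $ i)"
      using int u w by (intro Henstock_Kurzweil_Integration.integral_diff) auto
    finally show ?thesis
      using K_sigma_component[OF L2_diff[OF u w] t, of i] K_sigma_component[OF u t, of i]
        K_sigma_component[OF w t, of i] K_op_diff[OF u w t]
      by (simp add: algebra_simps)
  qed
  then show ?thesis by (simp add: vec_eq_iff)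
qed

text \<open>Integration by parts turns the assumption into the homogeneous equation
  \<open>\<sigma> g = \<integral> \<sigma>' g\<close> for each coordinate \<open>g\<close>. With
  \<sigma> bounded below and its derivative bounded, Gronwall's lemma with initial constant 0 gives
  \<open>g = 0\<close>.\<close>

lemma K_sigma_zero_imp_K_op_zero:
  assumes u: "u \<in> L2 T" and zero: "\<And>t. t \<in> {0..T} \<Longrightarrow> K_sigma H \<sigma> u t = 0" and t: "t \<in> {0..T}"
  shows "K_op H u t $ i = 0"
proof -
  let ?g = "\<lambda>r. K_op H u r $ i"
  obtain m where m: "0 < m" "\<And>s. s \<in> {0..T} \<Longrightarrow> m \<le> \<sigma> s $ i $ i"
    using lower[of i] by blast
  obtain S where S: "0 < S" "\<And>s. s \<in> {0..T} \<Longrightarrow> \<bar>\<sigma>' i s\<bar> \<le> S"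
    using continuous_on_Icc_bounded[OF cont[of i]] by (auto simp: real_norm_def)
  note cg = K_op_component_continuous[OF u, of i]
  have "\<bar>?g t\<bar> \<le> 0 * exp (S / m * t)"
  proof (rule gronwall[where T = T])
    show "continuous_on {0..T} (\<lambda>r. \<bar>?g r\<bar>)" using cg by (rule continuous_on_rabs)
    show "0 \<le> S / m" using S m by simp
    fix t assume t: "t \<in> {0..T}"
    have c: "continuous_on {0..t} ?g" "continuous_on {0..t} (\<sigma>' i)"
      using t by (auto intro: continuous_on_subset[OF cg] continuous_on_subset[OF cont])
    have ca: "continuous_on {0..t} (\<lambda>r. \<bar>?g r\<bar>)"
      using c(1) by (rule continuous_on_rabs)
    have "\<sigma> t $ i $ i * ?g t = integral {0..t} (\<lambda>r. \<sigma>' i r * ?g r)"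
      using K_sigma_component[OF u t, of i] zero[OF t] by simp
    then have "\<sigma> t $ i $ i * \<bar>?g t\<bar> = \<bar>integral {0..t} (\<lambda>r. \<sigma>' i r * ?g r)\<bar>"
      using \<sigma>_pos[OF t, of i] by (metis abs_mult abs_of_pos)
    also have "\<dots> \<le> integral {0..t} (\<lambda>r. S * \<bar>?g r\<bar>)"
      unfolding real_norm_def[symmetric] using c ca S t
      by (intro integral_norm_bound_integral integrable_continuous_interval
          continuous_on_mult continuous_on_const ca c)
        (auto simp: abs_mult intro!: mult_right_mono)
    also have "\<dots> = S * integral {0..t} (\<lambda>r. \<bar>?g r\<bar>)" by simp
    finally have "m * \<bar>?g t\<bar> \<le> S * integral {0..t} (\<lambda>r. \<bar>?g r\<bar>)"
      using mult_right_mono[OF m(2)[OF t], of "\<bar>?g t\<bar>"] by simp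
    then show "\<bar>?g t\<bar> \<le> 0 + S / m * integral {0..t} (\<lambda>r. \<bar>?g r\<bar>)"
      using m by (simp add: field_simps)
  qed (rule t)
  then show ?thesis by simp
qed

lemma K_sigma_injective:
  assumes u: "u \<in> L2 T" and zero: "\<And>t. t \<in> {0..T} \<Longrightarrow> K_sigma H \<sigma> u t = 0"
  shows "(LBINT t:{0..T}. (norm (u t))\<^sup>2) = 0"
proof -
  have "AE s in lborel. 0 < s \<longrightarrow> component T u i s = 0" for i
  proof (rule volterra_injective[OF H0(3,4) square_integrable_component[OF u] _ T])
    fix t assume t: "t \<in> {0..T}"
    show "volterra (H - 1/2) (component T u i) t = 0"
      using K_sigma_zero_imp_K_op_zero[OF u zero t, of i] K_op_component[OF H0(1) H(2) u t, of i]
        c_H_pos[OF H0(1) H(2)] by simp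
  qed (simp add: component_def)
  then have "AE s in lborel. \<forall>i. 0 < s \<longrightarrow> component T u i s = 0"
    by (intro eventually_all_finite) auto
  then have "AE s in lborel. indicator {0..T} s *\<^sub>R (norm (u s))\<^sup>2 = 0"
    using AE_lborel_singleton[of 0]
    by eventually_elim (auto simp: component_def norm_square_vec split: split_indicator)
  then show ?thesis
    unfolding set_lebesgue_integral_def by (rule integral_eq_zero_AE)
qed

text \<open>The condition on a drift under which the Abel equation is solvable: continuity for
  \<open>H \<le> 1/2\<close>, and a Hoelder order above \<open>H - 1/2\<close> otherwise. The
  restriction \<open>\<gamma> \<le> 1\<close> lets the Lipschitz coefficient \<sigma> be treated as
  Hoelder of the same order.\<close>

definition regular :: "(real \<Rightarrow> real^'n) \<Rightarrow> bool" where
  "regular f \<longleftrightarrow> continuous_on {0..T} f \<and>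
    (1/2 < H \<longrightarrow> (\<exists>L \<gamma>. H - 1/2 < \<gamma> \<and> \<gamma> \<le> 1 \<and> 0 \<le> L \<and>
      (\<forall>r\<in>{0..T}. \<forall>s\<in>{0..T}. norm (f s - f r) \<le> L * \<bar>s - r\<bar> powr \<gamma>)))"

text \<open>If \<open>K_op H u\<close> is the primitive of \<open>f / \<sigma>\<close>, then
  integrating \<sigma> against it returns the primitive of \<open>f\<close>. So each coordinate of
  \<open>u\<close> solves the scalar Volterra equation with right-hand side
  \<open>q i / c_H H\<close>.\<close>

lemma K_sigma_surjective_on_integrals:
  assumes f: "regular f"
  obtains u where "u \<in> L2 T" "\<And>t. t \<in> {0..T} \<Longrightarrow> K_sigma H \<sigma> u t = integral {0..t} f"
proof -
  have cf: "continuous_on {0..T} f" using f by (simp add: regular_def)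
  have cfi: "continuous_on {0..T} (\<lambda>s. f s $ i)" for i
    using cf by (rule continuous_on_component)
  define q where "q i s = f s $ i / \<sigma> s $ i $ i" for i s
  have cq: "continuous_on {0..T} (q i)" for i
    unfolding q_def[abs_def] using \<sigma>_pos[of _ i] by (intro continuous_intros cfi \<sigma>_cont) force
  have c: "0 < c_H H" using H0 H by (intro c_H_pos)
  have hq: "\<exists>L \<gamma>. H - 1/2 < \<gamma> \<and> (\<forall>r\<in>{0..T}. \<forall>s\<in>{0..T}. \<bar>q i s / c_H H - q i r / c_H H\<bar> \<le> L * \<bar>s - r\<bar> powr \<gamma>)"
    if H2: "0 < H - 1/2" for i
  proof -
    obtain L \<gamma> where \<gamma>: "H - 1/2 < \<gamma>" "\<gamma> \<le> 1" and L0: "0 \<le> L"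
      and L: "\<And>r s. r \<in> {0..T} \<Longrightarrow> s \<in> {0..T} \<Longrightarrow> norm (f s - f r) \<le> L * \<bar>s - r\<bar> powr \<gamma>"
      using f H2 by (auto simp: regular_def)
    obtain m where m: "0 < m" "\<And>s. s \<in> {0..T} \<Longrightarrow> m \<le> \<sigma> s $ i $ i"
      using lower[of i] by blast
    obtain S where S: "0 < S" "\<And>s. s \<in> {0..T} \<Longrightarrow> \<bar>\<sigma>' i s\<bar> \<le> S"
      using continuous_on_Icc_bounded[OF cont[of i]] by (auto simp: real_norm_def)
    obtain M where M: "0 < M" "\<And>s. s \<in> {0..T} \<Longrightarrow> \<bar>q i s\<bar> \<le> M"
      using continuous_on_Icc_bounded[OF cq[of i]] by (auto simp: real_norm_def)
    let ?K = "(L + M * (S * T powr (1 - \<gamma>))) / m / c_H H"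
    have "\<bar>q i s / c_H H - q i r / c_H H\<bar> \<le> ?K * \<bar>s - r\<bar> powr \<gamma>" if r: "r \<in> {0..T}" and s: "s \<in> {0..T}" for r s
    proof -
      have "\<bar>\<sigma> r $ i $ i - \<sigma> s $ i $ i\<bar> \<le> S * \<bar>r - s\<bar>"
        by (rule has_real_derivative_imp_lipschitz[OF deriv S(2) s r])
      also have "\<dots> \<le> S * (T powr (1 - \<gamma>) * \<bar>r - s\<bar> powr \<gamma>)"
        using S r s \<gamma> by (intro mult_left_mono lipschitz_imp_holder) auto
      finally have 1: "\<bar>\<sigma> r $ i $ i - \<sigma> s $ i $ i\<bar> \<le> S * T powr (1 - \<gamma>) * \<bar>s - r\<bar> powr \<gamma>"
        by (simp add: abs_minus_commute)
      have 2: "\<bar>f s $ i - f r $ i\<bar> \<le> L * \<bar>s - r\<bar> powr \<gamma>"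
        using component_le_norm_cart[of "f s - f r" i] L[OF r s] by simp
      \<comment> \<open>Writing the increment of the quotient with \<open>q i r\<close> itself
        leaves a single denominator, so only the lower bound for \<sigma> and the bound for
        \<open>q\<close> are needed.\<close>
      have "q i s - q i r = ((f s $ i - f r $ i) + q i r * (\<sigma> r $ i $ i - \<sigma> s $ i $ i)) / \<sigma> s $ i $ i"
        using \<sigma>_pos[OF r, of i] \<sigma>_pos[OF s, of i] by (simp add: q_def field_simps)
      also have "\<bar>\<dots>\<bar> = \<bar>(f s $ i - f r $ i) + q i r * (\<sigma> r $ i $ i - \<sigma> s $ i $ i)\<bar> / \<sigma> s $ i $ i"
        using \<sigma>_pos[OF s, of i] by simp
      also have "\<dots> \<le> \<bar>(f s $ i - f r $ i) + q i r * (\<sigma> r $ i $ i - \<sigma> s $ i $ i)\<bar> / m"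
        using m s by (intro divide_left_mono mult_pos_pos \<sigma>_pos) auto
      also have "\<dots> \<le> (L * \<bar>s - r\<bar> powr \<gamma> + M * (S * T powr (1 - \<gamma>) * \<bar>s - r\<bar> powr \<gamma>)) / m"
      proof (intro divide_right_mono order_trans[OF abs_triangle_ineq] add_mono 2)
        show "\<bar>q i r * (\<sigma> r $ i $ i - \<sigma> s $ i $ i)\<bar> \<le> M * (S * T powr (1 - \<gamma>) * \<bar>s - r\<bar> powr \<gamma>)"
          unfolding abs_mult using M r 1 by (intro mult_mono) auto
      qed (use m in auto)
      finally have "\<bar>q i s - q i r\<bar> / c_H H \<le> (L * \<bar>s - r\<bar> powr \<gamma> + M * (S * T powr (1 - \<gamma>) * \<bar>s - r\<bar> powr \<gamma>)) / m / c_H H"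
        using c by (intro divide_right_mono) auto
      moreover have "\<bar>q i s / c_H H - q i r / c_H H\<bar> = \<bar>q i s - q i r\<bar> / c_H H"
        using c by (simp flip: diff_divide_distrib)
      ultimately show ?thesis by (simp add: algebra_simps)
    qed
    with \<gamma> show ?thesis by blast
  qed
  have "\<forall>i. \<exists>v. square_integrable v \<and> (\<forall>t\<in>{0..T}. volterra (H - 1/2) v t = integral {0..t} (\<lambda>s. q i s / c_H H))"
  proof
    fix i
    have "continuous_on {0..T} (\<lambda>s. q i s / c_H H)"
      using c by (intro continuous_intros cq) auto
    from volterra_surjective_on[OF H0(2,4) T this hq]
    show "\<exists>v. square_integrable v \<and> (\<forall>t\<in>{0..T}. volterra (H - 1/2) v t = integral {0..t} (\<lambda>s. q i s / c_H H))"
      by metis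
  qed
  then obtain U where U: "\<And>i. square_integrable (U i)"
    "\<And>i t. t \<in> {0..T} \<Longrightarrow> volterra (H - 1/2) (U i) t = integral {0..t} (\<lambda>s. q i s / c_H H)"
    by metis
  define u where "u s = (\<chi> i. U i s)" for s
  have u: "u \<in> L2 T"
    unfolding u_def[abs_def] using U(1) by (rule L2_vecI)
  have g: "K_op H u t $ i = integral {0..t} (q i)" if t: "t \<in> {0..T}" for t i
  proof -
    have "volterra (H - 1/2) (component T u i) t = volterra (H - 1/2) (U i) t"
      using t by (intro volterra_cong) (auto simp: component_def u_def)
    then show ?thesis
      using K_op_component[OF H0(1) H(2) u t, of i] U(2)[OF t, of i] c by simp
  qed
  have "K_sigma H \<sigma> u t $ i = integral {0..t} f $ i" if t: "t \<in> {0..T}" for t i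
  proof -
    let ?g = "\<lambda>s. integral {0..s} (q i)"
    have cg: "continuous_on {0..T} ?g"
      using cq by (intro indefinite_integral_continuous_1 integrable_continuous_interval)
    have sub: "continuous_on {0..t} h" if "continuous_on {0..T} h" for h :: "real \<Rightarrow> real"
      using t by (intro continuous_on_subset[OF that]) auto
    \<comment> \<open>The product rule for \<sigma> times the primitive of \<open>q\<close> reverses
      the integration by parts contained in \<open>K_sigma_component\<close>.\<close>
    have "((\<lambda>s. \<sigma>' i s * ?g s + f s $ i) has_integral \<sigma> t $ i $ i * ?g t - \<sigma> 0 $ i $ i * ?g 0) {0..t}"
    proof (rule fundamental_theorem_of_calculus)
      show "0 \<le> t" using t by simp
      fix x assume "x \<in> {0..t}"
      then have x: "x \<in> {0..T}" using t by auto
      have "(?g has_real_derivative q i x) (at x within {0..T})"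
        using integral_has_vector_derivative[OF cq x] by (simp add: has_real_derivative_iff_has_vector_derivative)
      from DERIV_mult[OF deriv[OF x, of i] this]
      have "((\<lambda>s. \<sigma> s $ i $ i * ?g s) has_real_derivative \<sigma>' i x * ?g x + f x $ i) (at x within {0..T})"
        using \<sigma>_pos[OF x, of i] by (simp add: q_def)
      then have "((\<lambda>s. \<sigma> s $ i $ i * ?g s) has_real_derivative \<sigma>' i x * ?g x + f x $ i) (at x within {0..t})"
        by (rule DERIV_subset) (use t in auto)
      then show "((\<lambda>s. \<sigma> s $ i $ i * ?g s) has_vector_derivative \<sigma>' i x * ?g x + f x $ i) (at x within {0..t})"
        by (simp add: has_real_derivative_iff_has_vector_derivative)
    qed
    then have "\<sigma> t $ i $ i * ?g t = integral {0..t} (\<lambda>s. \<sigma>' i s * ?g s + f s $ i)"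
      by (simp add: integral_unique)
    also have "\<dots> = integral {0..t} (\<lambda>s. \<sigma>' i s * ?g s) + integral {0..t} (\<lambda>s. f s $ i)"
      by (intro Henstock_Kurzweil_Integration.integral_add integrable_continuous_interval sub
          continuous_on_mult cont cg cfi)
    finally have eq: "\<sigma> t $ i $ i * ?g t - integral {0..t} (\<lambda>s. \<sigma>' i s * ?g s) = integral {0..t} (\<lambda>s. f s $ i)"
      by simp
    have "integral {0..t} (\<lambda>s. \<sigma>' i s * K_op H u s $ i) = integral {0..t} (\<lambda>s. \<sigma>' i s * ?g s)"
      using t g by (intro integral_cong) auto
    moreover have "f integrable_on {0..t}"
      using t by (intro integrable_continuous_interval continuous_on_subset[OF cf]) auto
    ultimately show ?thesis
      using K_sigma_component[OF u t, of i] g[OF t, of i] eq by simp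
  qed
  then have "K_sigma H \<sigma> u t = integral {0..t} f" if "t \<in> {0..T}" for t
    using that by (simp add: vec_eq_iff)
  with u show thesis by (rule that)
qed

text \<open>The order 1/2 of \<open>K_op\<close> for \<open>H > 1/2\<close> survives the
  integration-by-parts formula, whose other terms are Lipschitz. The point is that 1/2 exceeds
  \<open>H - 1/2\<close> for every \<open>H < 1\<close>.\<close>

lemma K_sigma_holder:
  assumes H2: "1/2 < H" and u: "u \<in> L2 T"
  obtains L where "0 \<le> L"
    "\<And>r s. r \<in> {0..T} \<Longrightarrow> s \<in> {0..T} \<Longrightarrow> norm (K_sigma H \<sigma> u s - K_sigma H \<sigma> u r) \<le> L * \<bar>s - r\<bar> powr (1/2)"
proof -
  have "\<exists>C\<ge>0. \<forall>s t. 0 \<le> s \<longrightarrow> s \<le> t \<longrightarrow> t \<le> T \<longrightarrow>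
      \<bar>K_sigma H \<sigma> u t $ i - K_sigma H \<sigma> u s $ i\<bar> \<le> C * (t - s) powr (1/2)" for i
  proof -
    let ?g = "\<lambda>r. K_op H u r $ i"
    note cg = K_op_component_continuous[OF u, of i]
    obtain D where D: "0 \<le> D" "\<And>s t. 0 \<le> s \<Longrightarrow> s \<le> t \<Longrightarrow> t \<le> T \<Longrightarrow>
        \<bar>volterra (H - 1/2) (component T u i) t - volterra (H - 1/2) (component T u i) s\<bar> \<le> D * (t - s) powr (1/2)"
      using volterra_holder[of "H - 1/2" "component T u i" T] H2 H0 square_integrable_component[OF u] by auto
    have c: "0 < c_H H" using H0 H by (intro c_H_pos)
    obtain S where S: "0 < S" "\<And>s. s \<in> {0..T} \<Longrightarrow> \<bar>\<sigma>' i s\<bar> \<le> S"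
      using continuous_on_Icc_bounded[OF cont[of i]] by (auto simp: real_norm_def)
    obtain N where N: "0 < N" "\<And>s. s \<in> {0..T} \<Longrightarrow> \<bar>\<sigma> s $ i $ i\<bar> \<le> N"
      using continuous_on_Icc_bounded[OF \<sigma>_cont[of i]] by (auto simp: real_norm_def)
    obtain M where M: "0 < M" "\<And>s. s \<in> {0..T} \<Longrightarrow> \<bar>?g s\<bar> \<le> M"
      using continuous_on_Icc_bounded[OF cg] by (auto simp: real_norm_def)
    let ?C = "N * (c_H H * D) + 2 * (S * M * T powr (1/2))"
    have "\<bar>K_sigma H \<sigma> u t $ i - K_sigma H \<sigma> u s $ i\<bar> \<le> ?C * (t - s) powr (1/2)"
      if st: "0 \<le> s" "s \<le> t" "t \<le> T" for s t
    proof -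
      have s: "s \<in> {0..T}" and t: "t \<in> {0..T}" using st by auto
      have h: "t - s \<le> T powr (1/2) * (t - s) powr (1/2)"
        using lipschitz_imp_holder[of "t - s" T "1/2"] st by simp
      have "?g t - ?g s = c_H H * (volterra (H - 1/2) (component T u i) t - volterra (H - 1/2) (component T u i) s)"
        using K_op_component[OF H0(1) H(2) u] s t by (simp add: right_diff_distrib)
      then have dg: "\<bar>?g t - ?g s\<bar> \<le> c_H H * (D * (t - s) powr (1/2))"
        using D(2)[OF st] c by (simp add: abs_mult mult_left_mono)
      have 1: "\<bar>\<sigma> t $ i $ i * (?g t - ?g s)\<bar> \<le> N * (c_H H * (D * (t - s) powr (1/2)))"
        unfolding abs_mult using N t dg by (intro mult_mono) auto
      have "\<bar>\<sigma> t $ i $ i - \<sigma> s $ i $ i\<bar> \<le> S * (t - s)"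
        using has_real_derivative_imp_lipschitz[OF deriv S(2) s t] st by simp
      then have "\<bar>(\<sigma> t $ i $ i - \<sigma> s $ i $ i) * ?g s\<bar> \<le> S * (t - s) * M"
        unfolding abs_mult using M s S st by (intro mult_mono) auto
      then have 2: "\<bar>(\<sigma> t $ i $ i - \<sigma> s $ i $ i) * ?g s\<bar> \<le> S * M * (t - s)"
        by (simp add: algebra_simps)
      have sub: "continuous_on {a..b} (\<lambda>r. \<sigma>' i r * ?g r)" if "0 \<le> a" "b \<le> T" for a b
        using that by (intro continuous_on_mult continuous_on_subset[OF cont] continuous_on_subset[OF cg]) auto
      have "norm (integral {s..t} (\<lambda>r. \<sigma>' i r * ?g r)) \<le> S * M * (t - s)"
      proof (rule integral_bound)
        show "s \<le> t" by (rule st)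
        show "continuous_on {s..t} (\<lambda>r. \<sigma>' i r * ?g r)" using st by (intro sub) auto
        fix r assume "r \<in> {s..t}"
        then show "norm (\<sigma>' i r * ?g r) \<le> S * M"
          unfolding real_norm_def abs_mult using S M st by (intro mult_mono) auto
      qed
      then have 3: "\<bar>integral {s..t} (\<lambda>r. \<sigma>' i r * ?g r)\<bar> \<le> S * M * (t - s)" by simp
      have "integral {0..s} (\<lambda>r. \<sigma>' i r * ?g r) + integral {s..t} (\<lambda>r. \<sigma>' i r * ?g r) = integral {0..t} (\<lambda>r. \<sigma>' i r * ?g r)"
        using st by (intro Henstock_Kurzweil_Integration.integral_combine integrable_continuous_interval sub) auto
      then have "K_sigma H \<sigma> u t $ i - K_sigma H \<sigma> u s $ i
          = \<sigma> t $ i $ i * (?g t - ?g s) + (\<sigma> t $ i $ i - \<sigma> s $ i $ i) * ?g s - integral {s..t} (\<lambda>r. \<sigma>' i r * ?g r)"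
        using K_sigma_component[OF u s, of i] K_sigma_component[OF u t, of i] by (simp add: algebra_simps)
      then have "\<bar>K_sigma H \<sigma> u t $ i - K_sigma H \<sigma> u s $ i\<bar>
          \<le> N * (c_H H * (D * (t - s) powr (1/2))) + 2 * (S * M * (t - s))"
        using 1 2 3 by linarith
      also have "\<dots> \<le> N * (c_H H * (D * (t - s) powr (1/2))) + 2 * (S * M * (T powr (1/2) * (t - s) powr (1/2)))"
        using S M h by (intro add_left_mono mult_left_mono) auto
      finally show ?thesis by (simp add: algebra_simps)
    qed
    moreover have "0 \<le> ?C" using S M N D c by simp
    ultimately show ?thesis by blast
  qed
  then obtain C where C: "\<And>i. 0 \<le> C i"
    "\<And>i s t. 0 \<le> s \<Longrightarrow> s \<le> t \<Longrightarrow> t \<le> T \<Longrightarrow>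
      \<bar>K_sigma H \<sigma> u t $ i - K_sigma H \<sigma> u s $ i\<bar> \<le> C i * (t - s) powr (1/2)"
    by metis
  have le: "norm (K_sigma H \<sigma> u t - K_sigma H \<sigma> u s) \<le> sum C UNIV * (t - s) powr (1/2)"
    if "0 \<le> s" "s \<le> t" "t \<le> T" for s t
  proof -
    have "norm (K_sigma H \<sigma> u t - K_sigma H \<sigma> u s) \<le> (\<Sum>i\<in>UNIV. \<bar>(K_sigma H \<sigma> u t - K_sigma H \<sigma> u s) $ i\<bar>)"
      by (rule norm_le_l1_cart)
    also have "\<dots> \<le> (\<Sum>i\<in>UNIV. C i * (t - s) powr (1/2))"
      using C(2)[OF that] by (intro sum_mono) simp
    finally show ?thesis by (simp add: sum_distrib_right)
  qed
  show thesis
  proof (rule that[of "sum C UNIV"])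
    show "0 \<le> sum C UNIV" using C(1) by (rule sum_nonneg)
    fix r s assume "r \<in> {0..T}" "s \<in> {0..T}"
    then show "norm (K_sigma H \<sigma> u s - K_sigma H \<sigma> u r) \<le> sum C UNIV * \<bar>s - r\<bar> powr (1/2)"
      using le[of r s] le[of s r] by (cases "r \<le> s") (auto simp: norm_minus_commute)
  qed
qed

lemma CM_space_regular:
  assumes h: "h \<in> CM_space H T \<sigma>"
  shows "1/2 < H \<Longrightarrow> \<exists>L\<ge>0. \<forall>r\<in>{0..T}. \<forall>s\<in>{0..T}. norm (h s - h r) \<le> L * \<bar>s - r\<bar> powr (1/2)"
    and "h 0 = 0"
proof -
  obtain u where u: "u \<in> L2 T" "\<And>t. t \<in> {0..T} \<Longrightarrow> h t = K_sigma H \<sigma> u t"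
    using h by (auto simp: CM_space_def)
  show "h 0 = 0" using u K_sigma_0[OF u(1)] T by simp
  show "\<exists>L\<ge>0. \<forall>r\<in>{0..T}. \<forall>s\<in>{0..T}. norm (h s - h r) \<le> L * \<bar>s - r\<bar> powr (1/2)" if "1/2 < H"
    using K_sigma_holder[OF that u(1)] u(2) by metis
qed

lemma integral_in_CM_space:
  assumes "regular f" and "\<And>t. t \<in> {0..T} \<Longrightarrow> h t = integral {0..t} f"
  shows "h \<in> CM_space H T \<sigma>"
proof -
  obtain u where "u \<in> L2 T" "\<And>t. t \<in> {0..T} \<Longrightarrow> K_sigma H \<sigma> u t = integral {0..t} f"
    using K_sigma_surjective_on_integrals[OF assms(1)] by auto
  with assms(2) show ?thesis
    unfolding CM_space_def by (intro CollectI bexI[of _ u]) auto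
qed

lemma CM_space_diff:
  assumes "h \<in> CM_space H T \<sigma>" "k \<in> CM_space H T \<sigma>"
  shows "(\<lambda>t. h t - k t) \<in> CM_space H T \<sigma>"
proof -
  obtain u where u: "u \<in> L2 T" "\<And>t. t \<in> {0..T} \<Longrightarrow> h t = K_sigma H \<sigma> u t"
    using assms(1) by (auto simp: CM_space_def)
  obtain w where w: "w \<in> L2 T" "\<And>t. t \<in> {0..T} \<Longrightarrow> k t = K_sigma H \<sigma> w t"
    using assms(2) by (auto simp: CM_space_def)
  show ?thesis
    unfolding CM_space_def using K_sigma_diff[OF u(1) w(1)] u(2) w(2)
    by (intro CollectI bexI[OF _ L2_diff[OF u(1) w(1)]]) auto
qed

text \<open>The chosen preimage of a path vanishing on [0,T] need not be the zero function. It is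
  some preimage in \<open>L2 T\<close>, because the path is the integral of 0, and injectivity makes
  its energy vanish.\<close>

lemma K_sigma_inv_zero:
  assumes "\<And>t. t \<in> {0..T} \<Longrightarrow> h t = 0"
  shows "(LBINT t:{0..T}. (norm (K_sigma_inv H T \<sigma> h t))\<^sup>2) = 0"
proof -
  have "regular (\<lambda>_. 0)"
    unfolding regular_def using H by (auto intro!: exI[of _ 1])
  then have "h \<in> CM_space H T \<sigma>"
    by (rule integral_in_CM_space) (simp add: assms)
  then have "\<exists>u. u \<in> L2 T \<and> (\<forall>t\<in>{0..T}. h t = K_sigma H \<sigma> u t)"
    by (auto simp: CM_space_def)
  from someI_ex[OF this] have "K_sigma_inv H T \<sigma> h \<in> L2 T"
    "\<And>t. t \<in> {0..T} \<Longrightarrow> h t = K_sigma H \<sigma> (K_sigma_inv H T \<sigma> h) t"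
    by (auto simp: K_sigma_inv_def)
  then show ?thesis
    using assms by (intro K_sigma_injective) auto
qed

end

subsection \<open>Minimizers\<close>

lemma holder_norm_le_iff:
  "holder_norm T \<beta> f \<le> ereal K \<longleftrightarrow>
    (\<forall>s\<in>{0..T}. \<forall>t\<in>{0..T}. s \<noteq> t \<longrightarrow> norm (f t - f s) \<le> K * \<bar>t - s\<bar> powr \<beta>)"
  by (auto simp: holder_norm_def SUP_le_iff pos_divide_le_eq)

text \<open>Mean value estimates extract what the argument uses: bounds on the first derivatives
  give the Lipschitz constants of \<open>b\<close> in space and time, and the bound on the second
  space derivative gives that of the divergence.\<close>

lemma Cb13_bounds:
  fixes b :: "real \<Rightarrow> real^'n \<Rightarrow> real^'n"
  assumes "Cb13 T b"
  obtains \<Lambda> D where "0 \<le> \<Lambda>" "0 \<le> D"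
    "continuous_on ({0..T} \<times> UNIV) (\<lambda>(t, x). b t x)"
    "\<And>t x y. t \<in> {0..T} \<Longrightarrow> norm (b t x - b t y) \<le> \<Lambda> * norm (x - y)"
    "\<And>s t x. s \<in> {0..T} \<Longrightarrow> t \<in> {0..T} \<Longrightarrow> norm (b s x - b t x) \<le> \<Lambda> * \<bar>s - t\<bar>"
    "continuous_on ({0..T} \<times> UNIV) (\<lambda>(t, x). divergence (b t) x)"
    "\<And>t x y. t \<in> {0..T} \<Longrightarrow> \<bar>divergence (b t) x - divergence (b t) y\<bar> \<le> D * norm (x - y)"
proof -
  obtain bt b1 b2 where
    b: "bdd_cont_on T b" and bt: "bdd_cont_on T bt"
    and dt: "\<And>t x. t \<in> {0..T} \<Longrightarrow> ((\<lambda>s. b s x) has_vector_derivative bt t x) (at t within {0..T})"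
    and b1: "bdd_cont_on T b1" and b2: "bdd_cont_on T b2"
    and d1: "\<And>t x. t \<in> {0..T} \<Longrightarrow> (b t has_derivative blinfun_apply (b1 t x)) (at x)"
    and d2: "\<And>t x. t \<in> {0..T} \<Longrightarrow> (b1 t has_derivative blinfun_apply (b2 t x)) (at x)"
    using assms unfolding Cb13_def by metis
  have bound: "\<exists>M>0. \<forall>t\<in>{0..T}. \<forall>x. norm (f t x) \<le> M"
    if "bdd_cont_on T f" for f :: "real \<Rightarrow> real^'n \<Rightarrow> 'b::real_normed_vector"
  proof -
    have "bounded ((\<lambda>(t, x). f t x) ` ({0..T} \<times> UNIV))"
      using that by (simp add: bdd_cont_on_def)
    then obtain M where "0 < M" "\<And>z. z \<in> (\<lambda>(t, x). f t x) ` ({0..T} \<times> UNIV) \<Longrightarrow> norm z \<le> M"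
      unfolding bounded_pos by blast
    then show ?thesis by (intro exI[of _ M]) force
  qed
  obtain Mt where Mt: "0 < Mt" "\<And>t x. t \<in> {0..T} \<Longrightarrow> norm (bt t x) \<le> Mt"
    using bound[OF bt] by blast
  obtain M1 where M1: "0 < M1" "\<And>t x. t \<in> {0..T} \<Longrightarrow> norm (b1 t x) \<le> M1"
    using bound[OF b1] by blast
  obtain M2 where M2: "0 < M2" "\<And>t x. t \<in> {0..T} \<Longrightarrow> norm (b2 t x) \<le> M2"
    using bound[OF b2] by blast
  have l1: "norm (b t x - b t y) \<le> M1 * norm (x - y)" if t: "t \<in> {0..T}" for t x y
    by (rule differentiable_bound[of UNIV "b t" "\<lambda>x. blinfun_apply (b1 t x)"])
      (use d1[OF t] M1(2)[OF t] in \<open>auto simp: norm_blinfun.rep_eq\<close>)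
  have l2: "norm (b1 t x - b1 t y) \<le> M2 * norm (x - y)" if t: "t \<in> {0..T}" for t x y
    by (rule differentiable_bound[of UNIV "b1 t" "\<lambda>x. blinfun_apply (b2 t x)"])
      (use d2[OF t] M2(2)[OF t] in \<open>auto simp: norm_blinfun.rep_eq\<close>)
  have lt: "norm (b s x - b t x) \<le> Mt * \<bar>s - t\<bar>" if st: "s \<in> {0..T}" "t \<in> {0..T}" for s t x
  proof -
    have "norm (b s x - b t x) \<le> Mt * norm (s - t)"
    proof (rule differentiable_bound[of "{0..T}" "\<lambda>s. b s x" "\<lambda>r h. h *\<^sub>R bt r x"])
      fix r assume r: "r \<in> {0..T}"
      show "((\<lambda>s. b s x) has_derivative (\<lambda>h. h *\<^sub>R bt r x)) (at r within {0..T})"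
        using dt[OF r] by (simp add: has_vector_derivative_def)
      show "onorm (\<lambda>h. h *\<^sub>R bt r x) \<le> Mt"
        using Mt(2)[OF r, of x] by (intro onorm_le) (simp add: mult.commute[of Mt] mult_left_mono)
    qed (use st in auto)
    then show ?thesis by simp
  qed
  have div: "divergence (b t) x = (\<Sum>i\<in>UNIV. blinfun_apply (b1 t x) (axis i 1) $ i)" if "t \<in> {0..T}" for t x
    using frechet_derivative_at[OF d1[OF that, of x]] by (simp add: divergence_def)
  have ldiv: "\<bar>divergence (b t) x - divergence (b t) y\<bar> \<le> real CARD('n) * M2 * norm (x - y)"
    if t: "t \<in> {0..T}" for t x y
  proof -
    have "divergence (b t) x - divergence (b t) y = (\<Sum>i\<in>UNIV. blinfun_apply (b1 t x - b1 t y) (axis i 1) $ i)"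
      by (simp add: div[OF t] blinfun.diff_left sum_subtractf)
    also have "\<bar>\<dots>\<bar> \<le> (\<Sum>i\<in>(UNIV::'n set). M2 * norm (x - y))"
    proof (rule order_trans[OF sum_abs sum_mono])
      fix i :: 'n
      have "\<bar>blinfun_apply (b1 t x - b1 t y) (axis i 1) $ i\<bar> \<le> norm (blinfun_apply (b1 t x - b1 t y) (axis i 1))"
        by (rule component_le_norm_cart)
      also have "\<dots> \<le> norm (b1 t x - b1 t y) * norm (axis i (1::real))"
        by (rule norm_blinfun)
      also have "\<dots> \<le> M2 * norm (x - y)"
        using l2[OF t] by (simp add: norm_axis_1)
      finally show "\<bar>blinfun_apply (b1 t x - b1 t y) (axis i 1) $ i\<bar> \<le> M2 * norm (x - y)" .
    qed
    finally show ?thesis by simp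
  qed
  have "continuous_on ({0..T} \<times> UNIV) (\<lambda>p. \<Sum>i\<in>UNIV. blinfun_apply (case p of (t, x) \<Rightarrow> b1 t x) (axis i 1) $ i)"
    using b1 unfolding bdd_cont_on_def
    by (intro continuous_on_sum continuous_on_component blinfun.continuous_on continuous_on_const) auto
  then have cdiv: "continuous_on ({0..T} \<times> UNIV) (\<lambda>(t, x). divergence (b t) x)"
    by (rule continuous_on_eq) (auto simp: div)
  have cb: "continuous_on ({0..T} \<times> UNIV) (\<lambda>(t, x). b t x)"
    using b by (simp add: bdd_cont_on_def)
  show thesis
  proof (rule that[OF _ _ cb _ _ cdiv ldiv])
    show "0 \<le> max M1 Mt" "0 \<le> real CARD('n) * M2" using M1 M2 by auto
    show "norm (b t x - b t y) \<le> max M1 Mt * norm (x - y)" if "t \<in> {0..T}" for t x y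
      using l1[OF that, of x y] by (rule order_trans) (intro mult_right_mono, auto)
    show "norm (b s x - b t x) \<le> max M1 Mt * \<bar>s - t\<bar>" if "s \<in> {0..T}" "t \<in> {0..T}" for s t x
      using lt[OF that, of x] by (rule order_trans) (intro mult_right_mono, auto)
  qed
qed

lemma LINT_Icc_eq_integral:
  fixes f :: "real \<Rightarrow> 'a::euclidean_space"
  assumes "continuous_on {0..T} f" "r \<in> {0..T}"
  shows "(LBINT s:{0..r}. f s) = integral {0..r} f"
  using assms by (intro set_borel_integral_eq_integral borel_integrable_atLeastAtMost')
    (auto intro: continuous_on_subset)

section \<open>Admissibility of drift integrals and comparison with the zero-noise path\<close>

context fractional_noise
begin

text \<open>Regularity shared by the zero-noise path and all admissible paths, and preserved well
  enough by the drift to make \<open>s \<mapsto> b s (\<phi> s)\<close>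
  \<open>regular\<close>.\<close>

definition half_regular :: "(real \<Rightarrow> real^'n) \<Rightarrow> bool" where
  "half_regular \<phi> \<longleftrightarrow> continuous_on {0..T} \<phi> \<and>
    (1/2 < H \<longrightarrow> (\<exists>L\<ge>0. \<forall>r\<in>{0..T}. \<forall>s\<in>{0..T}. norm (\<phi> s - \<phi> r) \<le> L * \<bar>s - r\<bar> powr (1/2)))"

lemma regular_drift:
  assumes \<Lambda>: "0 \<le> \<Lambda>"
    and cb: "continuous_on ({0..T} \<times> UNIV) (\<lambda>(t, x). b t x)"
    and lx: "\<And>t x y. t \<in> {0..T} \<Longrightarrow> norm (b t x - b t y) \<le> \<Lambda> * norm (x - y)"
    and lt: "\<And>s t x. s \<in> {0..T} \<Longrightarrow> t \<in> {0..T} \<Longrightarrow> norm (b s x - b t x) \<le> \<Lambda> * \<bar>s - t\<bar>"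
    and \<phi>: "half_regular \<phi>"
  shows "regular (\<lambda>s. b s (\<phi> s))"
proof -
  have c\<phi>: "continuous_on {0..T} \<phi>" using \<phi> by (simp add: half_regular_def)
  have "continuous_on {0..T} (\<lambda>s. case (s, \<phi> s) of (t, x) \<Rightarrow> b t x)"
    by (rule continuous_on_compose2[OF cb continuous_on_Pair[OF continuous_on_id c\<phi>]]) auto
  then have "continuous_on {0..T} (\<lambda>s. b s (\<phi> s))" by simp
  moreover have "\<exists>L \<gamma>. H - 1/2 < \<gamma> \<and> \<gamma> \<le> 1 \<and> 0 \<le> L \<and>
      (\<forall>r\<in>{0..T}. \<forall>s\<in>{0..T}. norm (b s (\<phi> s) - b r (\<phi> r)) \<le> L * \<bar>s - r\<bar> powr \<gamma>)" if H2: "1/2 < H"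
  proof -
    obtain L where L: "0 \<le> L" "\<And>r s. r \<in> {0..T} \<Longrightarrow> s \<in> {0..T} \<Longrightarrow> norm (\<phi> s - \<phi> r) \<le> L * \<bar>s - r\<bar> powr (1/2)"
      using \<phi> H2 by (auto simp: half_regular_def)
    have "norm (b s (\<phi> s) - b r (\<phi> r)) \<le> (\<Lambda> * T powr (1/2) + \<Lambda> * L) * \<bar>s - r\<bar> powr (1/2)"
      if r: "r \<in> {0..T}" and s: "s \<in> {0..T}" for r s
    proof -
      have h: "\<bar>s - r\<bar> \<le> T powr (1/2) * \<bar>s - r\<bar> powr (1/2)"
        using lipschitz_imp_holder[of "\<bar>s - r\<bar>" T "1/2"] r s by auto
      have "norm (b s (\<phi> s) - b r (\<phi> r)) \<le> norm (b s (\<phi> s) - b r (\<phi> s)) + norm (b r (\<phi> s) - b r (\<phi> r))"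
        using norm_triangle_ineq[of "b s (\<phi> s) - b r (\<phi> s)" "b r (\<phi> s) - b r (\<phi> r)"] by simp
      also have "\<dots> \<le> \<Lambda> * \<bar>s - r\<bar> + \<Lambda> * norm (\<phi> s - \<phi> r)"
        using lt[OF s r] lx[OF r] by (intro add_mono)
      also have "\<dots> \<le> \<Lambda> * (T powr (1/2) * \<bar>s - r\<bar> powr (1/2)) + \<Lambda> * (L * \<bar>s - r\<bar> powr (1/2))"
        using h L(2)[OF r s] \<Lambda> by (intro add_mono mult_left_mono)
      finally show ?thesis by (simp add: algebra_simps)
    qed
    then show ?thesis
      using H L \<Lambda> by (intro exI[of _ "\<Lambda> * T powr (1/2) + \<Lambda> * L"] exI[of _ "1/2"]) auto
  qed
  ultimately show ?thesis unfolding regular_def by blast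
qed

lemma ode_solution_half_regular:
  assumes X: "\<And>t. t \<in> {0..T} \<Longrightarrow> (X has_vector_derivative F t) (at t within {0..T})"
    and F: "continuous_on {0..T} F"
  shows "half_regular X" and "\<And>t. t \<in> {0..T} \<Longrightarrow> X t - X 0 = integral {0..t} F"
proof -
  have cX: "continuous_on {0..T} X"
    using X by (intro continuous_on_vector_derivative) auto
  have ftc: "integral {s..t} F = X t - X s" if "0 \<le> s" "s \<le> t" "t \<le> T" for s t
  proof (rule integral_unique, rule fundamental_theorem_of_calculus[OF \<open>s \<le> t\<close>])
    fix y assume "y \<in> {s..t}"
    then show "(X has_vector_derivative F y) (at y within {s..t})"
      using X[of y] that by (auto intro: has_vector_derivative_within_subset)
  qed
  then show "\<And>t. t \<in> {0..T} \<Longrightarrow> X t - X 0 = integral {0..t} F" by simp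
  obtain M where M: "0 < M" "\<And>s. s \<in> {0..T} \<Longrightarrow> norm (F s) \<le> M"
    using continuous_on_Icc_bounded[OF F] by auto
  have le: "norm (X t - X s) \<le> M * T powr (1/2) * (t - s) powr (1/2)" if st: "0 \<le> s" "s \<le> t" "t \<le> T" for s t
  proof -
    have "norm (integral {s..t} F) \<le> M * (t - s)"
      using st M by (intro integral_bound continuous_on_subset[OF F]) auto
    also have "\<dots> \<le> M * (T powr (1/2) * (t - s) powr (1/2))"
      using M lipschitz_imp_holder[of "t - s" T "1/2"] st by (intro mult_left_mono) auto
    finally show ?thesis using ftc[OF st] by simp
  qed
  have "norm (X s - X r) \<le> M * T powr (1/2) * \<bar>s - r\<bar> powr (1/2)" if "r \<in> {0..T}" "s \<in> {0..T}" for r s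
    using le[of r s] le[of s r] that by (cases "r \<le> s") (auto simp: norm_minus_commute)
  moreover have "0 \<le> M * T powr (1/2)" using M by simp
  ultimately show "half_regular X"
    unfolding half_regular_def using cX by blast
qed

text \<open>The embedding supplies continuity for every \<open>H\<close>. For \<open>H > 1/2\<close>
  its exponent may lie below \<open>H - 1/2\<close>, so the order 1/2 is taken from
  \<open>CM_space_regular\<close>.\<close>

lemma free_paths_half_regular:
  assumes \<phi>: "\<phi> \<in> free_paths H T \<sigma> x0" and emb: "embeds_in_holder H T \<sigma> \<beta>" and \<beta>: "0 < \<beta>"
  shows "half_regular \<phi>" and "\<phi> 0 = x0"
proof -
  have h: "(\<lambda>t. \<phi> t - x0) \<in> CM_space H T \<sigma>" using \<phi> by (simp add: free_paths_def)
  show "\<phi> 0 = x0" using CM_space_regular(2)[OF h] by simp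
  obtain L where "holder_norm T \<beta> (\<lambda>t. \<phi> t - x0) \<le> ereal (L * CM_norm H T \<sigma> (\<lambda>t. \<phi> t - x0))"
    using emb h unfolding embeds_in_holder_def by blast
  then have le: "norm (\<phi> t - \<phi> s) \<le> L * CM_norm H T \<sigma> (\<lambda>t. \<phi> t - x0) * \<bar>t - s\<bar> powr \<beta>"
    if "s \<in> {0..T}" "t \<in> {0..T}" for s t
    using that unfolding holder_norm_le_iff by (cases "s = t") auto
  have "continuous_on {0..T} \<phi>"
  proof (rule holder_on_imp_continuous_on[OF \<beta>])
    fix s t assume "s \<in> {0..T}" "t \<in> {0..T}" "s \<le> t"
    then show "norm (\<phi> t - \<phi> s) \<le> L * CM_norm H T \<sigma> (\<lambda>t. \<phi> t - x0) * (t - s) powr \<beta>"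
      using le[of s t] by simp
  qed
  then show "half_regular \<phi>"
    unfolding half_regular_def using CM_space_regular(1)[OF h] by simp
qed

lemma minimizer_estimate:
  assumes b: "Cb13 T b"
    and X: "\<And>t. t \<in> {0..T} \<Longrightarrow> (X has_vector_derivative b t (X t)) (at t within {0..T})"
    and X0: "X 0 = x0"
    and A: "A = bridge_paths H T \<sigma> x0 (X T) \<or> A = free_paths H T \<sigma> x0"
    and \<beta>: "0 < \<beta>" "\<beta> < 1" and emb: "embeds_in_holder H T \<sigma> \<beta>"
  shows "\<exists>C>0. \<forall>\<epsilon>>0. \<forall>\<phi>. is_arg_min (J H T b \<sigma> x0 \<epsilon>) (\<lambda>\<psi>. \<psi> \<in> A) \<phi> \<longrightarrow>
           holder_norm T \<beta> (\<lambda>t. \<phi> t - X t) \<le> ereal (C * \<epsilon>)"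
proof -
  obtain \<Lambda> D where \<Lambda>: "0 \<le> \<Lambda>" and D: "0 \<le> D"
    and cb: "continuous_on ({0..T} \<times> UNIV) (\<lambda>(t, x). b t x)"
    and lx: "\<And>t x y. t \<in> {0..T} \<Longrightarrow> norm (b t x - b t y) \<le> \<Lambda> * norm (x - y)"
    and lt: "\<And>s t x. s \<in> {0..T} \<Longrightarrow> t \<in> {0..T} \<Longrightarrow> norm (b s x - b t x) \<le> \<Lambda> * \<bar>s - t\<bar>"
    and cdiv: "continuous_on ({0..T} \<times> UNIV) (\<lambda>(t, x). divergence (b t) x)"
    and ldiv: "\<And>t x y. t \<in> {0..T} \<Longrightarrow> \<bar>divergence (b t) x - divergence (b t) y\<bar> \<le> D * norm (x - y)"
    using Cb13_bounds[OF b] by metis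
  have reg: "regular (\<lambda>s. b s (\<psi> s))" if "half_regular \<psi>" for \<psi>
    using \<Lambda> cb lx lt that by (rule regular_drift)
  have compose: "continuous_on {0..T} (\<lambda>s. f s (\<psi> s))"
    if "continuous_on ({0..T} \<times> UNIV) (\<lambda>(t, x). f t x)" "continuous_on {0..T} \<psi>"
    for f :: "real \<Rightarrow> real^'n \<Rightarrow> 'b::topological_space" and \<psi>
    using continuous_on_compose2[OF that(1) continuous_on_Pair[OF continuous_on_id that(2)]] by auto
  have cX: "continuous_on {0..T} X"
    using X by (intro continuous_on_vector_derivative) auto
  have X_reg: "half_regular X" and X_int: "\<And>t. t \<in> {0..T} \<Longrightarrow> X t - x0 = integral {0..t} (\<lambda>s. b s (X s))"
    using ode_solution_half_regular[OF X compose[OF cb cX]] X0 by auto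
  have "X \<in> free_paths H T \<sigma> x0"
    unfolding free_paths_def using integral_in_CM_space[OF reg[OF X_reg] X_int] by simp
  \<comment> \<open>The prescribed endpoint is \<open>X T\<close>, so \<open>X\<close> is a
    competitor under both choices of \<open>A\<close>.\<close>
  then have X_A: "X \<in> A" and A_sub: "A \<subseteq> free_paths H T \<sigma> x0"
    using A by (auto simp: bridge_paths_def)
  define d where "d = d_H H"
  have d: "0 \<le> d" unfolding d_def using H0 H by (intro d_H_nonneg)
  have JX: "J H T b \<sigma> x0 \<epsilon> X = d / 2 * (LBINT t:{0..T}. divergence (b t) (X t))" for \<epsilon>
  proof -
    have "X r - x0 - (LBINT s:{0..r}. b s (X s)) = 0" if "r \<in> {0..T}" for r
      using X_int[OF that] LINT_Icc_eq_integral[OF compose[OF cb cX] that] by simp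
    from K_sigma_inv_zero[OF this] show ?thesis by (simp add: J_def d_def)
  qed
  obtain L' where L': "\<And>h. h \<in> CM_space H T \<sigma> \<Longrightarrow> holder_norm T \<beta> h \<le> ereal (L' * CM_norm H T \<sigma> h)"
    using emb unfolding embeds_in_holder_def by blast
  \<comment> \<open>The embedding constant is only known to be some real number; enlarging it to a
    nonnegative one keeps the estimate, since the norm is nonnegative.\<close>
  define L where "L = max L' 0"
  have L0: "0 \<le> L" by (simp add: L_def)
  have norm0: "0 \<le> CM_norm H T \<sigma> h" for h
    unfolding CM_norm_def L2_norm_def set_lebesgue_integral_def
    by (intro real_sqrt_ge_zero Bochner_Integration.integral_nonneg) simp
  have L: "norm (h t - h s) \<le> L * CM_norm H T \<sigma> h * \<bar>t - s\<bar> powr \<beta>"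
    if "h \<in> CM_space H T \<sigma>" "s \<in> {0..T}" "t \<in> {0..T}" for h s t
  proof (cases "s = t")
    case False
    then have "norm (h t - h s) \<le> L' * CM_norm H T \<sigma> h * \<bar>t - s\<bar> powr \<beta>"
      using L'[OF that(1)] that unfolding holder_norm_le_iff by blast
    also have "\<dots> \<le> L * CM_norm H T \<sigma> h * \<bar>t - s\<bar> powr \<beta>"
      using norm0 by (intro mult_right_mono) (auto simp: L_def)
    finally show ?thesis .
  qed simp
  \<comment> \<open>With \<open>N\<close> the norm of \<open>h\<close>: \<open>C1 * N\<close> bounds
    the uniform distance of \<phi> and \<open>X\<close>, by Gronwall. \<open>C2\<close> collects the
    resulting bound for the divergence difference over [0,T]. \<open>C3\<close> bounds the Hoelder
    norm, adding to that of \<open>h\<close> the Lipschitz bound of the drift integral, converted to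
    order \<beta> by \<open>T powr (1 - \<beta>)\<close>.\<close>
  define C1 where "C1 = L * T powr \<beta> * exp (\<Lambda> * T)"
  have C1: "0 \<le> C1" using L0 by (simp add: C1_def)
  define C2 where "C2 = d * (D * C1 * T)"
  define C3 where "C3 = L + \<Lambda> * C1 * T powr (1 - \<beta>)"
  have C2: "0 \<le> C2" using d D C1 T by (simp add: C2_def)
  have C3: "0 \<le> C3" using L0 \<Lambda> C1 by (simp add: C3_def)
  have main: "holder_norm T \<beta> (\<lambda>t. \<phi> t - X t) \<le> ereal (C3 * C2 * \<epsilon>)"
    if \<epsilon>: "0 < \<epsilon>" and min: "is_arg_min (J H T b \<sigma> x0 \<epsilon>) (\<lambda>\<psi>. \<psi> \<in> A) \<phi>" for \<epsilon> \<phi>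
  proof -
    have \<phi>_A: "\<phi> \<in> A" and J_le: "J H T b \<sigma> x0 \<epsilon> \<phi> \<le> J H T b \<sigma> x0 \<epsilon> X"
      using min X_A by (auto simp: is_arg_min_def not_less)
    then have \<phi>: "\<phi> \<in> free_paths H T \<sigma> x0" using A_sub by blast
    have \<phi>_reg: "half_regular \<phi>" and \<phi>0: "\<phi> 0 = x0"
      using free_paths_half_regular[OF \<phi> emb \<beta>(1)] by auto
    have c\<phi>: "continuous_on {0..T} \<phi>" using \<phi>_reg by (simp add: half_regular_def)
    define h where "h = (\<lambda>r. \<phi> r - x0 - (LBINT s:{0..r}. b s (\<phi> s)))"
    have h_eq: "h t = \<phi> t - x0 - integral {0..t} (\<lambda>s. b s (\<phi> s))" if "t \<in> {0..T}" for t
      using LINT_Icc_eq_integral[OF compose[OF cb c\<phi>] that] by (simp add: h_def)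
    have h: "h \<in> CM_space H T \<sigma>"
    proof -
      have "(\<lambda>r. \<phi> r - x0) \<in> CM_space H T \<sigma>"
        using \<phi> by (simp add: free_paths_def)
      moreover have "(\<lambda>r. LBINT s:{0..r}. b s (\<phi> s)) \<in> CM_space H T \<sigma>"
        using LINT_Icc_eq_integral[OF compose[OF cb c\<phi>]] by (rule integral_in_CM_space[OF reg[OF \<phi>_reg]])
      ultimately show ?thesis
        unfolding h_def by (rule CM_space_diff)
    qed
    have h0: "h 0 = 0" by (rule CM_space_regular(2)[OF h])
    define N where "N = CM_norm H T \<sigma> h"
    have N0: "0 \<le> N" by (simp add: N_def norm0)
    \<comment> \<open>The norm and the energy in \<open>J\<close> use the same choice
      \<open>K_sigma_inv H T \<sigma> h\<close>, so the quadratic term is exactly \<open>N\<close>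
      squared divided by \<open>2 * \<epsilon>\<close>.\<close>
    have N2: "N\<^sup>2 = (LBINT t:{0..T}. (norm (K_sigma_inv H T \<sigma> h t))\<^sup>2)"
      unfolding N_def CM_norm_def L2_norm_def set_lebesgue_integral_def
      by (intro real_sqrt_pow2 Bochner_Integration.integral_nonneg) simp
    have int_b: "(\<lambda>s. b s (\<psi> s)) integrable_on {a..c}"
      if "continuous_on {0..T} \<psi>" "0 \<le> a" "c \<le> T" for \<psi> a c
      using that by (intro integrable_continuous_interval continuous_on_subset[OF compose[OF cb that(1)]]) auto
    have diff: "\<phi> t - X t = h t + integral {0..t} (\<lambda>s. b s (\<phi> s) - b s (X s))" if t: "t \<in> {0..T}" for t
    proof -
      have "integral {0..t} (\<lambda>s. b s (\<phi> s) - b s (X s))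
          = integral {0..t} (\<lambda>s. b s (\<phi> s)) - integral {0..t} (\<lambda>s. b s (X s))"
        using t by (intro Henstock_Kurzweil_Integration.integral_diff int_b c\<phi> cX) auto
      then show ?thesis using h_eq[OF t] X_int[OF t] by (simp add: algebra_simps)
    qed
    define y where "y t = norm (\<phi> t - X t)" for t
    have cy: "continuous_on {0..T} y"
      unfolding y_def by (intro continuous_on_norm continuous_on_diff c\<phi> cX)
    have sub: "continuous_on {a..c} f" if "continuous_on {0..T} f" "0 \<le> a" "c \<le> T"
      for f :: "real \<Rightarrow> 'c::topological_space" and a c
      using that by (intro continuous_on_subset[OF that(1)]) auto
    have cdb: "continuous_on {0..T} (\<lambda>s. b s (\<phi> s) - b s (X s))"
      by (rule continuous_on_diff[OF compose[OF cb c\<phi>] compose[OF cb cX]])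
    have y_bound: "y t \<le> C1 * N" if t: "t \<in> {0..T}" for t
    proof -
      have "y t \<le> L * N * T powr \<beta> * exp (\<Lambda> * t)"
      proof (rule gronwall[OF cy \<Lambda> _ t])
        fix t assume t: "t \<in> {0..T}"
        have "norm (h t) \<le> L * N * \<bar>t - 0\<bar> powr \<beta>"
          using L[OF h, of 0 t] h0 t T by (simp add: N_def)
        also have "\<dots> \<le> L * N * T powr \<beta>"
          using t \<beta> L0 N0 by (intro mult_left_mono powr_mono2) auto
        finally have 1: "norm (h t) \<le> L * N * T powr \<beta>" .
        have "norm (integral {0..t} (\<lambda>s. b s (\<phi> s) - b s (X s))) \<le> integral {0..t} (\<lambda>s. \<Lambda> * y s)"
          using t lx by (intro integral_norm_bound_integral integrable_continuous_interval
              continuous_on_mult continuous_on_const sub[OF cdb] sub[OF cy]) (auto simp: y_def)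
        then have 2: "norm (integral {0..t} (\<lambda>s. b s (\<phi> s) - b s (X s))) \<le> \<Lambda> * integral {0..t} y"
          by simp
        show "y t \<le> L * N * T powr \<beta> + \<Lambda> * integral {0..t} y"
          unfolding y_def[of t] diff[OF t] using 1 2
          by (intro order_trans[OF norm_triangle_ineq] add_mono)
      qed
      also have "\<dots> \<le> L * N * T powr \<beta> * exp (\<Lambda> * T)"
        using t \<Lambda> L0 N0 by (intro mult_left_mono) (auto intro: mult_left_mono)
      finally show ?thesis by (simp add: C1_def mult_ac)
    qed
    have "N\<^sup>2 \<le> \<epsilon> * (C2 * N)"
    proof -
      let ?I = "\<lambda>\<psi>. LBINT t:{0..T}. divergence (b t) (\<psi> t)"
      have T': "T \<in> {0..T}" using T by simp
      have eqI: "?I \<psi> = integral {0..T} (\<lambda>t. divergence (b t) (\<psi> t))" if "continuous_on {0..T} \<psi>" for \<psi>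
        using compose[OF cdiv that] T' by (rule LINT_Icc_eq_integral)
      have "?I X - ?I \<phi> = integral {0..T} (\<lambda>t. divergence (b t) (X t) - divergence (b t) (\<phi> t))"
        unfolding eqI[OF cX] eqI[OF c\<phi>]
        by (rule Henstock_Kurzweil_Integration.integral_diff[symmetric])
          (rule integrable_continuous_interval compose[OF cdiv cX] compose[OF cdiv c\<phi>])+
      also have "\<dots> \<le> norm (integral {0..T} (\<lambda>t. divergence (b t) (X t) - divergence (b t) (\<phi> t)))"
        by simp
      also have "\<dots> \<le> (D * (C1 * N)) * (T - 0)"
      proof (rule integral_bound)
        fix t assume t: "t \<in> {0..T}"
        have "\<bar>divergence (b t) (X t) - divergence (b t) (\<phi> t)\<bar> \<le> D * norm (X t - \<phi> t)"
          using t by (rule ldiv)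
        also have "\<dots> \<le> D * (C1 * N)"
          using y_bound[OF t] D by (intro mult_left_mono) (auto simp: y_def norm_minus_commute)
        finally show "norm (divergence (b t) (X t) - divergence (b t) (\<phi> t)) \<le> D * (C1 * N)" by simp
      qed (use T continuous_on_diff[OF compose[OF cdiv cX] compose[OF cdiv c\<phi>]] in auto)
      finally have I_le: "?I X - ?I \<phi> \<le> D * C1 * T * N" by (simp add: mult_ac)
      have "1 / (2 * \<epsilon>) * N\<^sup>2 + d / 2 * ?I \<phi> \<le> d / 2 * ?I X"
        using J_le unfolding JX by (simp add: J_def N2 h_def d_def)
      then have "N\<^sup>2 \<le> \<epsilon> * (d * (?I X - ?I \<phi>))"
        using \<epsilon> by (simp add: field_simps)
      also have "\<dots> \<le> \<epsilon> * (d * (D * C1 * T * N))"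
        using \<epsilon> d I_le by (intro mult_left_mono) auto
      finally show ?thesis by (simp add: C2_def mult_ac)
    qed
    \<comment> \<open>One factor \<open>N\<close> cancels unless \<open>N = 0\<close>; this passes
      from a quadratic inequality to the linear rate.\<close>
    then have N: "N \<le> C2 * \<epsilon>"
      using N0 C2 \<epsilon> by (cases "N = 0") (auto simp: power2_eq_square mult_ac)
    let ?B = "(\<lambda>r. b r (\<phi> r) - b r (X r))"
    have hN: "norm ((\<phi> t - X t) - (\<phi> s - X s)) \<le> C3 * N * \<bar>t - s\<bar> powr \<beta>" if s: "s \<in> {0..T}" and t: "t \<in> {0..T}" for s t
    proof -
      have bnd: "norm (integral {p..q} ?B) \<le> \<Lambda> * (C1 * N) * (q - p)"
        if "0 \<le> p" "p \<le> q" "q \<le> T" for p q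
      proof (rule integral_bound[OF \<open>p \<le> q\<close>])
        show "continuous_on {p..q} ?B" using that(1,3) by (rule sub[OF cdb])
        fix r assume "r \<in> {p..q}"
        then have r: "r \<in> {0..T}" using that by auto
        have "norm (b r (\<phi> r) - b r (X r)) \<le> \<Lambda> * y r" using lx[OF r] by (simp add: y_def)
        also have "\<dots> \<le> \<Lambda> * (C1 * N)" using y_bound[OF r] \<Lambda> by (rule mult_left_mono)
        finally show "norm (b r (\<phi> r) - b r (X r)) \<le> \<Lambda> * (C1 * N)" .
      qed
      have comb: "integral {0..q} ?B - integral {0..p} ?B
          = integral {p..q} ?B" if "0 \<le> p" "p \<le> q" "q \<le> T" for p q
      proof -
        have "?B integrable_on {0..q}"
          using that by (intro integrable_continuous_interval sub[OF cdb]) auto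
        from Henstock_Kurzweil_Integration.integral_combine[OF that(1,2) this] show ?thesis
          by (simp add: algebra_simps)
      qed
      have "norm (integral {0..t} ?B - integral {0..s} ?B)
          \<le> \<Lambda> * (C1 * N) * \<bar>t - s\<bar>"
        using bnd[of s t] comb[of s t] bnd[of t s] comb[of t s] s t
        by (cases "s \<le> t") (auto simp: norm_minus_commute)
      also have "\<dots> \<le> \<Lambda> * (C1 * N) * (T powr (1 - \<beta>) * \<bar>t - s\<bar> powr \<beta>)"
        using s t \<beta> \<Lambda> C1 N0 by (intro mult_left_mono lipschitz_imp_holder) auto
      finally have 2: "norm (integral {0..t} ?B - integral {0..s} ?B)
          \<le> \<Lambda> * (C1 * N) * (T powr (1 - \<beta>) * \<bar>t - s\<bar> powr \<beta>)" .
      have 1: "norm (h t - h s) \<le> L * N * \<bar>t - s\<bar> powr \<beta>"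
        using L[OF h s t] by (simp add: N_def)
      have "norm ((\<phi> t - X t) - (\<phi> s - X s)) = norm ((h t - h s)
          + (integral {0..t} ?B - integral {0..s} ?B))"
        using diff[OF s] diff[OF t] by (simp add: algebra_simps)
      also have "\<dots> \<le> L * N * \<bar>t - s\<bar> powr \<beta> + \<Lambda> * (C1 * N) * (T powr (1 - \<beta>) * \<bar>t - s\<bar> powr \<beta>)"
        using 1 2 by (intro order_trans[OF norm_triangle_ineq] add_mono)
      also have "\<dots> = C3 * N * \<bar>t - s\<bar> powr \<beta>" by (simp add: C3_def algebra_simps)
      finally show ?thesis .
    qed
    have N_C: "C3 * N * \<bar>t - s\<bar> powr \<beta> \<le> C3 * C2 * \<epsilon> * \<bar>t - s\<bar> powr \<beta>" for s t
      using N C3 by (intro mult_right_mono) (auto simp: mult.assoc intro: mult_left_mono)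
    have "norm ((\<phi> t - X t) - (\<phi> s - X s)) \<le> C3 * C2 * \<epsilon> * \<bar>t - s\<bar> powr \<beta>"
      if "s \<in> {0..T}" "t \<in> {0..T}" for s t
      using hN[OF that] N_C by (rule order_trans)
    then show ?thesis
      unfolding holder_norm_le_iff by simp
  qed
  show ?thesis
  \<comment> \<open>The product may vanish, for instance if the divergence has Lipschitz bound 0;
    adding 1 makes the constant positive.\<close>
  proof (intro exI[of _ "C3 * C2 + 1"] conjI allI impI)
    show "0 < C3 * C2 + 1" using C2 C3 by (simp add: add_nonneg_pos)
    fix \<epsilon> :: real and \<phi>
    assume "0 < \<epsilon>" "is_arg_min (J H T b \<sigma> x0 \<epsilon>) (\<lambda>\<psi>. \<psi> \<in> A) \<phi>"
    then have "holder_norm T \<beta> (\<lambda>t. \<phi> t - X t) \<le> ereal (C3 * C2 * \<epsilon>)" by (rule main)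
    also have "\<dots> \<le> ereal ((C3 * C2 + 1) * \<epsilon>)" using \<open>0 < \<epsilon>\<close> by (simp add: algebra_simps)
    finally show "holder_norm T \<beta> (\<lambda>t. \<phi> t - X t) \<le> ereal ((C3 * C2 + 1) * \<epsilon>)" .
  qed
qed

end

theorem corollary4p13:
  fixes H T \<beta> :: real
    and b :: "real \<Rightarrow> real^'n \<Rightarrow> real^'n"
    and \<sigma> :: "real \<Rightarrow> real^'n^'n"
    and x0 :: "real^'n"
    and X :: "real \<Rightarrow> real^'n"
    and A :: "(real \<Rightarrow> real^'n) set"
  assumes "1/4 < H" and "H < 1" and "0 < T"
    and "Cb13 T b" and "diffusion_coeff T \<sigma>"
    and "\<And>t. t \<in> {0..T} \<Longrightarrow> (X has_vector_derivative b t (X t)) (at t within {0..T})"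
    and "X 0 = x0"
    and "A = bridge_paths H T \<sigma> x0 (X T) \<or> A = free_paths H T \<sigma> x0"
    and "0 < \<beta>" and "\<beta> < H" and "embeds_in_holder H T \<sigma> \<beta>"
  shows "\<exists>C>0. \<forall>\<epsilon>>0. \<forall>\<phi>. is_arg_min (J H T b \<sigma> x0 \<epsilon>) (\<lambda>\<psi>. \<psi> \<in> A) \<phi> \<longrightarrow>
           holder_norm T \<beta> (\<lambda>t. \<phi> t - X t) \<le> ereal (C * \<epsilon>)"
proof -
  have diag: "\<And>t i j. t \<in> {0..T} \<Longrightarrow> i \<noteq> j \<Longrightarrow> \<sigma> t $ i $ j = 0"
    and C1: "\<forall>i. C1_on T (\<lambda>t. \<sigma> t $ i $ i)"
    and low: "\<And>i. \<exists>m M. 0 < m \<and> (\<forall>t\<in>{0..T}. m \<le> \<sigma> t $ i $ i \<and> \<sigma> t $ i $ i \<le> M)"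
    using assms(5) unfolding diffusion_coeff_def by blast+
  obtain \<sigma>' where "\<And>i. continuous_on {0..T} (\<sigma>' i)"
    "\<And>i t. t \<in> {0..T} \<Longrightarrow> ((\<lambda>t. \<sigma> t $ i $ i) has_real_derivative \<sigma>' i t) (at t within {0..T})"
    using C1 unfolding C1_on_def by metis
  then interpret fractional_noise H T \<sigma> \<sigma>'
  proof unfold_locales
    fix i
    obtain m M where "0 < m" "\<forall>t\<in>{0..T}. m \<le> \<sigma> t $ i $ i \<and> \<sigma> t $ i $ i \<le> M"
      using low[of i] by blast
    then show "\<exists>m>0. \<forall>s\<in>{0..T}. m \<le> \<sigma> s $ i $ i"
      by auto
  qed (use assms(1-3) diag in auto)
  show ?thesis
    using assms by (intro minimizer_estimate) auto
qed

end
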